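(* Let $A$ be an $(l+1)\times(l+1)$ generalized Cartan matrix of untwisted affine type with Dynkin diagram $\Gamma$ (vertices $0,1,\dots,l$), let $U$ be the associated quantum affine algebra over $\mathbb Q(q)$, and let $E$ be a simply folded full heap over $\Gamma$. (i) Over the field $k=\mathbb Q(q)$, $V_E$ has the structure of a left $U$-module such that $E_i$ and $F_i$ act as $X_i$ and $Y_i$, and such that for all $h\in\mathbb Z\Pi^\vee$ we have $q^h.v_I=q^\lambda v_I$, where $\lambda\in\mathbb Z$ is such that $h.v_I=\lambda v_I$; here $\alpha_i^\vee$ is identified with the operator $H_i$ for $0\le i\le l$, and with the operator $D$ for $i=l+1$. (ii) The $U$-module $V_E$ is integrable and has a crystal basis $(\mathcal L,\mathcal B)$, where $\mathcal B=\{v_I: I\text{ is a proper ideal of }E\}$ (identified with its image in $\mathcal L/q\mathcal L$) and $\mathcal L$ is the free $\mathbb A_0$-module with $\mathcal B$ as a basis, where $\mathbb A_0\subset\mathbb Q(q)$ is the subring of rational functions regular at $q=0$.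
   Context: All generalized Cartan matrices have entries in $\{2,0,-1,-2\}$: $a_{ii}=2$, $a_{ij}\le0$ for $i\neq j$, $a_{ij}=0\iff a_{ji}=0$; simply laced means entries in $\{2,0,-1\}$. In the Dynkin diagram, whose vertex set $P$ indexes the rows, distinct $p,q$ are adjacent iff $a_{pq}\ne0$ (with an arrow pointing towards $p$ if $a_{pq}=-2$). Untwisted affine types are those denoted $X_l^{(1)}$ by Kac; vertex $0$ is the extra vertex. Labelled heap over $\Gamma$: $(E,\le,\varepsilon)$ with $(E,\le)$ a locally finite poset and $\varepsilon:E\to P$ such that (1) $\alpha,\beta$ are comparable whenever their labels are equal or adjacent; (2) $\le$ is the transitive closure of "$\alpha\le\beta$ and the labels of $\alpha,\beta$ are equal or adjacent". A heap is an isomorphism class of labelled heaps (work with a representative). $E$ is fibred if (a) each $\varepsilon^{-1}(p)$ is unbounded above and below, and (b) for adjacent $p,p'$ and $\varepsilon(\alpha)=p$ there is $\beta$ with $\varepsilon(\beta)=p'$ such that $\alpha$ covers $\beta$ or $\beta$ covers $\alpha$. $E$ is full if it is fibred and every open interval $(\alpha,\beta)$ with $\varepsilon(\alpha)=\varepsilon(\beta)=p$ and containing no element labelled $p$ satisfies $\sum_{\gamma\in(\alpha,\beta)}a_{p,\varepsilon(\gamma)}=-2$. An ideal is a downward closed subset; it is proper if it is nonempty, not all of $E$, and meets each $\varepsilon^{-1}(p)$ in a nonempty proper subset. Folding. Let $B$ be simply laced of untwisted affine type with Dynkin diagram $\Gamma'$, and $\mu$ a graph automorphism of $\Gamma'$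 of order exactly $2$ such that $p$ and $\mu(p)$ are never distinct adjacent vertices. Let $f(p)=\bar p$ be the $\mu$-orbit of $p$. Define $\overline B$, with diagram $\overline{\Gamma'}$, indexed by orbits: $\bar b_{\bar p\bar p}=2$; for $\bar p\ne\bar q$, $\bar b_{\bar p\bar q}=0$ if no element of $\bar p$ is adjacent to an element of $\bar q$, $-2$ if $p\ne\mu(p)$ and an element of $\bar q$ is adjacent to both $p$ and $\mu(p)$, and $-1$ otherwise. Let $E'=(E',\le,\varepsilon)$ be a full labelled heap over $\Gamma'$ such that whenever $\mu(p)$ and $q$ are equal or adjacent, every $\alpha\in\varepsilon^{-1}(p)$ and $\beta\in\varepsilon^{-1}(q)$ are comparable. Then $\overline{E'}=(E',\le,f\circ\varepsilon)$ is a full heap over $\overline{\Gamma'}$. A full heap $E$ over $\Gamma$ is simply folded if either $A$ is simply laced (and $E$ is any full heap over $\Gamma$), or $A$ is not simply laced and there exist a simply laced $B$ of untwisted affine type with Dynkin diagram $\Gamma'$, a graph automorphism $\mu$ of $\Gamma'$ of order exactly $2$ such that $p$ and $\mu(p)$ are never distinct adjacent vertices, and a full labelled heap $E'=(E',\le,\varepsilon)$ over $\Gamma'$ such that all $\alpha\in\varepsilon^{-1}(p)$, $\beta\in\varepsilon^{-1}(q)$ are comparable whenever $\mu(p)$ and $q$ are equal or adjacent, with $A=\overline B$ and $E=\overline{E'}$. Operators. $V_E$ has $k$-basis $\{v_I\}$, $I$ running over proper ideals of $E$. For a vertex $p$: $X_p(v_I)=v_{I\cup\{\alpha\}}$ if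 there is a (unique) $\alpha\in E\setminus I$ labelled $p$ with $I\cup\{\alpha\}$ an ideal, else $0$; $Y_p(v_I)=v_{I\setminus\{\alpha\}}$ if there is a (unique) $\alpha\in I$ labelled $p$ with $I\setminus\{\alpha\}$ an ideal, else $0$; $H_p(v_I)=-v_I$ in the case $X_p(v_I)\neq0$, $v_I$ in the case $Y_p(v_I)\ne0$, and $0$ otherwise (the cases are mutually exclusive). Number $\varepsilon^{-1}(0)=\{E(0,z):z\in\mathbb Z\}$ increasingly; $h(I)=\max\{t:E(0,t)\in I\}$ and $D(v_I)=h(I)v_I$. Quantum affine algebra. $\Pi=\{\alpha_0,\dots,\alpha_{l+1}\}$, $\Pi^\vee=\{\alpha_0^\vee,\dots,\alpha_{l+1}^\vee\}$ with $\mathbb Z$-bilinear pairing $\mathbb Z\Pi\times\mathbb Z\Pi^\vee\to\mathbb Z$: $\langle\alpha_j,\alpha_i^\vee\rangle=a_{ij}$ for $0\le i,j\le l$; $\langle\alpha_0,\alpha_{l+1}^\vee\rangle=\langle\alpha_{l+1},\alpha_0^\vee\rangle=1$; $\langle\alpha_i,\alpha_{l+1}^\vee\rangle=\langle\alpha_{l+1},\alpha_i^\vee\rangle=0$ for $1\le i\le l$; $\langle\alpha_{l+1},\alpha_{l+1}^\vee\rangle=0$. Set $[n]=(q^n-q^{-n})/(q-q^{-1})$, $[n]!=\prod_{i=1}^n[i]$, and $q_i=q$ if $\alpha_i$ is a short root (all roots being short in the simply laced case), $q_i=q^2$ if $\alpha_i$ is long. $U$ is the associative unital $\mathbb Q(q)$-algebra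 generated by $E_i,F_i$ ($0\le i\le l$), $q^h$ ($h\in\mathbb Z\Pi^\vee$) with relations $q^0=1$, $q^hq^{h'}=q^{h+h'}$, $q^hE_iq^{-h}=q^{\langle\alpha_i,h\rangle}E_i$, $q^hF_iq^{-h}=q^{-\langle\alpha_i,h\rangle}F_i$, $E_iF_j-F_jE_i=\delta_{ij}(t_i-t_i^{-1})/(q_i-q_i^{-1})$, and for $i\neq j$, $\sum_{p=0}^b(-1)^pE_i^{(p)}E_jE_i^{(b-p)}=\sum_{p=0}^b(-1)^pF_i^{(p)}F_jF_i^{(b-p)}=0$, where $t_i=q_i^{\alpha_i^\vee}$ (meaning $q^{s\alpha_i^\vee}$ when $q_i=q^s$), $b=1-\langle\alpha_j,\alpha_i^\vee\rangle$, $E_i^{(p)}=E_i^p/[p]!$, $F_i^{(p)}=F_i^p/[p]!$. Weight lattice: $\Lambda=\operatorname{Hom}_{\mathbb Z}(\mathbb Z\Pi^\vee,\mathbb Z)$. A $U$-module $M$ is integrable if all $E_i,F_i$ act locally nilpotently and $M=\bigoplus_{\lambda\in\Lambda}M_\lambda$, $M_\lambda=\{u: q^hu=q^{\langle\lambda,h\rangle}u\ \forall h\in\mathbb Z\Pi^\vee\}$. For integrable $M$ and each $0\le i\le l$, every element is uniquely a sum of elements $F_i^{(n)}u$ with $u\in\ker E_i\cap M_\lambda$, and the Kashiwara operators are $\tilde f_i(F_i^{(n)}u)=F_i^{(n+1)}u$, $\tilde e_i(F_i^{(n)}u)=F_i^{(n-1)}u$ (with $F_i^{(-1)}u=0$).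 A crystal basis of $M$ is a pair $(\mathcal L,\mathcal B)$ such that: (i) $\mathcal L$ is a free $\mathbb A_0$-submodule of $M$ with $M\cong\mathbb Q(q)\otimes_{\mathbb A_0}\mathcal L$; (ii) $\mathcal L=\bigoplus_\lambda\mathcal L_\lambda$, $\mathcal L_\lambda=\mathcal L\cap M_\lambda$; (iii) $\mathcal B$ is a $\mathbb Q$-basis of $\mathcal L/q\mathcal L\cong\mathbb Q\otimes_{\mathbb A_0}\mathcal L$; (iv) $\tilde e_i\mathcal L\subset\mathcal L$, $\tilde f_i\mathcal L\subset\mathcal L$; (v) the induced operators satisfy $\tilde e_i\mathcal B\subset\mathcal B\sqcup\{0\}$, $\tilde f_i\mathcal B\subset\mathcal B\sqcup\{0\}$; (vi) for $b,b'\in\mathcal B$, $b'=\tilde f_ib$ iff $b=\tilde e_ib'$. *)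

theory Defs
  imports
    "HOL-Library.Poly_Mapping"
    "HOL-Library.FuncSet"
    "HOL-Computational_Algebra.Polynomial"
    "HOL-Computational_Algebra.Fraction_Field"
    "HOL-Combinatorics.Permutations"
    "HOL-Algebra.QuotRing"
begin

section \<open>Generalized Cartan matrices\<close>

text \<open>
  An \<open>(l+1) \<times> (l+1)\<close> matrix is a function on pairs of naturals of which only the values at indices
  \<open>\<le> l\<close> matter; the vertex set of its Dynkin diagram is \<open>{..l}\<close>.
\<close>

definition gen_cartan_matrix :: "nat \<Rightarrow> (nat \<Rightarrow> nat \<Rightarrow> int) \<Rightarrow> bool" where
  "gen_cartan_matrix l A \<longleftrightarrow>
     (\<forall>i\<le>l. \<forall>j\<le>l. A i j \<in> {2, 0, -1, -2}) \<and>
     (\<forall>i\<le>l. A i i = 2) \<and>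
     (\<forall>i\<le>l. \<forall>j\<le>l. i \<noteq> j \<longrightarrow> A i j \<le> 0) \<and>
     (\<forall>i\<le>l. \<forall>j\<le>l. A i j = 0 \<longleftrightarrow> A j i = 0)"

definition simply_laced :: "nat \<Rightarrow> (nat \<Rightarrow> nat \<Rightarrow> int) \<Rightarrow> bool" where
  "simply_laced l A \<longleftrightarrow> (\<forall>i\<le>l. \<forall>j\<le>l. A i j \<in> {2, 0, -1})"

definition adjacent :: "(nat \<Rightarrow> nat \<Rightarrow> int) \<Rightarrow> nat \<Rightarrow> nat \<Rightarrow> bool" where
  "adjacent A p q \<longleftrightarrow> p \<noteq> q \<and> A p q \<noteq> 0"

text \<open>
  The untwisted affine types, with the vertex numbering of Kac's Table Aff 1. \<open>kac_edges\<close> lists each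
  edge once. A pair \<open>(i, j)\<close> in \<open>kac_double\<close> has entry \<open>a\<^sub>i\<^sub>j = -2\<close>, that is, the arrow points towards
  \<open>i\<close>. \<open>G\<^sub>2\<^sup>(\<^sup>1\<^sup>)\<close> is listed for completeness; its entry \<open>-3\<close> is not allowed by \<open>gen_cartan_matrix\<close>.
\<close>

datatype affine_type =
  Aff_A nat | Aff_B nat | Aff_C nat | Aff_D nat | Aff_E6 | Aff_E7 | Aff_E8 | Aff_F4 | Aff_G2

fun affine_rank :: "affine_type \<Rightarrow> nat" where
  "affine_rank (Aff_A l) = l"
| "affine_rank (Aff_B l) = l"
| "affine_rank (Aff_C l) = l"
| "affine_rank (Aff_D l) = l"
| "affine_rank Aff_E6 = 6"
| "affine_rank Aff_E7 = 7"
| "affine_rank Aff_E8 = 8"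
| "affine_rank Aff_F4 = 4"
| "affine_rank Aff_G2 = 2"

fun admissible :: "affine_type \<Rightarrow> bool" where
  "admissible (Aff_A l) \<longleftrightarrow> l \<ge> 1"
| "admissible (Aff_B l) \<longleftrightarrow> l \<ge> 3"
| "admissible (Aff_C l) \<longleftrightarrow> l \<ge> 2"
| "admissible (Aff_D l) \<longleftrightarrow> l \<ge> 4"
| "admissible _ \<longleftrightarrow> True"

definition path_edges :: "nat \<Rightarrow> nat \<Rightarrow> (nat \<times> nat) set" where
  "path_edges a b = {(i, Suc i) | i. a \<le> i \<and> i < b}"

fun kac_edges :: "affine_type \<Rightarrow> (nat \<times> nat) set" where
  "kac_edges (Aff_A l) = insert (0, l) (path_edges 0 l)"
| "kac_edges (Aff_B l) = insert (0, 2) (path_edges 1 l)"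
| "kac_edges (Aff_C l) = path_edges 0 l"
| "kac_edges (Aff_D l) = {(0, 2), (l - 2, l)} \<union> path_edges 1 (l - 1)"
| "kac_edges Aff_E6 = {(3, 6), (0, 6)} \<union> path_edges 1 5"
| "kac_edges Aff_E7 = insert (3, 7) (path_edges 0 6)"
| "kac_edges Aff_E8 = insert (5, 8) (path_edges 0 7)"
| "kac_edges Aff_F4 = path_edges 0 4"
| "kac_edges Aff_G2 = path_edges 0 2"

fun kac_double :: "affine_type \<Rightarrow> (nat \<times> nat) set" where
  "kac_double (Aff_A l) = (if l = 1 then {(0, 1), (1, 0)} else {})"
| "kac_double (Aff_B l) = {(l, l - 1)}"
| "kac_double (Aff_C l) = {(1, 0), (l - 1, l)}"
| "kac_double Aff_F4 = {(3, 2)}"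
| "kac_double _ = {}"

definition kac_matrix :: "affine_type \<Rightarrow> nat \<Rightarrow> nat \<Rightarrow> int" where
  "kac_matrix X i j =
     (if i = j then 2
      else if (i, j) \<in> kac_double X then -2
      else if X = Aff_G2 \<and> (i, j) = (2, 1) then -3
      else if (i, j) \<in> kac_edges X \<or> (j, i) \<in> kac_edges X then -1
      else 0)"

text \<open>The vertices other than the extra vertex \<open>0\<close> may be numbered arbitrarily.\<close>

definition untwisted_affine :: "nat \<Rightarrow> (nat \<Rightarrow> nat \<Rightarrow> int) \<Rightarrow> bool" where
  "untwisted_affine l A \<longleftrightarrow>
     (\<exists>X \<sigma>. admissible X \<and> affine_rank X = l \<and> \<sigma> permutes {..l} \<and> \<sigma> 0 = 0 \<and>
            (\<forall>i\<le>l. \<forall>j\<le>l. A (\<sigma> i) (\<sigma> j) = kac_matrix X i j))"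

section \<open>Full heaps\<close>

text \<open>
  The poset underlying a heap is a type of class \<open>order\<close>; the labelling is a function into the
  naturals.
\<close>

definition labelled_heap :: "nat \<Rightarrow> (nat \<Rightarrow> nat \<Rightarrow> int) \<Rightarrow> ('e::order \<Rightarrow> nat) \<Rightarrow> bool" where
  "labelled_heap l A \<epsilon> \<longleftrightarrow>
     (\<forall>\<alpha>. \<epsilon> \<alpha> \<le> l) \<and>
     (\<forall>\<alpha> \<beta>::'e. finite {\<alpha>..\<beta>}) \<and>
     (\<forall>\<alpha> \<beta>. \<epsilon> \<alpha> = \<epsilon> \<beta> \<or> adjacent A (\<epsilon> \<alpha>) (\<epsilon> \<beta>) \<longrightarrow> \<alpha> \<le> \<beta> \<or> \<beta> \<le> \<alpha>) \<and>
     ((\<le>) = (\<lambda>\<alpha> \<beta>. \<alpha> \<le> \<beta> \<and> (\<epsilon> \<alpha> = \<epsilon> \<beta> \<or> adjacent A (\<epsilon> \<alpha>) (\<epsilon> \<beta>)))\<^sup>+\<^sup>+)"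

definition covers :: "'e::order \<Rightarrow> 'e \<Rightarrow> bool" where
  "covers \<alpha> \<beta> \<longleftrightarrow> \<beta> < \<alpha> \<and> {\<beta><..<\<alpha>} = {}"

definition fibred :: "nat \<Rightarrow> (nat \<Rightarrow> nat \<Rightarrow> int) \<Rightarrow> ('e::order \<Rightarrow> nat) \<Rightarrow> bool" where
  "fibred l A \<epsilon> \<longleftrightarrow>
     (\<forall>p\<le>l. \<not> bdd_above {\<alpha>. \<epsilon> \<alpha> = p} \<and> \<not> bdd_below {\<alpha>. \<epsilon> \<alpha> = p}) \<and>
     (\<forall>p\<le>l. \<forall>p'\<le>l. \<forall>\<alpha>. adjacent A p p' \<and> \<epsilon> \<alpha> = p \<longrightarrow>
        (\<exists>\<beta>. \<epsilon> \<beta> = p' \<and> (covers \<alpha> \<beta> \<or> covers \<beta> \<alpha>)))"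

definition full_heap :: "nat \<Rightarrow> (nat \<Rightarrow> nat \<Rightarrow> int) \<Rightarrow> ('e::order \<Rightarrow> nat) \<Rightarrow> bool" where
  "full_heap l A \<epsilon> \<longleftrightarrow>
     labelled_heap l A \<epsilon> \<and> fibred l A \<epsilon> \<and>
     (\<forall>p \<alpha> \<beta>. \<alpha> < \<beta> \<and> \<epsilon> \<alpha> = p \<and> \<epsilon> \<beta> = p \<and> (\<forall>\<gamma>\<in>{\<alpha><..<\<beta>}. \<epsilon> \<gamma> \<noteq> p) \<longrightarrow>
        (\<Sum>\<gamma>\<in>{\<alpha><..<\<beta>}. A p (\<epsilon> \<gamma>)) = -2)"

definition order_ideal :: "'e::order set \<Rightarrow> bool" where
  "order_ideal I \<longleftrightarrow> (\<forall>\<beta>\<in>I. \<forall>\<alpha>\<le>\<beta>. \<alpha> \<in> I)"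

definition proper_ideals :: "nat \<Rightarrow> ('e::order \<Rightarrow> nat) \<Rightarrow> 'e set set" where
  "proper_ideals l \<epsilon> =
     {I. order_ideal I \<and> I \<noteq> {} \<and> I \<noteq> UNIV \<and>
         (\<forall>p\<le>l. I \<inter> {\<alpha>. \<epsilon> \<alpha> = p} \<noteq> {} \<and> I \<inter> {\<alpha>. \<epsilon> \<alpha> = p} \<noteq> {\<alpha>. \<epsilon> \<alpha> = p})}"

section \<open>Folding\<close>

definition folding_automorphism :: "nat \<Rightarrow> (nat \<Rightarrow> nat \<Rightarrow> int) \<Rightarrow> (nat \<Rightarrow> nat) \<Rightarrow> bool" where
  "folding_automorphism m B \<mu> \<longleftrightarrow>
     \<mu> permutes {..m} \<and>
     (\<forall>p\<le>m. \<forall>q\<le>m. adjacent B (\<mu> p) (\<mu> q) \<longleftrightarrow> adjacent B p q) \<and>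
     \<mu> \<circ> \<mu> = id \<and> \<mu> \<noteq> id \<and>
     (\<forall>p\<le>m. \<not> adjacent B p (\<mu> p))"

definition orbit_of :: "(nat \<Rightarrow> nat) \<Rightarrow> nat \<Rightarrow> nat set" where
  "orbit_of \<mu> p = {p, \<mu> p}"

definition folded_matrix :: "(nat \<Rightarrow> nat \<Rightarrow> int) \<Rightarrow> (nat \<Rightarrow> nat) \<Rightarrow> nat set \<Rightarrow> nat set \<Rightarrow> int" where
  "folded_matrix B \<mu> P Q =
     (if P = Q then 2
      else if \<not> (\<exists>p\<in>P. \<exists>q\<in>Q. adjacent B p q) then 0
      else if \<exists>p\<in>P. p \<noteq> \<mu> p \<and> (\<exists>q\<in>Q. adjacent B q p \<and> adjacent B q (\<mu> p)) then -2
      else -1)"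

text \<open>
  In the second disjunct the heap \<open>E'\<close> is the poset of \<open>E\<close> with another labelling \<open>\<epsilon>'\<close>, and the
  bijection \<open>\<phi>\<close> identifies the orbits, which index the folded matrix, with the vertices \<open>{..l}\<close>.
\<close>

definition simply_folded :: "nat \<Rightarrow> (nat \<Rightarrow> nat \<Rightarrow> int) \<Rightarrow> ('e::order \<Rightarrow> nat) \<Rightarrow> bool" where
  "simply_folded l A \<epsilon> \<longleftrightarrow> full_heap l A \<epsilon> \<and>
     (simply_laced l A \<or>
      \<not> simply_laced l A \<and>
      (\<exists>m B \<mu> \<epsilon>' \<phi>.
         gen_cartan_matrix m B \<and> untwisted_affine m B \<and> simply_laced m B \<and>
         folding_automorphism m B \<mu> \<and>
         full_heap m B \<epsilon>' \<and>
         (\<forall>\<alpha> \<beta>. \<mu> (\<epsilon>' \<alpha>) = \<epsilon>' \<beta> \<or> adjacent B (\<mu> (\<epsilon>' \<alpha>)) (\<epsilon>' \<beta>) \<longrightarrow> \<alpha> \<le> \<beta> \<or> \<beta> \<le> \<alpha>) \<and>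
         bij_betw \<phi> (orbit_of \<mu> ` {..m}) {..l} \<and>
         (\<forall>P\<in>orbit_of \<mu> ` {..m}. \<forall>Q\<in>orbit_of \<mu> ` {..m}.
            A (\<phi> P) (\<phi> Q) = folded_matrix B \<mu> P Q) \<and>
         (\<forall>\<alpha>. \<epsilon> \<alpha> = \<phi> (orbit_of \<mu> (\<epsilon>' \<alpha>)))))"

section \<open>The field \<open>\<rat>(q)\<close>\<close>

type_synonym qrat = "rat poly fract"

definition qq :: qrat where
  "qq = Fract [:0, 1:] 1"

definition A0 :: "qrat set" where
  "A0 = {Fract a b | a b. poly b 0 \<noteq> 0}"

definition qint :: "nat \<Rightarrow> qrat" where
  "qint n = (qq ^ n - inverse (qq ^ n)) / (qq - inverse qq)"

definition qfact :: "nat \<Rightarrow> qrat" where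
  "qfact n = (\<Prod>i=1..n. qint i)"

section \<open>The space \<open>V\<^sub>E\<close> and its operators\<close>

text \<open>
  \<open>V\<^sub>E\<close> is carried by the finitely supported functions on sets of heap elements whose support
  consists of proper ideals; \<open>v\<^sub>I\<close> is the indicator of \<open>I\<close>.
\<close>

type_synonym 'e heap_vec = "'e set \<Rightarrow>\<^sub>0 qrat"

definition smult_vec :: "qrat \<Rightarrow> 'e heap_vec \<Rightarrow> 'e heap_vec" where
  "smult_vec c v = Poly_Mapping.map ((*) c) v"

definition basis_vec :: "'e set \<Rightarrow> 'e heap_vec" where
  "basis_vec I = Poly_Mapping.single I 1"

definition heap_space :: "nat \<Rightarrow> ('e::order \<Rightarrow> nat) \<Rightarrow> 'e heap_vec set" where
  "heap_space l \<epsilon> = {v. Poly_Mapping.keys v \<subseteq> proper_ideals l \<epsilon>}"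

definition lin_ext :: "('e set \<Rightarrow> 'e heap_vec) \<Rightarrow> 'e heap_vec \<Rightarrow> 'e heap_vec" where
  "lin_ext g v = (\<Sum>I\<in>Poly_Mapping.keys v. smult_vec (Poly_Mapping.lookup v I) (g I))"

definition addable :: "('e::order \<Rightarrow> nat) \<Rightarrow> nat \<Rightarrow> 'e set \<Rightarrow> 'e \<Rightarrow> bool" where
  "addable \<epsilon> p I \<alpha> \<longleftrightarrow> \<alpha> \<notin> I \<and> \<epsilon> \<alpha> = p \<and> order_ideal (I \<union> {\<alpha>})"

definition removable :: "('e::order \<Rightarrow> nat) \<Rightarrow> nat \<Rightarrow> 'e set \<Rightarrow> 'e \<Rightarrow> bool" where
  "removable \<epsilon> p I \<alpha> \<longleftrightarrow> \<alpha> \<in> I \<and> \<epsilon> \<alpha> = p \<and> order_ideal (I - {\<alpha>})"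

definition X_op :: "('e::order \<Rightarrow> nat) \<Rightarrow> nat \<Rightarrow> 'e heap_vec \<Rightarrow> 'e heap_vec" where
  "X_op \<epsilon> p = lin_ext (\<lambda>I. if \<exists>\<alpha>. addable \<epsilon> p I \<alpha>
                            then basis_vec (I \<union> {THE \<alpha>. addable \<epsilon> p I \<alpha>}) else 0)"

definition Y_op :: "('e::order \<Rightarrow> nat) \<Rightarrow> nat \<Rightarrow> 'e heap_vec \<Rightarrow> 'e heap_vec" where
  "Y_op \<epsilon> p = lin_ext (\<lambda>I. if \<exists>\<alpha>. removable \<epsilon> p I \<alpha>
                            then basis_vec (I - {THE \<alpha>. removable \<epsilon> p I \<alpha>}) else 0)"

definition H_op :: "('e::order \<Rightarrow> nat) \<Rightarrow> nat \<Rightarrow> 'e heap_vec \<Rightarrow> 'e heap_vec" where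
  "H_op \<epsilon> p = lin_ext (\<lambda>I. if X_op \<epsilon> p (basis_vec I) \<noteq> 0 then - basis_vec I
                            else if Y_op \<epsilon> p (basis_vec I) \<noteq> 0 then basis_vec I
                            else 0)"

text \<open>\<open>E0\<close> is an increasing numbering by \<open>\<int>\<close> of the heap elements labelled \<open>0\<close>.\<close>

definition heap_height :: "(int \<Rightarrow> 'e) \<Rightarrow> 'e set \<Rightarrow> int" where
  "heap_height E0 I = (GREATEST t. E0 t \<in> I)"

definition D_op :: "(int \<Rightarrow> 'e) \<Rightarrow> 'e heap_vec \<Rightarrow> 'e heap_vec" where
  "D_op E0 = lin_ext (\<lambda>I. smult_vec (of_int (heap_height E0 I)) (basis_vec I))"

section \<open>The quantum affine algebra\<close>

text \<open>
  The free monoid, written additively, so that \<open>'g free_word \<Rightarrow>\<^sub>0 qrat\<close> is the free associative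
  \<open>\<rat>(q)\<close>-algebra on \<open>'g\<close> with the multiplication of \<open>Poly_Mapping\<close>.
\<close>

datatype 'g free_word = Word (letters: "'g list")

instantiation free_word :: (type) monoid_add
begin

definition zero_free_word :: "'a free_word" where
  "0 = Word []"

definition plus_free_word :: "'a free_word \<Rightarrow> 'a free_word \<Rightarrow> 'a free_word" where
  "u + v = Word (letters u @ letters v)"

instance
  by standard (simp_all add: zero_free_word_def plus_free_word_def)

end

definition free_algebra :: "'g set \<Rightarrow> ('g free_word \<Rightarrow>\<^sub>0 qrat) ring" where
  "free_algebra S = \<lparr>carrier = {x. \<forall>w\<in>Poly_Mapping.keys x. set (letters w) \<subseteq> S},
                     mult = (*), one = 1, zero = 0, add = (+)\<rparr>"

definition fa_const :: "qrat \<Rightarrow> 'g free_word \<Rightarrow>\<^sub>0 qrat" where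
  "fa_const c = Poly_Mapping.single 0 c"

definition fa_gen :: "'g \<Rightarrow> 'g free_word \<Rightarrow>\<^sub>0 qrat" where
  "fa_gen g = Poly_Mapping.single (Word [g]) 1"

definition divided_power :: "('g free_word \<Rightarrow>\<^sub>0 qrat) \<Rightarrow> nat \<Rightarrow> 'g free_word \<Rightarrow>\<^sub>0 qrat" where
  "divided_power x n = fa_const (inverse (qfact n)) * x ^ n"

text \<open>
  \<open>\<int>\<Pi>\<^sup>\<or>\<close> consists of integer combinations of \<open>\<alpha>\<^sub>0\<^sup>\<or>, \<dots>, \<alpha>\<^sub>l\<^sub>+\<^sub>1\<^sup>\<or>\<close>; \<open>Poly_Mapping.single i 1\<close> is
  \<open>\<alpha>\<^sub>i\<^sup>\<or>\<close>. \<open>root_pairing l A j i\<close> is \<open>\<langle>\<alpha>\<^sub>j, \<alpha>\<^sub>i\<^sup>\<or>\<rangle>\<close>, and \<open>pairing l A j h\<close> is \<open>\<langle>\<alpha>\<^sub>j, h\<rangle>\<close>.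
\<close>

type_synonym coweight = "nat \<Rightarrow>\<^sub>0 int"

definition coroot_lattice :: "nat \<Rightarrow> coweight set" where
  "coroot_lattice l = {h. Poly_Mapping.keys h \<subseteq> {..l + 1}}"

definition root_pairing :: "nat \<Rightarrow> (nat \<Rightarrow> nat \<Rightarrow> int) \<Rightarrow> nat \<Rightarrow> nat \<Rightarrow> int" where
  "root_pairing l A j i =
     (if j \<le> l \<and> i \<le> l then A i j
      else if (j = 0 \<and> i = l + 1) \<or> (j = l + 1 \<and> i = 0) then 1
      else 0)"

definition pairing :: "nat \<Rightarrow> (nat \<Rightarrow> nat \<Rightarrow> int) \<Rightarrow> nat \<Rightarrow> coweight \<Rightarrow> int" where
  "pairing l A j h =
     (\<Sum>i\<in>Poly_Mapping.keys h. Poly_Mapping.lookup h i * root_pairing l A j i)"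

text \<open>
  The numbers \<open>d i\<close> of a symmetrizer are proportional to the squared lengths of the simple roots
  \<open>\<alpha>\<^sub>i\<close>. A simple root is short if none is shorter; in particular all are short in type
  \<open>A\<^sub>1\<^sup>(\<^sup>1\<^sup>)\<close>. \<open>root_exponent l A i\<close> is the \<open>s\<close> with \<open>q\<^sub>i = q\<^sup>s\<close>.
\<close>

definition symmetrizer :: "nat \<Rightarrow> (nat \<Rightarrow> nat \<Rightarrow> int) \<Rightarrow> (nat \<Rightarrow> int) \<Rightarrow> bool" where
  "symmetrizer l A d \<longleftrightarrow>
     (\<forall>i\<le>l. d i > 0) \<and> (\<forall>i\<le>l. \<forall>j\<le>l. d i * A i j = d j * A j i)"

definition short_root :: "nat \<Rightarrow> (nat \<Rightarrow> nat \<Rightarrow> int) \<Rightarrow> nat \<Rightarrow> bool" where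
  "short_root l A i \<longleftrightarrow> (\<exists>d. symmetrizer l A d \<and> (\<forall>j\<le>l. d i \<le> d j))"

definition root_exponent :: "nat \<Rightarrow> (nat \<Rightarrow> nat \<Rightarrow> int) \<Rightarrow> nat \<Rightarrow> nat" where
  "root_exponent l A i = (if short_root l A i then 1 else 2)"

definition q_root :: "nat \<Rightarrow> (nat \<Rightarrow> nat \<Rightarrow> int) \<Rightarrow> nat \<Rightarrow> qrat" where
  "q_root l A i = qq ^ root_exponent l A i"

text \<open>\<open>Gen_E i\<close>, \<open>Gen_F i\<close>, \<open>Gen_K h\<close> stand for \<open>E\<^sub>i\<close>, \<open>F\<^sub>i\<close>, \<open>q\<^sup>h\<close>.\<close>

datatype qgen = Gen_E nat | Gen_F nat | Gen_K coweight

definition qgens :: "nat \<Rightarrow> qgen set" where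
  "qgens l = Gen_E ` {..l} \<union> Gen_F ` {..l} \<union> Gen_K ` coroot_lattice l"

abbreviation fE :: "nat \<Rightarrow> qgen free_word \<Rightarrow>\<^sub>0 qrat" where "fE i \<equiv> fa_gen (Gen_E i)"
abbreviation fF :: "nat \<Rightarrow> qgen free_word \<Rightarrow>\<^sub>0 qrat" where "fF i \<equiv> fa_gen (Gen_F i)"
abbreviation fK :: "coweight \<Rightarrow> qgen free_word \<Rightarrow>\<^sub>0 qrat" where "fK h \<equiv> fa_gen (Gen_K h)"

definition t_coweight :: "nat \<Rightarrow> (nat \<Rightarrow> nat \<Rightarrow> int) \<Rightarrow> nat \<Rightarrow> coweight" where
  "t_coweight l A i = Poly_Mapping.single i (int (root_exponent l A i))"

definition serre_element ::
  "nat \<Rightarrow> (qgen free_word \<Rightarrow>\<^sub>0 qrat) \<Rightarrow> (qgen free_word \<Rightarrow>\<^sub>0 qrat) \<Rightarrow> qgen free_word \<Rightarrow>\<^sub>0 qrat" where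
  "serre_element b x y =
     (\<Sum>p=0..b. (-1) ^ p * divided_power x p * y * divided_power x (b - p))"

definition quantum_relations ::
  "nat \<Rightarrow> (nat \<Rightarrow> nat \<Rightarrow> int) \<Rightarrow> (qgen free_word \<Rightarrow>\<^sub>0 qrat) set" where
  "quantum_relations l A =
     {fK 0 - 1}
   \<union> {fK h * fK h' - fK (h + h') | h h'. h \<in> coroot_lattice l \<and> h' \<in> coroot_lattice l}
   \<union> {fK h * fE i * fK (- h) - fa_const (qq powi pairing l A i h) * fE i
        | h i. h \<in> coroot_lattice l \<and> i \<le> l}
   \<union> {fK h * fF i * fK (- h) - fa_const (qq powi (- pairing l A i h)) * fF i
        | h i. h \<in> coroot_lattice l \<and> i \<le> l}
   \<union> {fE i * fF j - fF j * fE i -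
        (if i = j
         then fa_const (inverse (q_root l A i - inverse (q_root l A i))) *
              (fK (t_coweight l A i) - fK (- t_coweight l A i))
         else 0)
        | i j. i \<le> l \<and> j \<le> l}
   \<union> {serre_element (nat (1 - root_pairing l A j i)) (fE i) (fE j)
        | i j. i \<le> l \<and> j \<le> l \<and> i \<noteq> j}
   \<union> {serre_element (nat (1 - root_pairing l A j i)) (fF i) (fF j)
        | i j. i \<le> l \<and> j \<le> l \<and> i \<noteq> j}"

definition quantum_ideal ::
  "nat \<Rightarrow> (nat \<Rightarrow> nat \<Rightarrow> int) \<Rightarrow> (qgen free_word \<Rightarrow>\<^sub>0 qrat) set" where
  "quantum_ideal l A = genideal (free_algebra (qgens l)) (quantum_relations l A)"

definition quantum_affine_algebra ::
  "nat \<Rightarrow> (nat \<Rightarrow> nat \<Rightarrow> int) \<Rightarrow> (qgen free_word \<Rightarrow>\<^sub>0 qrat) set ring" where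
  "quantum_affine_algebra l A = FactRing (free_algebra (qgens l)) (quantum_ideal l A)"

definition quantum_class ::
  "nat \<Rightarrow> (nat \<Rightarrow> nat \<Rightarrow> int) \<Rightarrow> (qgen free_word \<Rightarrow>\<^sub>0 qrat) \<Rightarrow> (qgen free_word \<Rightarrow>\<^sub>0 qrat) set" where
  "quantum_class l A x = a_r_coset (free_algebra (qgens l)) (quantum_ideal l A) x"

text \<open>
  The weight lattice \<open>\<Lambda> = Hom(\<int>\<Pi>\<^sup>\<or>, \<int>)\<close>; weights are extensional, so that a weight is determined by its
  values on \<open>\<int>\<Pi>\<^sup>\<or>\<close>.
\<close>

type_synonym weight = "coweight \<Rightarrow> int"

definition weight_lattice :: "nat \<Rightarrow> weight set" where
  "weight_lattice l =
     {\<nu> \<in> extensional (coroot_lattice l).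
        \<forall>h\<in>coroot_lattice l. \<forall>h'\<in>coroot_lattice l. \<nu> (h + h') = \<nu> h + \<nu> h'}"

section \<open>Modules, integrability and crystal bases\<close>

text \<open>\<open>N\<close> is the internal direct sum of the \<open>W i\<close>, \<open>i \<in> J\<close>.\<close>

definition internal_direct_sum :: "'i set \<Rightarrow> ('i \<Rightarrow> 'v::ab_group_add set) \<Rightarrow> 'v set \<Rightarrow> bool" where
  "internal_direct_sum J W N \<longleftrightarrow>
     bij_betw (\<lambda>f. \<Sum>i\<in>Poly_Mapping.keys f. Poly_Mapping.lookup f i)
       {f. Poly_Mapping.keys f \<subseteq> J \<and> (\<forall>i\<in>Poly_Mapping.keys f. Poly_Mapping.lookup f i \<in> W i)} N"

text \<open>
  \<open>\<rat>(q) \<otimes> L\<close> over \<open>\<A>\<^sub>0\<close> is the quotient of the free abelian group on the pairs \<open>(c, x)\<close>, \<open>x \<in> L\<close>, by the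
  subgroup \<open>tensor_null\<close>.
\<close>

inductive_set tensor_null ::
  "(qrat \<Rightarrow> 'v::ab_group_add \<Rightarrow> 'v) \<Rightarrow> 'v set \<Rightarrow> (qrat \<times> 'v \<Rightarrow>\<^sub>0 int) set"
  for scale :: "qrat \<Rightarrow> 'v \<Rightarrow> 'v" and L :: "'v set" where
  zero: "0 \<in> tensor_null scale L"
| diff: "s \<in> tensor_null scale L \<Longrightarrow> t \<in> tensor_null scale L \<Longrightarrow> s - t \<in> tensor_null scale L"
| left: "x \<in> L \<Longrightarrow>
    Poly_Mapping.single (c + d, x) 1 - Poly_Mapping.single (c, x) 1 - Poly_Mapping.single (d, x) 1
      \<in> tensor_null scale L"
| right: "x \<in> L \<Longrightarrow> y \<in> L \<Longrightarrow>
    Poly_Mapping.single (c, x + y) 1 - Poly_Mapping.single (c, x) 1 - Poly_Mapping.single (c, y) 1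
      \<in> tensor_null scale L"
| balanced: "x \<in> L \<Longrightarrow> a \<in> A0 \<Longrightarrow>
    Poly_Mapping.single (c * a, x) 1 - Poly_Mapping.single (c, scale a x) 1
      \<in> tensor_null scale L"

locale quantum_affine_module = vector_space scale
  for scale :: "qrat \<Rightarrow> 'v::ab_group_add \<Rightarrow> 'v" +
  fixes l :: nat
    and A :: "nat \<Rightarrow> nat \<Rightarrow> int"
    and M :: "'v set"
    and act :: "(qgen free_word \<Rightarrow>\<^sub>0 qrat) set \<Rightarrow> 'v \<Rightarrow> 'v"
  assumes subspace_M: "subspace M"
    and act_closed: "\<And>u x. u \<in> carrier (quantum_affine_algebra l A) \<Longrightarrow> x \<in> M \<Longrightarrow> act u x \<in> M"
    and act_add_right: "\<And>u x y. u \<in> carrier (quantum_affine_algebra l A) \<Longrightarrow> x \<in> M \<Longrightarrow> y \<in> M \<Longrightarrow>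
      act u (x + y) = act u x + act u y"
    and act_add_left: "\<And>u u' x. u \<in> carrier (quantum_affine_algebra l A) \<Longrightarrow>
      u' \<in> carrier (quantum_affine_algebra l A) \<Longrightarrow> x \<in> M \<Longrightarrow>
      act (u \<oplus>\<^bsub>quantum_affine_algebra l A\<^esub> u') x = act u x + act u' x"
    and act_mult: "\<And>u u' x. u \<in> carrier (quantum_affine_algebra l A) \<Longrightarrow>
      u' \<in> carrier (quantum_affine_algebra l A) \<Longrightarrow> x \<in> M \<Longrightarrow>
      act (u \<otimes>\<^bsub>quantum_affine_algebra l A\<^esub> u') x = act u (act u' x)"
    and act_one: "\<And>x. x \<in> M \<Longrightarrow> act \<one>\<^bsub>quantum_affine_algebra l A\<^esub> x = x"
    and act_const: "\<And>c x. x \<in> M \<Longrightarrow> act (quantum_class l A (fa_const c)) x = scale c x"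
begin

definition E_act :: "nat \<Rightarrow> 'v \<Rightarrow> 'v" where
  "E_act i = act (quantum_class l A (fE i))"

definition F_act :: "nat \<Rightarrow> 'v \<Rightarrow> 'v" where
  "F_act i = act (quantum_class l A (fF i))"

definition K_act :: "coweight \<Rightarrow> 'v \<Rightarrow> 'v" where
  "K_act h = act (quantum_class l A (fK h))"

definition F_div_act :: "nat \<Rightarrow> nat \<Rightarrow> 'v \<Rightarrow> 'v" where
  "F_div_act i n = act (quantum_class l A (divided_power (fF i) n))"

definition weight_space :: "weight \<Rightarrow> 'v set" where
  "weight_space \<nu> = {u \<in> M. \<forall>h\<in>coroot_lattice l. K_act h u = scale (qq powi \<nu> h) u}"

definition integrable :: bool where
  "integrable \<longleftrightarrow>
     (\<forall>i\<le>l. \<forall>u\<in>M. (\<exists>n. (E_act i ^^ n) u = 0) \<and> (\<exists>n. (F_act i ^^ n) u = 0)) \<and>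
     internal_direct_sum (weight_lattice l) weight_space M"

text \<open>
  \<open>x\<close> is the sum of the \<open>F\<^sub>i\<^sup>(\<^sup>n\<^sup>) u\<^sub>n\<^sub>,\<^sub>\<nu>\<close>. Nonzero \<open>u\<close> with \<open>F\<^sub>i\<^sup>(\<^sup>n\<^sup>) u = 0\<close> are excluded: otherwise the
  decomposition would not be unique.
\<close>

definition string_decomposition :: "nat \<Rightarrow> 'v \<Rightarrow> (nat \<times> weight \<Rightarrow>\<^sub>0 'v) \<Rightarrow> bool" where
  "string_decomposition i x u \<longleftrightarrow>
     (\<forall>(n, \<nu>)\<in>Poly_Mapping.keys u.
        \<nu> \<in> weight_lattice l \<and>
        Poly_Mapping.lookup u (n, \<nu>) \<in> weight_space \<nu> \<and>
        E_act i (Poly_Mapping.lookup u (n, \<nu>)) = 0 \<and>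
        F_div_act i n (Poly_Mapping.lookup u (n, \<nu>)) \<noteq> 0) \<and>
     x = (\<Sum>(n, \<nu>)\<in>Poly_Mapping.keys u. F_div_act i n (Poly_Mapping.lookup u (n, \<nu>)))"

definition kashiwara_f :: "nat \<Rightarrow> 'v \<Rightarrow> 'v" where
  "kashiwara_f i x =
     (let u = THE u. string_decomposition i x u
      in \<Sum>(n, \<nu>)\<in>Poly_Mapping.keys u. F_div_act i (n + 1) (Poly_Mapping.lookup u (n, \<nu>)))"

definition kashiwara_e :: "nat \<Rightarrow> 'v \<Rightarrow> 'v" where
  "kashiwara_e i x =
     (let u = THE u. string_decomposition i x u
      in \<Sum>(n, \<nu>)\<in>Poly_Mapping.keys u.
           if n = 0 then 0 else F_div_act i (n - 1) (Poly_Mapping.lookup u (n, \<nu>)))"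

definition A0_submodule :: "'v set \<Rightarrow> bool" where
  "A0_submodule L \<longleftrightarrow>
     L \<subseteq> M \<and> 0 \<in> L \<and> (\<forall>x\<in>L. \<forall>y\<in>L. x + y \<in> L) \<and> (\<forall>a\<in>A0. \<forall>x\<in>L. scale a x \<in> L)"

definition A0_basis :: "'v set \<Rightarrow> 'v set \<Rightarrow> bool" where
  "A0_basis S L \<longleftrightarrow> S \<subseteq> L \<and>
     bij_betw (\<lambda>c. \<Sum>b\<in>Poly_Mapping.keys c. scale (Poly_Mapping.lookup c b) b)
       {c. Poly_Mapping.keys c \<subseteq> S \<and> (\<forall>b. Poly_Mapping.lookup c b \<in> A0)} L"

text \<open>The canonical map from \<open>\<rat>(q) \<otimes> L\<close> to \<open>M\<close> is an isomorphism.\<close>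

definition tensor_eval :: "(qrat \<times> 'v \<Rightarrow>\<^sub>0 int) \<Rightarrow> 'v" where
  "tensor_eval t =
     (\<Sum>(c, x)\<in>Poly_Mapping.keys t. scale (of_int (Poly_Mapping.lookup t (c, x)) * c) x)"

definition extension_of_scalars :: "'v set \<Rightarrow> bool" where
  "extension_of_scalars L \<longleftrightarrow>
     tensor_eval ` {t. Poly_Mapping.keys t \<subseteq> UNIV \<times> L} = M \<and>
     {t. Poly_Mapping.keys t \<subseteq> UNIV \<times> L \<and> tensor_eval t = 0} = tensor_null scale L"

text \<open>
  Elements of \<open>L/qL\<close> are cosets. Linear combinations in \<open>L/qL\<close> are computed on representatives.
\<close>

definition q_coset :: "'v set \<Rightarrow> 'v \<Rightarrow> 'v set" where
  "q_coset L x = {x + scale qq y | y. y \<in> L}"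

definition q_quotient :: "'v set \<Rightarrow> 'v set set" where
  "q_quotient L = q_coset L ` L"

definition rat_basis_of_quotient :: "'v set \<Rightarrow> 'v set set \<Rightarrow> bool" where
  "rat_basis_of_quotient L \<B> \<longleftrightarrow> \<B> \<subseteq> q_quotient L \<and>
     bij_betw (\<lambda>c. q_coset L (\<Sum>b\<in>Poly_Mapping.keys c.
                      scale (Fract [:Poly_Mapping.lookup c b:] 1) (SOME x. x \<in> b)))
       {c :: 'v set \<Rightarrow>\<^sub>0 rat. Poly_Mapping.keys c \<subseteq> \<B>} (q_quotient L)"

text \<open>
  The operator on \<open>L/qL\<close> induced by a linear operator \<open>T\<close> with \<open>T ` L \<subseteq> L\<close>: the cosets
  \<open>q_coset L (T x)\<close>, \<open>x \<in> X\<close>, are then all equal.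
\<close>

definition induced :: "'v set \<Rightarrow> ('v \<Rightarrow> 'v) \<Rightarrow> 'v set \<Rightarrow> 'v set" where
  "induced L T X = (\<Union>x\<in>X. q_coset L (T x))"

definition crystal_basis :: "'v set \<Rightarrow> 'v set set \<Rightarrow> bool" where
  "crystal_basis L \<B> \<longleftrightarrow>
     A0_submodule L \<and> (\<exists>S. A0_basis S L) \<and> extension_of_scalars L \<and>
     internal_direct_sum (weight_lattice l) (\<lambda>\<nu>. L \<inter> weight_space \<nu>) L \<and>
     rat_basis_of_quotient L \<B> \<and>
     (\<forall>i\<le>l. kashiwara_e i ` L \<subseteq> L \<and> kashiwara_f i ` L \<subseteq> L) \<and>
     (\<forall>i\<le>l. induced L (kashiwara_e i) ` \<B> \<subseteq> \<B> \<union> {q_coset L 0} \<and>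
            induced L (kashiwara_f i) ` \<B> \<subseteq> \<B> \<union> {q_coset L 0}) \<and>
     (\<forall>i\<le>l. \<forall>b\<in>\<B>. \<forall>b'\<in>\<B>.
        b' = induced L (kashiwara_f i) b \<longleftrightarrow> b = induced L (kashiwara_e i) b')"

end

text \<open>
  The operator on \<open>V\<^sub>E\<close> by which \<open>h \<in> \<int>\<Pi>\<^sup>\<or>\<close> acts when \<open>\<alpha>\<^sub>i\<^sup>\<or>\<close> is identified with \<open>H\<^sub>i\<close> for \<open>i \<le> l\<close> and with
  \<open>D\<close> for \<open>i = l + 1\<close>.
\<close>

definition coweight_op ::
  "nat \<Rightarrow> ('e::order \<Rightarrow> nat) \<Rightarrow> (int \<Rightarrow> 'e) \<Rightarrow> coweight \<Rightarrow> 'e heap_vec \<Rightarrow> 'e heap_vec" where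
  "coweight_op l \<epsilon> E0 h v =
     (\<Sum>i\<le>l. smult_vec (of_int (Poly_Mapping.lookup h i)) (H_op \<epsilon> i v)) +
     smult_vec (of_int (Poly_Mapping.lookup h (l + 1))) (D_op E0 v)"

definition crystal_lattice :: "nat \<Rightarrow> ('e::order \<Rightarrow> nat) \<Rightarrow> 'e heap_vec set" where
  "crystal_lattice l \<epsilon> =
     {\<Sum>I\<in>J. smult_vec (a I) (basis_vec I) | J a.
        finite J \<and> J \<subseteq> proper_ideals l \<epsilon> \<and> (\<forall>I\<in>J. a I \<in> A0)}"

end

theory Submission
  imports Defs
begin

text \<open>
  Let \<open>I\<close> be a proper ideal. Within the chain of elements labelled \<open>p\<close> it has a last element \<open>a\<close>, and
  there is a first element \<open>b\<close> outside \<open>I\<close>. Fullness says that the entries \<open>A p (\<epsilon> \<gamma>)\<close> sum to \<open>-2\<close> over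
  the \<open>\<gamma>\<close> strictly between \<open>a\<close> and \<open>b\<close>, so that either two of these \<open>\<gamma>\<close> have entry \<open>-1\<close> or a single one has
  entry \<open>-2\<close>, and all others have entry \<open>0\<close>. The element \<open>b\<close> can be added to \<open>I\<close> exactly if all of these
  neighbours lie in \<open>I\<close>, and \<open>a\<close> can be removed exactly if none does. Hence \<open>H\<^sub>p\<close> has the eigenvalue
  \<open>1 + \<Sum> A p (\<epsilon> \<gamma>)\<close> at \<open>v\<^sub>I\<close>, summed over the neighbours in \<open>I\<close>; it is one of \<open>-1, 0, 1\<close>, and it changes
  by \<open>A p r\<close> when an element labelled \<open>r\<close> is added. Both \<open>X\<^sub>p\<close> and \<open>Y\<^sub>p\<close> have square zero.

  These facts make the classical operators satisfy the quantum relations as they stand. In the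
  commutator relation the right-hand side acts by the quantum integer of \<open>w \<in> {-1, 0, 1}\<close>, which is \<open>w\<close>
  itself for every choice of the power \<open>q\<^sub>i\<close> of \<open>q\<close>. In the Serre relation for \<open>i \<noteq> j\<close> the summands contain
  \<open>X\<^sub>i\<^sup>2\<close>, or else \<open>A i j = -1\<close> and the summand is a multiple of \<open>X\<^sub>i X\<^sub>j X\<^sub>i\<close>, or \<open>A i j = 0\<close> and the relation is
  commutation. Now \<open>X\<^sub>i X\<^sub>j X\<^sub>i = 0\<close> if \<open>A i j = -1\<close>, because two neighbours have to be added between two
  consecutive elements labelled \<open>i\<close> and \<open>X\<^sub>j\<close> supplies only one of them.

  Since all \<open>i\<close>-strings have length at most \<open>1\<close>, the Kashiwara operators coincide with \<open>X\<^sub>i\<close> and \<open>Y\<^sub>i\<close>.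
  These map basis vectors to basis vectors or to \<open>0\<close> and are partial inverses of each other on them,
  which gives the crystal axioms for the lattice spanned by the basis vectors.

  The locale \<open>minuscule_crystal\<close> separates the two halves of the argument. It lists the
  properties of the steps \<open>I \<rightarrow> I \<union> {b}\<close> that are used; \<open>crystal_basis\<close> and the results before it follow from
  this list alone, and the locale \<open>cartan_heap\<close> verifies it for the proper ideals of a full heap.
  The passage from operators to modules over the quotient algebra is made in the locale \<open>quantum_rep\<close>.
\<close>

section \<open>The field of rational functions in q and its ring of functions regular at 0\<close>

lemma qq_power: "qq ^ n = Fract ([:0, 1:] ^ n) 1"
  by (induction n) (simp_all add: qq_def One_fract_def)

lemma qq_nonzero [simp]: "qq \<noteq> 0"
  by (simp add: qq_def eq_fract Zero_fract_def)

lemma qq_power_eq_1_iff [simp]: "qq ^ n = 1 \<longleftrightarrow> n = 0"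
proof
  assume "qq ^ n = 1"
  then have "[:0, 1:] ^ n = (1 :: rat poly)"
    by (simp add: qq_power One_fract_def eq_fract)
  then have "degree ([:0, 1:] ^ n :: rat poly) = 0" by simp
  then show "n = 0" by (simp add: degree_power_eq)
qed simp

lemma qq_powi_inject [simp]: "qq powi a = qq powi b \<longleftrightarrow> a = b"
proof
  have nonneg: "n = 0" if "qq powi n = 1" "n \<ge> 0" for n
    using that qq_power_eq_1_iff[of "nat n"] by (simp add: power_int_def)
  assume "qq powi a = qq powi b"
  then have "qq powi (a - b) = 1" "qq powi (b - a) = 1"
    by (simp_all add: power_int_diff)
  then show "a = b" using nonneg[of "a - b"] nonneg[of "b - a"] by linarith
qed simp

lemma qq_powi_diff_nonzero: "a \<noteq> b \<Longrightarrow> qq powi a - qq powi b \<noteq> 0"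
  by simp

lemma qfact_0 [simp]: "qfact 0 = 1"
  by (simp add: qfact_def)

lemma qfact_1 [simp]: "qfact (Suc 0) = 1"
proof -
  have "qq - inverse qq \<noteq> 0"
    using qq_powi_diff_nonzero[of 1 "- 1"] by (simp add: power_int_minus)
  then show ?thesis by (simp add: qfact_def qint_def)
qed

lemma Fract_in_A0: "poly b 0 \<noteq> 0 \<Longrightarrow> Fract a b \<in> A0"
  by (auto simp: A0_def)

lemma A0_E:
  assumes "c \<in> A0"
  obtains a b where "c = Fract a b" "poly b 0 \<noteq> 0" "b \<noteq> 0"
proof -
  from assms obtain a b where "c = Fract a b" "poly b 0 \<noteq> 0" by (auto simp: A0_def)
  then show thesis using that by fastforce
qed

lemma const_in_A0 [simp]: "Fract [:r:] 1 \<in> A0"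
  by (simp add: Fract_in_A0)

lemma A0_0 [simp]: "0 \<in> A0" and A0_1 [simp]: "1 \<in> A0" and A0_qq [simp]: "qq \<in> A0"
  by (simp_all add: Zero_fract_def One_fract_def qq_def Fract_in_A0)

lemma A0_add: "a \<in> A0 \<Longrightarrow> b \<in> A0 \<Longrightarrow> a + b \<in> A0"
  by (elim A0_E) (auto intro!: Fract_in_A0)

lemma A0_mult: "a \<in> A0 \<Longrightarrow> b \<in> A0 \<Longrightarrow> a * b \<in> A0"
  by (elim A0_E) (auto intro!: Fract_in_A0)

lemma A0_uminus: "a \<in> A0 \<Longrightarrow> - a \<in> A0"
  by (elim A0_E) (auto intro!: Fract_in_A0)

lemma A0_diff: "a \<in> A0 \<Longrightarrow> b \<in> A0 \<Longrightarrow> a - b \<in> A0"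
  using A0_add[of a "- b"] A0_uminus[of b] by simp

text \<open>
  \<^const>\<open>A0\<close> is a valuation ring: splitting off the powers of \<open>q\<close> from numerator and denominator
  writes every nonzero rational function as \<open>q\<^sup>n\<close>, \<open>n \<in> \<int>\<close>, times a unit.
\<close>

lemma A0_valuation_ring: "c \<in> A0 \<or> inverse c \<in> A0"
proof (cases c rule: Fract_cases_nonzero)
  case (Fract a b)
  have split: "\<exists>n p'. p = [:0, 1:] ^ n * p' \<and> poly p' 0 \<noteq> 0" if "p \<noteq> 0" for p :: "rat poly"
    using order_decomp[OF that, of 0] by (auto simp: poly_eq_0_iff_dvd)
  obtain m a' where a: "a = [:0, 1:] ^ m * a'" "poly a' 0 \<noteq> 0"
    using split \<open>a \<noteq> 0\<close> by blast
  obtain n b' where b: "b = [:0, 1:] ^ n * b'" "poly b' 0 \<noteq> 0"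
    using split \<open>b \<noteq> 0\<close> by blast
  have cancel: "Fract ([:0, 1:] ^ i * x) ([:0, 1:] ^ j * y) \<in> A0"
    if "j \<le> i" "poly y 0 \<noteq> 0" for i j and x y :: "rat poly"
  proof -
    have "Fract ([:0, 1:] ^ i * x) ([:0, 1:] ^ j * y) = Fract ([:0, 1:] ^ (i - j) * x) y"
      using that mult_fract_cancel[of "[:0, 1:] ^ j" "[:0, 1:] ^ (i - j) * x" y]
      by (simp add: mult.assoc[symmetric] power_add[symmetric])
    then show ?thesis using that by (simp add: Fract_in_A0)
  qed
  show ?thesis
    using cancel[of n m b' a'] cancel[of m n a' b'] a b Fract(1) by (cases "n \<le> m") auto
qed (simp add: Zero_fract_def Fract_in_A0)

text \<open>
  Taking the value at \<open>q = 0\<close> identifies \<open>\<A>\<^sub>0/q\<A>\<^sub>0\<close> with \<open>\<rat>\<close>: every element is congruent to a constant, and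
  by \<open>const_in_qA0\<close> the constant is unique.
\<close>

lemma A0_residue:
  assumes "c \<in> A0"
  shows "\<exists>r. \<exists>c'\<in>A0. c = Fract [:r:] 1 + qq * c'"
proof -
  obtain a b where c: "c = Fract a b" "poly b 0 \<noteq> 0" "b \<noteq> 0"
    using assms by (rule A0_E)
  define r where "r = poly a 0 / poly b 0"
  have "poly (a - [:r:] * b) 0 = 0" using c by (simp add: r_def)
  then have "[:- 0, 1:] dvd a - [:r:] * b" by (simp only: poly_eq_0_iff_dvd)
  then obtain p where "a - [:r:] * b = [:0, 1:] * p" by (auto elim: dvdE simp del: mult_pCons_left)
  then have p: "a = [:r:] * b + [:0, 1:] * p" by (simp add: algebra_simps)
  have "c = Fract [:r:] 1 + qq * Fract p b"
    unfolding c(1) p qq_def using c(3) by (simp add: eq_fract algebra_simps)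
  then show ?thesis using Fract_in_A0[OF c(2)] by blast
qed

lemma const_in_qA0:
  assumes "Fract [:r:] 1 = qq * c" "c \<in> A0"
  shows "r = 0"
proof -
  obtain a b where c: "c = Fract a b" "poly b 0 \<noteq> 0" "b \<noteq> 0"
    using assms(2) by (rule A0_E)
  have "[:r:] * b = [:0, 1:] * a"
    using assms(1) c(3) unfolding c(1) qq_def by (simp add: eq_fract)
  then have "poly ([:r:] * b) 0 = poly ([:0, 1:] * a) 0" by simp
  then show ?thesis using c(2) by simp
qed

section \<open>Linear operators on finitely supported functions\<close>

lemma lookup_smult_vec [simp]:
  "Poly_Mapping.lookup (smult_vec c v) I = c * Poly_Mapping.lookup v I"
proof -
  have "Poly_Mapping.lookup (Poly_Mapping.map ((*) c) v) I =
      (c * Poly_Mapping.lookup v I when Poly_Mapping.lookup v I \<noteq> 0)"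
    by transfer simp
  then show ?thesis by (simp add: smult_vec_def when_def split: if_splits)
qed

lemma lookup_basis_vec: "Poly_Mapping.lookup (basis_vec I) J = of_bool (I = J)"
  by (simp add: basis_vec_def lookup_single when_def)

lemma keys_basis_vec [simp]: "Poly_Mapping.keys (basis_vec I) = {I}"
  by (simp add: basis_vec_def)

lemma basis_vec_nonzero [simp]: "basis_vec I \<noteq> 0"
  by (metis keys_basis_vec keys_zero insert_not_empty)

lemma inj_basis_vec: "inj basis_vec"
  by (auto intro!: injI dest!: arg_cong[where f = Poly_Mapping.keys])

lemma basis_vec_eq_iff [simp]: "basis_vec I = basis_vec J \<longleftrightarrow> I = J"
  using inj_basis_vec by (auto dest: injD)

lemmas lin_add = module_hom.add[OF Vector_Spaces.module_hom_linearI]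
  and lin_scale = module_hom.scale[OF Vector_Spaces.module_hom_linearI]
  and lin_zero = module_hom.zero[OF Vector_Spaces.module_hom_linearI]
  and lin_diff = module_hom.diff[OF Vector_Spaces.module_hom_linearI]
  and lin_sum = module_hom.sum[OF Vector_Spaces.module_hom_linearI]

interpretation vec: vector_space smult_vec
  by standard (auto intro!: poly_mapping_eqI simp: lookup_add algebra_simps)

lemma lookup_lin_ext:
  "Poly_Mapping.lookup (lin_ext g v) K =
     (\<Sum>I\<in>Poly_Mapping.keys v. Poly_Mapping.lookup v I * Poly_Mapping.lookup (g I) K)"
  by (simp add: lin_ext_def lookup_sum)

lemma lin_ext_superset:
  assumes "finite S" "Poly_Mapping.keys v \<subseteq> S"
  shows "lin_ext g v = (\<Sum>I\<in>S. smult_vec (Poly_Mapping.lookup v I) (g I))"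
  unfolding lin_ext_def
  by (rule sum.mono_neutral_left) (use assms in \<open>auto simp: in_keys_iff\<close>)

lemma linear_lin_ext: "Vector_Spaces.linear smult_vec smult_vec (lin_ext g)"
proof -
  have add: "lin_ext g (u + v) = lin_ext g u + lin_ext g v" for u v
  proof -
    let ?S = "Poly_Mapping.keys u \<union> Poly_Mapping.keys v"
    show ?thesis
      using keys_add[of u v]
      by (simp add: lin_ext_superset[of ?S] lookup_add vec.scale_left_distrib sum.distrib)
  qed
  have scale: "lin_ext g (smult_vec c v) = smult_vec c (lin_ext g v)" for c v
    by (subst lin_ext_superset[of "Poly_Mapping.keys v"])
       (auto simp: in_keys_iff lin_ext_def vec.scale_sum_right)
  show ?thesis
    unfolding Vector_Spaces.linear_iff using add scale vec.vector_space_axioms by blast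
qed

lemma lin_ext_basis_vec [simp]: "lin_ext g (basis_vec I) = g I"
  by (simp add: lin_ext_def lookup_basis_vec)

lemma lin_ext_cong:
  "(\<And>I. I \<in> Poly_Mapping.keys v \<Longrightarrow> g I = g' I) \<Longrightarrow> lin_ext g v = lin_ext g' v"
  by (simp add: lin_ext_def)

lemma vec_expand: "v = (\<Sum>I\<in>Poly_Mapping.keys v. smult_vec (Poly_Mapping.lookup v I) (basis_vec I))"
  by (rule poly_mapping_eqI)
     (auto simp: lookup_sum lookup_basis_vec of_bool_def in_keys_iff if_distrib sum.delta cong: if_cong)

lemma keys_smult_vec: "Poly_Mapping.keys (smult_vec c v) \<subseteq> Poly_Mapping.keys v"
  by (auto simp: in_keys_iff)

text \<open>
  \<open>X\<^sub>p\<close> and \<open>Y\<^sub>p\<close> move basis vectors along a relation that is single-valued in both directions. For such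
  a relation no two terms of a linear combination are merged, so that the coefficients of the image can
  be read off from those of the argument.
\<close>

definition part_op :: "('e set \<Rightarrow> 'e set \<Rightarrow> bool) \<Rightarrow> 'e heap_vec \<Rightarrow> 'e heap_vec" where
  "part_op R = lin_ext (\<lambda>I. if \<exists>J. R I J then basis_vec (THE J. R I J) else 0)"

lemma linear_part_op: "Vector_Spaces.linear smult_vec smult_vec (part_op R)"
  unfolding part_op_def by (rule linear_lin_ext)

lemma bi_unique_the: "bi_unique R \<Longrightarrow> R I J \<Longrightarrow> (THE J. R I J) = J"
  by (rule the_equality) (auto dest: bi_uniqueDr)

lemma part_op_basis_vec:
  assumes "bi_unique R" "R I J"
  shows "part_op R (basis_vec I) = basis_vec J"
proof -
  have "(THE J. R I J) = J" using assms by (rule bi_unique_the)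
  then show ?thesis using assms(2) by (auto simp: part_op_def)
qed

lemma part_op_basis_vec_0: "\<nexists>J. R I J \<Longrightarrow> part_op R (basis_vec I) = 0"
  by (simp add: part_op_def)

lemma lookup_part_op:
  assumes R: "bi_unique R" and "R I J"
  shows "Poly_Mapping.lookup (part_op R v) J = Poly_Mapping.lookup v I"
proof -
  have target: "Poly_Mapping.lookup (if \<exists>J. R I' J then basis_vec (THE J. R I' J) else 0) J =
      of_bool (I' = I)" for I'
  proof (cases "\<exists>K. R I' K")
    case True
    then obtain K where K: "R I' K" by blast
    then have "(THE J. R I' J) = K" by (rule bi_unique_the[OF R])
    moreover have "K = J \<longleftrightarrow> I' = I" using K \<open>R I J\<close> R unfolding bi_unique_def by blast
    ultimately show ?thesis using True by (simp add: lookup_basis_vec)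
  next
    case False
    then show ?thesis using \<open>R I J\<close> by auto
  qed
  show ?thesis
    unfolding part_op_def lookup_lin_ext target
    by (auto simp: of_bool_def in_keys_iff if_distrib sum.delta cong: if_cong)
qed

lemma lookup_part_op_0:
  assumes R: "bi_unique R" and J: "\<nexists>I. R I J"
  shows "Poly_Mapping.lookup (part_op R v) J = 0"
proof -
  have target: "Poly_Mapping.lookup (if \<exists>J. R I' J then basis_vec (THE J. R I' J) else 0) J = 0" for I'
  proof (cases "\<exists>K. R I' K")
    case True
    then obtain K where K: "R I' K" by blast
    then have "(THE J. R I' J) = K" by (rule bi_unique_the[OF R])
    then show ?thesis using J K by (auto simp: lookup_basis_vec)
  qed simp
  show ?thesis
    unfolding part_op_def lookup_lin_ext target by simp
qed

lemma part_op_eqI: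
  assumes "bi_unique R"
    and "\<And>I J. R I J \<Longrightarrow> Poly_Mapping.lookup w J = Poly_Mapping.lookup v I"
    and "\<And>J. \<nexists>I. R I J \<Longrightarrow> Poly_Mapping.lookup w J = 0"
  shows "part_op R v = w"
proof (rule poly_mapping_eqI)
  fix J
  show "Poly_Mapping.lookup (part_op R v) J = Poly_Mapping.lookup w J"
    using assms by (cases "\<exists>I. R I J") (auto simp: lookup_part_op lookup_part_op_0)
qed

lemma bi_unique_compose: "bi_unique R \<Longrightarrow> bi_unique S \<Longrightarrow> bi_unique (R OO S)"
  unfolding bi_unique_def by blast

lemma part_op_compose:
  assumes R: "bi_unique R" and S: "bi_unique S"
  shows "part_op S (part_op R v) = part_op (R OO S) v"
proof (rule part_op_eqI[OF S])
  note RS = bi_unique_compose[OF R S]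
  show "Poly_Mapping.lookup (part_op (R OO S) v) K = Poly_Mapping.lookup (part_op R v) J"
    if "S J K" for J K
  proof (cases "\<exists>I. R I J")
    case True
    then obtain I where "R I J" by blast
    then show ?thesis using that lookup_part_op[OF RS, of I K] lookup_part_op[OF R] by auto
  next
    case False
    then have "\<nexists>I. (R OO S) I K" using that S by (blast dest: bi_uniqueDl)
    then show ?thesis using False lookup_part_op_0[OF RS] lookup_part_op_0[OF R] by metis
  qed
  show "Poly_Mapping.lookup (part_op (R OO S) v) K = 0" if "\<nexists>J. S J K" for K
    using that lookup_part_op_0[OF RS, of K] by auto
qed

lemma part_op_empty: "(\<And>I J. \<not> R I J) \<Longrightarrow> part_op R v = 0"
  by (rule part_op_eqI) (auto simp: bi_unique_def)

definition diag_op :: "('e set \<Rightarrow> qrat) \<Rightarrow> 'e heap_vec \<Rightarrow> 'e heap_vec" where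
  "diag_op f = lin_ext (\<lambda>I. smult_vec (f I) (basis_vec I))"

lemma linear_diag_op: "Vector_Spaces.linear smult_vec smult_vec (diag_op f)"
  unfolding diag_op_def by (rule linear_lin_ext)

lemma lookup_diag_op [simp]:
  "Poly_Mapping.lookup (diag_op f v) I = f I * Poly_Mapping.lookup v I"
  unfolding diag_op_def lookup_lin_ext lookup_smult_vec lookup_basis_vec
  by (auto simp: of_bool_def in_keys_iff if_distrib sum.delta mult.commute cong: if_cong)

lemma diag_op_basis_vec: "diag_op f (basis_vec I) = smult_vec (f I) (basis_vec I)"
  by (simp add: diag_op_def)

lemma keys_diag_op: "Poly_Mapping.keys (diag_op f v) \<subseteq> Poly_Mapping.keys v"
  by (auto simp: in_keys_iff)

lemma part_op_conversep:
  assumes R: "bi_unique R"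
  shows "part_op R (part_op R\<inverse>\<inverse> v) = diag_op (\<lambda>J. of_bool (\<exists>I. R I J)) v"
proof (rule part_op_eqI[OF R])
  have R': "bi_unique R\<inverse>\<inverse>" using R by (simp add: bi_unique_def)
  show "Poly_Mapping.lookup (diag_op (\<lambda>J. of_bool (\<exists>I. R I J)) v) J =
      Poly_Mapping.lookup (part_op R\<inverse>\<inverse> v) I" if "R I J" for I J
    using lookup_part_op[OF R', of J I] that by auto
qed auto

text \<open>
  Weight spaces will be the spans of the basis vectors with a common label \<open>g I\<close>; these are the
  projections onto them.
\<close>

definition component :: "('e set \<Rightarrow> 'x) \<Rightarrow> 'x \<Rightarrow> 'e heap_vec \<Rightarrow> 'e heap_vec" where
  "component g x = diag_op (\<lambda>I. of_bool (g I = x))"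

lemma lookup_component [simp]:
  "Poly_Mapping.lookup (component g x v) I = (if g I = x then Poly_Mapping.lookup v I else 0)"
  by (simp add: component_def)

lemma linear_component: "Vector_Spaces.linear smult_vec smult_vec (component g x)"
  unfolding component_def by (rule linear_diag_op)

lemma component_same:
  "\<forall>I\<in>Poly_Mapping.keys v. g I = x \<Longrightarrow> component g x v = v"
  by (rule poly_mapping_eqI) (auto simp: in_keys_iff)

lemma component_other:
  "\<forall>I\<in>Poly_Mapping.keys v. g I = y \<Longrightarrow> x \<noteq> y \<Longrightarrow> component g x v = 0"
  by (rule poly_mapping_eqI) (auto simp: in_keys_iff)

lemma sum_component:
  "finite X \<Longrightarrow> g ` Poly_Mapping.keys v \<subseteq> X \<Longrightarrow> (\<Sum>x\<in>X. component g x v) = v"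
  by (rule poly_mapping_eqI) (auto simp: lookup_sum sum.delta' image_subset_iff in_keys_iff)

lemma component_eq_0_iff: "component g x v = 0 \<longleftrightarrow> x \<notin> g ` Poly_Mapping.keys v"
proof
  assume 0: "component g x v = 0"
  show "x \<notin> g ` Poly_Mapping.keys v"
  proof
    assume "x \<in> g ` Poly_Mapping.keys v"
    then obtain I where "I \<in> Poly_Mapping.keys v" "x = g I" by blast
    then show False
      using arg_cong[OF 0, of "\<lambda>u. Poly_Mapping.lookup u I"] by (simp add: in_keys_iff)
  qed
qed (rule poly_mapping_eqI, fastforce simp: in_keys_iff)

text \<open>
  Labels on the basis vectors induce a grading of every additively closed set of vectors that contains
  \<open>0\<close> and the components of its elements.
\<close>

lemma internal_direct_sum_by_labels:
  fixes g :: "'e set \<Rightarrow> 'x" and N :: "'e heap_vec set"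
  assumes labels: "\<And>v. v \<in> N \<Longrightarrow> g ` Poly_Mapping.keys v \<subseteq> J"
    and zero: "0 \<in> N" and add: "\<And>u v. u \<in> N \<Longrightarrow> v \<in> N \<Longrightarrow> u + v \<in> N"
    and comp: "\<And>v x. v \<in> N \<Longrightarrow> component g x v \<in> N"
    and W: "\<And>x. x \<in> J \<Longrightarrow> W x = {v \<in> N. \<forall>I\<in>Poly_Mapping.keys v. g I = x}"
  shows "internal_direct_sum J W N"
  unfolding internal_direct_sum_def
proof (rule bij_betwI')
  let ?F = "{f. Poly_Mapping.keys f \<subseteq> J \<and> (\<forall>i\<in>Poly_Mapping.keys f. Poly_Mapping.lookup f i \<in> W i)}"
  let ?s = "\<lambda>f. \<Sum>i\<in>Poly_Mapping.keys f. Poly_Mapping.lookup f i"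
  have recover: "Poly_Mapping.lookup f x = component g x (?s f)" if f: "f \<in> ?F" for f x
  proof -
    have "component g x (?s f) = (\<Sum>i\<in>Poly_Mapping.keys f. component g x (Poly_Mapping.lookup f i))"
      by (rule lin_sum[OF linear_component])
    \<comment> \<open>Only the summand of degree \<open>x\<close> survives, so the family \<open>f\<close> can be recovered from its sum.\<close>
    also have "\<dots> = (\<Sum>i\<in>Poly_Mapping.keys f. if i = x then Poly_Mapping.lookup f i else 0)"
    proof (rule sum.cong)
      fix i assume "i \<in> Poly_Mapping.keys f"
      then have "\<forall>I\<in>Poly_Mapping.keys (Poly_Mapping.lookup f i). g I = i"
        using f W by (auto simp: subset_iff)
      then show "component g x (Poly_Mapping.lookup f i) = (if i = x then Poly_Mapping.lookup f i else 0)"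
        using component_same component_other by metis
    qed simp
    also have "\<dots> = Poly_Mapping.lookup f x"
      by (simp add: sum.delta in_keys_iff)
    finally show ?thesis by simp
  qed
  show "?s f = ?s f' \<longleftrightarrow> f = f'" if "f \<in> ?F" "f' \<in> ?F" for f f'
    using recover[OF that(1)] recover[OF that(2)] by (metis poly_mapping_eqI)
  show "?s f \<in> N" if "f \<in> ?F" for f
  proof -
    have "sum (Poly_Mapping.lookup f) X \<in> N" if "X \<subseteq> Poly_Mapping.keys f" "finite X" for X
      using that(2,1)
    proof (induction X)
      case (insert x X)
      then have "Poly_Mapping.lookup f x \<in> N"
        using \<open>f \<in> ?F\<close> W[of x] by auto
      then show ?case using insert add by simp
    qed (simp add: zero)
    then show ?thesis by simp
  qed
  show "\<exists>f\<in>?F. v = ?s f" if v: "v \<in> N" for v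
  proof
    define f where "f = Abs_poly_mapping (\<lambda>x. component g x v)"
    have fin: "finite {x. component g x v \<noteq> 0}"
      by (simp add: component_eq_0_iff)
    then have lf: "Poly_Mapping.lookup f x = component g x v" for x
      by (simp add: f_def)
    have kf: "Poly_Mapping.keys f = g ` Poly_Mapping.keys v"
      by (auto simp: in_keys_iff lf component_eq_0_iff)
    show "v = ?s f" by (simp add: kf lf sum_component)
    show "f \<in> ?F"
      using labels[OF v] comp[OF v] W
      by (fastforce simp: kf lf in_keys_iff split: if_splits)
  qed
qed

section \<open>Representations of the quantum affine algebra from operators\<close>

lemma carrier_free_algebra:
  "x \<in> carrier (free_algebra S) \<longleftrightarrow> (\<forall>w\<in>Poly_Mapping.keys x. set (letters w) \<subseteq> S)"
  by (simp add: free_algebra_def)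

lemma free_algebra_simps [simp]:
  "x \<otimes>\<^bsub>free_algebra S\<^esub> y = x * y" "\<one>\<^bsub>free_algebra S\<^esub> = 1"
  "\<zero>\<^bsub>free_algebra S\<^esub> = 0" "x \<oplus>\<^bsub>free_algebra S\<^esub> y = x + y"
  by (simp_all add: free_algebra_def)

lemma free_algebra_add:
  "x \<in> carrier (free_algebra S) \<Longrightarrow> y \<in> carrier (free_algebra S) \<Longrightarrow> x + y \<in> carrier (free_algebra S)"
  using keys_add[of x y] by (auto simp: carrier_free_algebra)

lemma free_algebra_uminus:
  "x \<in> carrier (free_algebra S) \<Longrightarrow> - x \<in> carrier (free_algebra S)"
  by (simp add: carrier_free_algebra in_keys_iff)

lemma free_algebra_diff:
  "x \<in> carrier (free_algebra S) \<Longrightarrow> y \<in> carrier (free_algebra S) \<Longrightarrow> x - y \<in> carrier (free_algebra S)"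
  using free_algebra_add[of x S "- y"] free_algebra_uminus by auto

lemma free_algebra_mult:
  "x \<in> carrier (free_algebra S) \<Longrightarrow> y \<in> carrier (free_algebra S) \<Longrightarrow> x * y \<in> carrier (free_algebra S)"
  using keys_mult[of x y] by (fastforce simp: carrier_free_algebra plus_free_word_def)

lemma free_algebra_0: "0 \<in> carrier (free_algebra S)"
  by (simp add: carrier_free_algebra)

lemma free_algebra_const: "fa_const c \<in> carrier (free_algebra S)"
  by (simp add: carrier_free_algebra fa_const_def zero_free_word_def)

lemma free_algebra_1: "1 \<in> carrier (free_algebra S)"
  by (simp add: carrier_free_algebra zero_free_word_def)

lemma free_algebra_gen: "g \<in> S \<Longrightarrow> fa_gen g \<in> carrier (free_algebra S)"
  by (simp add: carrier_free_algebra fa_gen_def)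

lemma free_algebra_power: "x \<in> carrier (free_algebra S) \<Longrightarrow> x ^ n \<in> carrier (free_algebra S)"
  by (induction n) (simp_all add: free_algebra_1 free_algebra_mult)

lemma free_algebra_sum:
  "(\<And>i. i \<in> I \<Longrightarrow> x i \<in> carrier (free_algebra S)) \<Longrightarrow> sum x I \<in> carrier (free_algebra S)"
  by (induction I rule: infinite_finite_induct) (simp_all add: free_algebra_0 free_algebra_add)

lemmas free_algebra_closed = free_algebra_add free_algebra_uminus free_algebra_diff free_algebra_mult
  free_algebra_0 free_algebra_const free_algebra_1 free_algebra_power free_algebra_sum

lemma ring_free_algebra: "ring (free_algebra S)"
proof (rule ringI)
  show "abelian_group (free_algebra S)"
  proof (rule abelian_groupI)
    fix x assume "x \<in> carrier (free_algebra S)"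
    then show "\<exists>y\<in>carrier (free_algebra S). y \<oplus>\<^bsub>free_algebra S\<^esub> x = \<zero>\<^bsub>free_algebra S\<^esub>"
      by (intro bexI[of _ "- x"]) (simp_all add: free_algebra_uminus)
  qed (simp_all add: free_algebra_closed algebra_simps)
  show "Group.monoid (free_algebra S)"
    by (rule monoidI) (simp_all add: free_algebra_closed mult.assoc)
qed (simp_all add: algebra_simps)

lemma uminus_free_algebra:
  assumes "x \<in> carrier (free_algebra S)"
  shows "\<ominus>\<^bsub>free_algebra S\<^esub> x = - x"
proof -
  interpret ring "free_algebra S" by (rule ring_free_algebra)
  show ?thesis
    by (rule minus_equality) (use assms in \<open>simp_all add: free_algebra_uminus\<close>)
qed

lemma divided_power_closed:
  "x \<in> carrier (free_algebra S) \<Longrightarrow> divided_power x n \<in> carrier (free_algebra S)"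
  by (simp add: divided_power_def free_algebra_closed)

lemma serre_element_closed:
  "x \<in> carrier (free_algebra S) \<Longrightarrow> y \<in> carrier (free_algebra S) \<Longrightarrow>
   serre_element b x y \<in> carrier (free_algebra S)"
  unfolding serre_element_def
  by (intro free_algebra_sum free_algebra_mult free_algebra_power free_algebra_uminus free_algebra_1
      divided_power_closed)

lemma coroot_lattice_closed:
  "0 \<in> coroot_lattice l" "h \<in> coroot_lattice l \<Longrightarrow> h' \<in> coroot_lattice l \<Longrightarrow> h + h' \<in> coroot_lattice l"
  "h \<in> coroot_lattice l \<Longrightarrow> - h \<in> coroot_lattice l"
  using keys_add[of h h'] by (auto simp: coroot_lattice_def)

lemma t_coweight_in_coroot_lattice: "i \<le> l \<Longrightarrow> t_coweight l A i \<in> coroot_lattice l"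
  by (auto simp: t_coweight_def coroot_lattice_def keys_single)

lemma fE_closed: "i \<le> l \<Longrightarrow> fE i \<in> carrier (free_algebra (qgens l))"
  and fF_closed: "i \<le> l \<Longrightarrow> fF i \<in> carrier (free_algebra (qgens l))"
  and fK_closed: "h \<in> coroot_lattice l \<Longrightarrow> fK h \<in> carrier (free_algebra (qgens l))"
  by (auto intro!: free_algebra_gen simp: qgens_def)

lemma quantum_relations_closed: "quantum_relations l A \<subseteq> carrier (free_algebra (qgens l))"
  unfolding quantum_relations_def
  by (auto intro!: free_algebra_closed serre_element_closed fE_closed fF_closed fK_closed
      coroot_lattice_closed t_coweight_in_coroot_lattice)

lemma ideal_quantum_ideal: "ideal (quantum_ideal l A) (free_algebra (qgens l))"
proof -
  interpret ring "free_algebra (qgens l)" by (rule ring_free_algebra)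
  show ?thesis
    unfolding quantum_ideal_def by (rule genideal_ideal[OF quantum_relations_closed])
qed

text \<open>
  An element of the free algebra acts as the same noncommutative polynomial in given linear operators;
  a word acts as the composition of its letters, the last letter first.
\<close>

locale free_algebra_rep = vector_space scale
  for scale :: "qrat \<Rightarrow> 'v::ab_group_add \<Rightarrow> 'v" +
  fixes gop :: "'g \<Rightarrow> 'v \<Rightarrow> 'v"
  assumes linear_gop: "Vector_Spaces.linear scale scale (gop g)"
begin

definition word_act :: "'g free_word \<Rightarrow> 'v \<Rightarrow> 'v" where
  "word_act w = foldr gop (letters w)"

definition eval :: "('g free_word \<Rightarrow>\<^sub>0 qrat) \<Rightarrow> 'v \<Rightarrow> 'v" where
  "eval a v = (\<Sum>w\<in>Poly_Mapping.keys a. scale (Poly_Mapping.lookup a w) (word_act w v))"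

lemma linear_word_act: "Vector_Spaces.linear scale scale (word_act w)"
proof -
  have "Vector_Spaces.linear scale scale (foldr gop ws)" for ws
  proof (induction ws)
    case (Cons g ws)
    show ?case
      unfolding foldr.simps by (rule Vector_Spaces.linear_compose[OF Cons.IH linear_gop])
  qed (simp add: linear_id[unfolded id_def] linear_ident)
  then show ?thesis by (simp add: word_act_def)
qed

lemma word_act_plus: "word_act (u + w) v = word_act u (word_act w v)"
  by (simp add: word_act_def plus_free_word_def)

lemma linear_eval: "Vector_Spaces.linear scale scale (eval a)"
  unfolding eval_def[abs_def] Vector_Spaces.linear_iff
  by (auto simp: vector_space_axioms lin_add[OF linear_word_act] lin_scale[OF linear_word_act]
      scale_right_distrib sum.distrib scale_sum_right mult.commute)

lemma eval_superset:
  assumes "finite S" "Poly_Mapping.keys a \<subseteq> S"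
  shows "eval a v = (\<Sum>w\<in>S. scale (Poly_Mapping.lookup a w) (word_act w v))"
  unfolding eval_def
  by (rule sum.mono_neutral_left) (use assms in \<open>auto simp: in_keys_iff\<close>)

lemma eval_0 [simp]: "eval 0 v = 0"
  by (simp add: eval_def)

lemma eval_add [simp]: "eval (a + b) v = eval a v + eval b v"
proof -
  let ?S = "Poly_Mapping.keys a \<union> Poly_Mapping.keys b"
  show ?thesis
    using keys_add[of a b]
    by (simp add: eval_superset[of ?S] lookup_add scale_left_distrib sum.distrib)
qed

lemma eval_uminus [simp]: "eval (- a) v = - eval a v"
  by (simp add: eval_def sum_negf)

lemma eval_diff [simp]: "eval (a - b) v = eval a v - eval b v"
  using eval_add[of a "- b" v] by simp

lemma eval_sum: "eval (sum f S) v = (\<Sum>i\<in>S. eval (f i) v)"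
  by (induction S rule: infinite_finite_induct) simp_all

lemma eval_single: "eval (Poly_Mapping.single w c) v = scale c (word_act w v)"
  by (simp add: eval_def)

lemma eval_const [simp]: "eval (fa_const c) v = scale c v"
  by (simp add: fa_const_def eval_single word_act_def zero_free_word_def)

lemma eval_1 [simp]: "eval 1 v = v"
  using eval_const[of 1 v] by (simp add: fa_const_def)

lemma eval_gen [simp]: "eval (fa_gen g) v = gop g v"
  by (simp add: fa_gen_def eval_single word_act_def)

lemma sum_singles:
  "a = (\<Sum>w\<in>Poly_Mapping.keys a. Poly_Mapping.single w (Poly_Mapping.lookup a w))"
  by (rule poly_mapping_eqI)
     (auto simp: lookup_sum lookup_single when_def in_keys_iff sum.delta)

lemma eval_mult [simp]: "eval (a * b) v = eval a (eval b v)"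
proof -
  let ?a = "Poly_Mapping.lookup a" and ?b = "Poly_Mapping.lookup b"
  have "a * b = (\<Sum>u\<in>Poly_Mapping.keys a. \<Sum>w\<in>Poly_Mapping.keys b.
      Poly_Mapping.single u (?a u) * Poly_Mapping.single w (?b w))"
    by (subst (1) sum_singles[of a], subst (1) sum_singles[of b]) (rule sum_product)
  then have "eval (a * b) v = (\<Sum>u\<in>Poly_Mapping.keys a. \<Sum>w\<in>Poly_Mapping.keys b.
      scale (?a u * ?b w) (word_act u (word_act w v)))"
    by (simp add: eval_sum mult_single eval_single word_act_plus)
  also have "\<dots> = eval a (eval b v)"
    by (simp add: eval_def lin_sum[OF linear_word_act] lin_scale[OF linear_word_act] scale_sum_right)
  finally show ?thesis .
qed

lemma eval_power [simp]: "eval (a ^ n) v = (eval a ^^ n) v"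
  by (induction n arbitrary: v) (simp_all add: funpow_swap1)

lemma eval_divided_power: "eval (divided_power a n) v = scale (inverse (qfact n)) ((eval a ^^ n) v)"
  by (simp add: divided_power_def)

end

locale quantum_operators = free_algebra_rep scale gop
  for scale :: "qrat \<Rightarrow> 'v::ab_group_add \<Rightarrow> 'v" and gop :: "qgen \<Rightarrow> 'v \<Rightarrow> 'v"
begin

text \<open>
  If \<open>x\<close> acts with square zero, only the summands with divided powers of order at most \<open>1\<close> survive: for
  \<open>b = 1\<close> they form the commutator of \<open>x\<close> and \<open>y\<close>, for \<open>b = 2\<close> only \<open>x y x\<close> remains, and for \<open>b = 3\<close> nothing does.
\<close>

lemma eval_serre_element:
  assumes sq: "\<And>v. eval x (eval x v) = 0"
    and b: "b = 1 \<and> (\<forall>v. eval x (eval y v) = eval y (eval x v)) \<or>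
      b = 2 \<and> (\<forall>v. eval x (eval y (eval x v)) = 0) \<or> b = 3"
  shows "eval (serre_element b x y) v = 0"
proof -
  have zero: "eval a 0 = 0" for a
    by (rule lin_zero[OF linear_eval])
  have scale: "eval a (scale c v) = scale c (eval a v)" for a c v
    by (rule lin_scale[OF linear_eval])
  consider "b = Suc 0" "\<forall>v. eval x (eval y v) = eval y (eval x v)"
    | "b = Suc (Suc 0)" "\<forall>v. eval x (eval y (eval x v)) = 0" | "b = Suc (Suc (Suc 0))"
    using b by (auto simp: numeral_2_eq_2 numeral_3_eq_3)
  then show ?thesis
    by cases (simp_all add: serre_element_def eval_sum eval_divided_power atLeast0_atMost_Suc
        sq zero scale)
qed

end

text \<open>
  If the operators for the generators satisfy the defining relations on a subspace \<open>M\<close>, then a coset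
  acts through any of its representatives.
\<close>

locale quantum_rep = quantum_operators scale gop
  for scale :: "qrat \<Rightarrow> 'v::ab_group_add \<Rightarrow> 'v" and gop :: "qgen \<Rightarrow> 'v \<Rightarrow> 'v" +
  fixes l :: nat and A :: "nat \<Rightarrow> nat \<Rightarrow> int" and M :: "'v set"
  assumes subspace_M: "subspace M"
    and gop_closed: "g \<in> qgens l \<Longrightarrow> x \<in> M \<Longrightarrow> gop g x \<in> M"
    and relations: "r \<in> quantum_relations l A \<Longrightarrow> x \<in> M \<Longrightarrow> eval r x = 0"
begin

abbreviation R where "R \<equiv> free_algebra (qgens l)"

lemma eval_closed:
  assumes "a \<in> carrier R" "x \<in> M"
  shows "eval a x \<in> M"
proof -
  have word: "set ws \<subseteq> qgens l \<Longrightarrow> foldr gop ws x \<in> M" for ws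
    by (induction ws) (use assms(2) gop_closed in auto)
  show ?thesis
    unfolding eval_def
    by (intro subspace_sum[OF subspace_M] subspace_scale[OF subspace_M])
       (use assms(1) word in \<open>auto simp: word_act_def carrier_free_algebra\<close>)
qed

lemma ideal_annihilator: "ideal {a \<in> carrier R. \<forall>x\<in>M. eval a x = 0} R"
proof -
  interpret ring R by (rule ring_free_algebra)
  show ?thesis
  proof (rule idealI[OF ring_axioms])
    show "subgroup {a \<in> carrier R. \<forall>x\<in>M. eval a x = 0} (add_monoid R)"
      by (rule add.subgroupI) (auto simp: uminus_free_algebra free_algebra_closed)
  next
    fix a b assume a: "a \<in> {a \<in> carrier R. \<forall>x\<in>M. eval a x = 0}" and b: "b \<in> carrier R"
    then show "b \<otimes>\<^bsub>R\<^esub> a \<in> {a \<in> carrier R. \<forall>x\<in>M. eval a x = 0}"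
      by (simp add: free_algebra_mult lin_zero[OF linear_eval])
    show "a \<otimes>\<^bsub>R\<^esub> b \<in> {a \<in> carrier R. \<forall>x\<in>M. eval a x = 0}"
      using a b by (simp add: free_algebra_mult eval_closed)
  qed
qed

text \<open>
  The annihilator of \<open>M\<close> in the free algebra is a two-sided ideal. It contains the relations, and hence
  the ideal that they generate.
\<close>

lemma eval_quantum_ideal:
  assumes "a \<in> quantum_ideal l A" "x \<in> M"
  shows "eval a x = 0"
proof -
  interpret ring R by (rule ring_free_algebra)
  have "quantum_ideal l A \<subseteq> {a \<in> carrier R. \<forall>x\<in>M. eval a x = 0}"
    unfolding quantum_ideal_def
    by (rule genideal_minimal[OF ideal_annihilator]) (use relations quantum_relations_closed in blast)
  then show ?thesis using assms by auto
qed

text \<open>The choice of the representative is immaterial on \<open>M\<close> by \<open>act_class\<close>.\<close>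

definition act :: "(qgen free_word \<Rightarrow>\<^sub>0 qrat) set \<Rightarrow> 'v \<Rightarrow> 'v" where
  "act u = eval (SOME a. a \<in> u)"

lemma act_class:
  assumes a: "a \<in> carrier R" and x: "x \<in> M"
  shows "act (quantum_class l A a) x = eval a x"
proof -
  interpret ideal "quantum_ideal l A" R by (rule ideal_quantum_ideal)
  define b where "b = (SOME b. b \<in> quantum_class l A a)"
  have "a \<in> quantum_class l A a"
    unfolding quantum_class_def by (rule a_rcos_self[OF a])
  then have "b \<in> quantum_class l A a"
    unfolding b_def by (rule someI)
  then obtain c where "c \<in> quantum_ideal l A" "b = c + a"
    by (auto simp: quantum_class_def a_r_coset_def')
  then show ?thesis
    using eval_quantum_ideal[OF _ x] by (simp add: act_def b_def[symmetric])
qed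

lemma quotient_cases:
  assumes "u \<in> carrier (quantum_affine_algebra l A)"
  obtains a where "a \<in> carrier R" "u = quantum_class l A a"
  using assms
  by (auto simp: quantum_affine_algebra_def quantum_class_def FactRing_def A_RCOSETS_def')

lemma quotient_ops:
  assumes "a \<in> carrier R" "b \<in> carrier R"
  shows "quantum_class l A a \<oplus>\<^bsub>quantum_affine_algebra l A\<^esub> quantum_class l A b =
      quantum_class l A (a + b)"
    and "quantum_class l A a \<otimes>\<^bsub>quantum_affine_algebra l A\<^esub> quantum_class l A b =
      quantum_class l A (a * b)"
    and "\<one>\<^bsub>quantum_affine_algebra l A\<^esub> = quantum_class l A 1"
proof -
  interpret ideal "quantum_ideal l A" R by (rule ideal_quantum_ideal)
  show "quantum_class l A a \<oplus>\<^bsub>quantum_affine_algebra l A\<^esub> quantum_class l A b =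
      quantum_class l A (a + b)"
    using a_rcos_sum[OF assms]
    by (simp add: quantum_class_def quantum_affine_algebra_def FactRing_def)
  show "quantum_class l A a \<otimes>\<^bsub>quantum_affine_algebra l A\<^esub> quantum_class l A b =
      quantum_class l A (a * b)"
    using rcoset_mult_add[OF assms]
    by (simp add: quantum_class_def quantum_affine_algebra_def FactRing_def)
  show "\<one>\<^bsub>quantum_affine_algebra l A\<^esub> = quantum_class l A 1"
    by (simp add: quantum_class_def quantum_affine_algebra_def FactRing_def)
qed

lemma quantum_affine_module: "quantum_affine_module scale l A M act"
proof unfold_locales
  show "subspace M" by (rule subspace_M)
next
  fix u x assume "u \<in> carrier (quantum_affine_algebra l A)" "x \<in> M"
  then show "act u x \<in> M" by (elim quotient_cases) (simp add: act_class eval_closed)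
next
  fix u x y assume "u \<in> carrier (quantum_affine_algebra l A)" "x \<in> M" "y \<in> M"
  then show "act u (x + y) = act u x + act u y"
    by (elim quotient_cases) (simp add: act_class subspace_add[OF subspace_M] lin_add[OF linear_eval])
next
  fix u u' x
  assume "u \<in> carrier (quantum_affine_algebra l A)" "u' \<in> carrier (quantum_affine_algebra l A)"
    and x: "x \<in> M"
  then obtain a a' where a: "a \<in> carrier R" "u = quantum_class l A a"
    and a': "a' \<in> carrier R" "u' = quantum_class l A a'"
    by (metis quotient_cases)
  show "act (u \<oplus>\<^bsub>quantum_affine_algebra l A\<^esub> u') x = act u x + act u' x"
    using a a' x by (simp add: quotient_ops act_class free_algebra_closed)
  show "act (u \<otimes>\<^bsub>quantum_affine_algebra l A\<^esub> u') x = act u (act u' x)"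
    using a a' x by (simp add: quotient_ops act_class free_algebra_closed eval_closed)
next
  fix x assume "x \<in> M"
  then show "act \<one>\<^bsub>quantum_affine_algebra l A\<^esub> x = x"
    using quotient_ops(3)[OF free_algebra_0 free_algebra_0] by (simp add: act_class free_algebra_1)
next
  fix c x assume "x \<in> M"
  then show "act (quantum_class l A (fa_const c)) x = scale c x"
    by (simp add: act_class free_algebra_const)
qed

end

section \<open>Minuscule crystals\<close>

text \<open>
  The eigenvalue of \<open>H\<close> at the state \<open>I\<close> when \<open>R\<close> is the graph of \<open>X\<close>: \<open>-1\<close> if a step leads up
  from \<open>I\<close>, \<open>1\<close> if one leads down. The two never happen together in a crystal.
\<close>

definition step_weight :: "('e set \<Rightarrow> 'e set \<Rightarrow> bool) \<Rightarrow> 'e set \<Rightarrow> int" where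
  "step_weight R I = of_bool (\<exists>J. R J I) - of_bool (\<exists>J. R I J)"

text \<open>
  The set \<open>P\<close> of states indexes the basis, and \<open>step i I J\<close> says that the raising operator \<open>E\<^sub>i\<close> takes \<open>I\<close> to \<open>J\<close>.
  The conditions correspond to the defining relations: \<open>step_weight_step\<close> and \<open>height_step\<close> to the
  relations between \<open>q\<^sup>h\<close> and \<open>E\<^sub>i\<close>, \<open>F\<^sub>i\<close>; \<open>no_double_step\<close> and \<open>diamond\<close> to the commutators of \<open>E\<^sub>i\<close> and \<open>F\<^sub>j\<close>
  for \<open>i = j\<close> and \<open>i \<noteq> j\<close>; and \<open>no_double_step\<close>, \<open>commute\<close> and \<open>no_triple\<close> to the Serre relations. As
  relations between states they are stable under reversal, so each serves the \<open>E\<^sub>i\<close> and the \<open>F\<^sub>i\<close> alike.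
\<close>

locale minuscule_crystal =
  fixes l :: nat and A :: "nat \<Rightarrow> nat \<Rightarrow> int" and P :: "'e set set"
    and step :: "nat \<Rightarrow> 'e set \<Rightarrow> 'e set \<Rightarrow> bool" and height :: "'e set \<Rightarrow> int"
  assumes cartan: "gen_cartan_matrix l A"
    and step_mem: "i \<le> l \<Longrightarrow> step i I J \<Longrightarrow> I \<in> P \<and> J \<in> P"
    and bi_unique_step: "i \<le> l \<Longrightarrow> bi_unique (step i)"
    and no_double_step: "i \<le> l \<Longrightarrow> step i I J \<Longrightarrow> \<not> step i J K"
    and step_weight_step: "i \<le> l \<Longrightarrow> j \<le> l \<Longrightarrow> step j I J \<Longrightarrow>
      step_weight (step i) J = step_weight (step i) I + A i j"
    and height_step: "j \<le> l \<Longrightarrow> step j I J \<Longrightarrow> height J = height I + of_bool (j = 0)"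
    and diamond: "i \<le> l \<Longrightarrow> j \<le> l \<Longrightarrow> i \<noteq> j \<Longrightarrow>
      (step j)\<inverse>\<inverse> OO step i = step i OO (step j)\<inverse>\<inverse>"
    and commute: "i \<le> l \<Longrightarrow> j \<le> l \<Longrightarrow> A i j = 0 \<Longrightarrow> step i OO step j = step j OO step i"
    and no_triple: "i \<le> l \<Longrightarrow> j \<le> l \<Longrightarrow> A i j = - 1 \<Longrightarrow> step i I J \<Longrightarrow> step j J K \<Longrightarrow> \<not> step i K L"
begin

text \<open>
  The integer by which \<open>h\<close> acts at the state \<open>I\<close> if \<open>\<alpha>\<^sub>i\<^sup>\<or>\<close> is identified with \<open>H\<^sub>i\<close> for \<open>i \<le> l\<close> and with the
  height for \<open>i = l + 1\<close>.
\<close>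

definition wt :: "coweight \<Rightarrow> 'e set \<Rightarrow> int" where
  "wt h I = (\<Sum>i\<le>l. Poly_Mapping.lookup h i * step_weight (step i) I) +
     Poly_Mapping.lookup h (l + 1) * height I"

lemma wt_0 [simp]: "wt 0 I = 0"
  by (simp add: wt_def)

lemma wt_add: "wt (h + h') I = wt h I + wt h' I"
  by (simp add: wt_def lookup_add algebra_simps sum.distrib)

lemma wt_uminus [simp]: "wt (- h) I = - wt h I"
  using wt_add[of h "- h" I] by simp

lemma wt_single: "i \<le> l \<Longrightarrow> wt (Poly_Mapping.single i n) I = n * step_weight (step i) I"
  by (simp add: wt_def lookup_single when_def if_distrib[of "\<lambda>x. x * _"] sum.delta cong: if_cong)

lemma pairing_eq:
  assumes "h \<in> coroot_lattice l" "j \<le> l"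
  shows "pairing l A j h =
    (\<Sum>i\<le>l. Poly_Mapping.lookup h i * A i j) + Poly_Mapping.lookup h (l + 1) * of_bool (j = 0)"
proof -
  have "pairing l A j h = (\<Sum>i\<in>{..Suc l}. Poly_Mapping.lookup h i * root_pairing l A j i)"
    unfolding pairing_def using assms
    by (intro sum.mono_neutral_left) (auto simp: coroot_lattice_def in_keys_iff)
  also have "\<dots> = (\<Sum>i\<le>l. Poly_Mapping.lookup h i * A i j) +
      Poly_Mapping.lookup h (l + 1) * of_bool (j = 0)"
    using assms(2) by (simp add: root_pairing_def)
  finally show ?thesis .
qed

lemma wt_step:
  assumes "h \<in> coroot_lattice l" "j \<le> l" "step j I J"
  shows "wt h J = wt h I + pairing l A j h"
  using assms
  by (simp add: wt_def pairing_eq step_weight_step height_step algebra_simps sum.distrib)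

abbreviation X :: "nat \<Rightarrow> 'e heap_vec \<Rightarrow> 'e heap_vec" where
  "X i \<equiv> part_op (step i)"

abbreviation Y :: "nat \<Rightarrow> 'e heap_vec \<Rightarrow> 'e heap_vec" where
  "Y i \<equiv> part_op (step i)\<inverse>\<inverse>"

abbreviation Kq :: "coweight \<Rightarrow> 'e heap_vec \<Rightarrow> 'e heap_vec" where
  "Kq h \<equiv> diag_op (\<lambda>I. qq powi wt h I)"

definition gop :: "qgen \<Rightarrow> 'e heap_vec \<Rightarrow> 'e heap_vec" where
  "gop g = (case g of Gen_E i \<Rightarrow> X i | Gen_F i \<Rightarrow> Y i
     | Gen_K h \<Rightarrow> Kq h)"

lemma gop_simps [simp]:
  "gop (Gen_E i) = X i" "gop (Gen_F i) = Y i"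
  "gop (Gen_K h) = Kq h"
  by (simp_all add: gop_def)

definition M :: "'e heap_vec set" where
  "M = {v. Poly_Mapping.keys v \<subseteq> P}"

lemma bi_unique_step': "i \<le> l \<Longrightarrow> bi_unique (step i)\<inverse>\<inverse>"
  using bi_unique_step[of i] by (simp add: bi_unique_def)

lemma part_op_in_M:
  assumes "bi_unique R" "\<And>I J. R I J \<Longrightarrow> J \<in> P"
  shows "part_op R v \<in> M"
proof -
  have "J \<in> P" if "J \<in> Poly_Mapping.keys (part_op R v)" for J
    using that lookup_part_op_0[OF assms(1), of J v] assms(2)[of _ J] by (auto simp: in_keys_iff)
  then show ?thesis by (auto simp: M_def)
qed

lemma subspace_M: "vec.subspace M"
  unfolding vec.subspace_def M_def
proof (intro conjI ballI allI)
  fix x y :: "'e heap_vec"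
  assume "x \<in> {v. Poly_Mapping.keys v \<subseteq> P}" "y \<in> {v. Poly_Mapping.keys v \<subseteq> P}"
  then show "x + y \<in> {v. Poly_Mapping.keys v \<subseteq> P}" using keys_add[of x y] by auto
next
  fix c and x :: "'e heap_vec"
  assume "x \<in> {v. Poly_Mapping.keys v \<subseteq> P}"
  then show "smult_vec c x \<in> {v. Poly_Mapping.keys v \<subseteq> P}" using keys_smult_vec[of c x] by auto
qed simp

lemma linear_gop: "Vector_Spaces.linear smult_vec smult_vec (gop g)"
  by (cases g) (simp_all add: linear_part_op linear_diag_op)

lemma quantum_operators_gop: "quantum_operators smult_vec gop"
  by (intro quantum_operators.intro free_algebra_rep.intro free_algebra_rep_axioms.intro
      linear_gop vec.vector_space_axioms)

sublocale ops: quantum_operators smult_vec gop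
  by (rule quantum_operators_gop)

lemma step_weight_cases:
  assumes "i \<le> l"
  obtains "step_weight (step i) I = - 1" "\<exists>J. step i I J" "\<nexists>J. step i J I"
  | "step_weight (step i) I = 1" "\<nexists>J. step i I J" "\<exists>J. step i J I"
  | "step_weight (step i) I = 0" "\<nexists>J. step i I J" "\<nexists>J. step i J I"
  using no_double_step[OF assms, of _ I] unfolding step_weight_def
  by (cases "\<exists>J. step i I J"; cases "\<exists>J. step i J I") auto

lemma X_X_0: "i \<le> l \<Longrightarrow> X i (X i v) = 0"
  using no_double_step[of i] bi_unique_step[of i] by (auto simp: part_op_compose intro: part_op_empty)

lemma Y_Y_0: "i \<le> l \<Longrightarrow> Y i (Y i v) = 0"
  using no_double_step[of i] bi_unique_step'[of i] by (auto simp: part_op_compose intro: part_op_empty)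

lemma X_Y: "i \<le> l \<Longrightarrow>
  X i (Y i v) = diag_op (\<lambda>I. of_bool (\<exists>J. step i J I)) v"
  by (rule part_op_conversep[OF bi_unique_step])

lemma Y_X: "i \<le> l \<Longrightarrow>
  Y i (X i v) = diag_op (\<lambda>I. of_bool (\<exists>J. step i I J)) v"
  using part_op_conversep[OF bi_unique_step'] by simp

lemma relation_K_mult:
  "Kq h (Kq h' v) = Kq (h + h') v"
  by (rule poly_mapping_eqI) (simp add: wt_add power_int_add)

lemma relation_K_E:
  assumes "h \<in> coroot_lattice l" "i \<le> l"
  shows "Kq h (X i (Kq (- h) v)) =
    smult_vec (qq powi pairing l A i h) (X i v)"
proof (rule poly_mapping_eqI)
  fix J
  show "Poly_Mapping.lookup (Kq h (X i (Kq (- h) v))) J =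
    Poly_Mapping.lookup (smult_vec (qq powi pairing l A i h) (X i v)) J"
  proof (cases "\<exists>I. step i I J")
    case True
    then obtain I where I: "step i I J" by blast
    have "qq powi wt h J * qq powi (- wt h I) = qq powi pairing l A i h"
      using wt_step[OF assms I] by (simp flip: power_int_add)
    then show ?thesis
      by (simp add: lookup_part_op[OF bi_unique_step I] assms mult.assoc[symmetric])
  qed (simp add: lookup_part_op_0 bi_unique_step assms)
qed

lemma relation_K_F:
  assumes "h \<in> coroot_lattice l" "i \<le> l"
  shows "Kq h (Y i (Kq (- h) v)) =
    smult_vec (qq powi (- pairing l A i h)) (Y i v)"
proof (rule poly_mapping_eqI)
  fix J
  show "Poly_Mapping.lookup (Kq h (Y i (Kq (- h) v))) J =
    Poly_Mapping.lookup (smult_vec (qq powi (- pairing l A i h)) (Y i v)) J"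
  proof (cases "\<exists>I. step i J I")
    case True
    then obtain I where I: "step i J I" by blast
    have "qq powi wt h J * qq powi (- wt h I) = qq powi (- pairing l A i h)"
      using wt_step[OF assms I] by (simp flip: power_int_add)
    moreover have "(step i)\<inverse>\<inverse> I J" using I by simp
    ultimately show ?thesis
      by (simp add: lookup_part_op[OF bi_unique_step'] assms mult.assoc[symmetric])
  next
    case False
    then have "\<nexists>I. (step i)\<inverse>\<inverse> I J" by simp
    then show ?thesis by (simp add: lookup_part_op_0[OF bi_unique_step'[OF assms(2)]])
  qed
qed

text \<open>
  On a state where \<open>H\<^sub>i\<close> has the eigenvalue \<open>w\<close> the right-hand side acts by \<open>(q\<^sup>s\<^sup>w - q\<^sup>-\<^sup>s\<^sup>w) / (q\<^sup>s - q\<^sup>-\<^sup>s)\<close>, which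
  is \<open>w\<close> because \<open>w \<in> {-1, 0, 1}\<close>, for every \<open>s > 0\<close>.
\<close>

lemma relation_E_F_same:
  fixes s :: nat
  assumes i: "i \<le> l" and s: "s > 0"
  shows "X i (Y i v) - Y i (X i v) =
    smult_vec (inverse (qq ^ s - inverse (qq ^ s)))
     (diag_op (\<lambda>I. qq powi wt (Poly_Mapping.single i (int s)) I) v -
      diag_op (\<lambda>I. qq powi wt (- Poly_Mapping.single i (int s)) I) v)"
proof (rule poly_mapping_eqI)
  fix I
  have nz: "qq ^ s - inverse (qq ^ s) \<noteq> 0"
    using qq_powi_diff_nonzero[of "int s" "- int s"] s by (simp add: power_int_minus)
  then have *: "inverse (qq ^ s - inverse (qq ^ s)) * (inverse (qq ^ s) - qq ^ s) = - 1"
    by (simp add: field_simps)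
  show "Poly_Mapping.lookup (X i (Y i v) - Y i (X i v)) I =
    Poly_Mapping.lookup (smult_vec (inverse (qq ^ s - inverse (qq ^ s)))
     (diag_op (\<lambda>I. qq powi wt (Poly_Mapping.single i (int s)) I) v -
      diag_op (\<lambda>I. qq powi wt (- Poly_Mapping.single i (int s)) I) v)) I"
    using nz
    by (cases rule: step_weight_cases[OF i, of I])
       (simp_all add: X_Y[OF i] Y_X[OF i] lookup_minus wt_single[OF i] power_int_minus
         left_diff_distrib[symmetric] mult.assoc[symmetric] *)
qed

lemma relation_E_F_diff:
  assumes "i \<le> l" "j \<le> l" "i \<noteq> j"
  shows "X i (Y j v) = Y j (X i v)"
  using diamond[OF assms] assms by (simp add: part_op_compose bi_unique_step bi_unique_step')

lemma serre_cases:
  assumes "i \<le> l" "j \<le> l" "i \<noteq> j"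
  obtains "nat (1 - root_pairing l A j i) = 1" "A i j = 0"
  | "nat (1 - root_pairing l A j i) = 2" "A i j = - 1"
  | "nat (1 - root_pairing l A j i) = 3"
proof -
  have "A i j \<in> {2, 0, - 1, - 2}" "A i j \<le> 0"
    using cartan assms by (auto simp: gen_cartan_matrix_def)
  then have "A i j = 0 \<or> A i j = - 1 \<or> A i j = - 2" by auto
  then show thesis using that assms by (auto simp: root_pairing_def)
qed

lemma relation_serre_E:
  assumes "i \<le> l" "j \<le> l" "i \<noteq> j"
  shows "ops.eval (serre_element (nat (1 - root_pairing l A j i)) (fE i) (fE j)) v = 0"
proof (rule ops.eval_serre_element)
  note bi = bi_unique_step[OF assms(1)] bi_unique_step[OF assms(2)]
  show "ops.eval (fE i) (ops.eval (fE i) v) = 0" for v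
    using assms by (simp add: X_X_0)
  show "nat (1 - root_pairing l A j i) = 1 \<and>
      (\<forall>v. ops.eval (fE i) (ops.eval (fE j) v) = ops.eval (fE j) (ops.eval (fE i) v)) \<or>
      nat (1 - root_pairing l A j i) = 2 \<and>
      (\<forall>v. ops.eval (fE i) (ops.eval (fE j) (ops.eval (fE i) v)) = 0) \<or>
      nat (1 - root_pairing l A j i) = 3"
  proof (cases rule: serre_cases[OF assms])
    case 1
    then show ?thesis using commute[OF assms(1,2)] bi by (simp add: part_op_compose)
  next
    case 2
    have "part_op ((step i OO step j) OO step i) v = 0" for v
      using no_triple[OF assms(1,2) 2(2)] by (intro part_op_empty) (auto elim!: relcomppE)
    then have "X i (X j (X i v)) = 0" for v
      by (simp add: part_op_compose bi_unique_compose bi_unique_step bi_unique_step' assms)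
    then show ?thesis using 2 by simp
  qed simp
qed

lemma relation_serre_F:
  assumes "i \<le> l" "j \<le> l" "i \<noteq> j"
  shows "ops.eval (serre_element (nat (1 - root_pairing l A j i)) (fF i) (fF j)) v = 0"
proof (rule ops.eval_serre_element)
  note bi = bi_unique_step'[OF assms(1)] bi_unique_step'[OF assms(2)]
  show "ops.eval (fF i) (ops.eval (fF i) v) = 0" for v
    using assms by (simp add: Y_Y_0)
  show "nat (1 - root_pairing l A j i) = 1 \<and>
      (\<forall>v. ops.eval (fF i) (ops.eval (fF j) v) = ops.eval (fF j) (ops.eval (fF i) v)) \<or>
      nat (1 - root_pairing l A j i) = 2 \<and>
      (\<forall>v. ops.eval (fF i) (ops.eval (fF j) (ops.eval (fF i) v)) = 0) \<or>
      nat (1 - root_pairing l A j i) = 3"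
  proof (cases rule: serre_cases[OF assms])
    case 1
    have "(step i)\<inverse>\<inverse> OO (step j)\<inverse>\<inverse> = (step j)\<inverse>\<inverse> OO (step i)\<inverse>\<inverse>"
      using commute[OF assms(1,2) 1(2)] by (metis converse_relcompp)
    then show ?thesis using 1 bi by (simp add: part_op_compose)
  next
    case 2
    have "part_op (((step i)\<inverse>\<inverse> OO (step j)\<inverse>\<inverse>) OO (step i)\<inverse>\<inverse>) v = 0" for v
      using no_triple[OF assms(1,2) 2(2)]
      by (intro part_op_empty) (auto elim!: relcomppE conversepE)
    then have "Y i (Y j (Y i v)) = 0" for v
      by (simp add: part_op_compose bi_unique_compose bi_unique_step bi_unique_step' assms)
    then show ?thesis using 2 by simp
  qed simp
qed

sublocale rep: quantum_rep smult_vec gop l A M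
proof
  show "vec.subspace M" by (rule subspace_M)
next
  fix g x assume g: "g \<in> qgens l" and x: "x \<in> M"
  show "gop g x \<in> M"
  proof (cases g)
    case (Gen_E i)
    then show ?thesis
      using g part_op_in_M[OF bi_unique_step, of i] step_mem[of i] by (auto simp: qgens_def)
  next
    case (Gen_F i)
    then show ?thesis
      using g part_op_in_M[OF bi_unique_step', of i] step_mem[of i] by (auto simp: qgens_def)
  next
    case (Gen_K h)
    then show ?thesis
      using x keys_diag_op[of "\<lambda>I. qq powi wt h I" x] by (auto simp: M_def)
  qed
next
  fix r x assume "r \<in> quantum_relations l A" "x \<in> M"
  have exponent: "root_exponent l A i > 0" for i
    by (simp add: root_exponent_def)
  have K0: "diag_op (\<lambda>I. 1) x = x"
    by (rule poly_mapping_eqI) simp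
  show "ops.eval r x = 0"
    using \<open>r \<in> quantum_relations l A\<close> unfolding quantum_relations_def
    by (auto simp: K0 relation_K_mult relation_K_E relation_K_F relation_E_F_diff
        relation_serre_E relation_serre_F relation_E_F_same[OF _ exponent] q_root_def t_coweight_def
        simp del: wt_uminus)
qed

sublocale module: quantum_affine_module smult_vec l A M rep.act
  by (rule rep.quantum_affine_module)

end

section \<open>Weights and Kashiwara operators of a minuscule crystal\<close>

context minuscule_crystal
begin

text \<open>Restriction makes weights extensional, as the elements of the weight lattice are.\<close>

definition weight :: "'e set \<Rightarrow> weight" where
  "weight I = restrict (\<lambda>h. wt h I) (coroot_lattice l)"

lemma weight_in_lattice: "weight I \<in> weight_lattice l"
  by (auto simp: weight_def weight_lattice_def coroot_lattice_closed wt_add)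

lemma weight_step_weight:
  assumes "i \<le> l"
  shows "weight I (Poly_Mapping.single i 1) = step_weight (step i) I"
  using assms by (simp add: weight_def coroot_lattice_def wt_single)

lemma E_act: "i \<le> l \<Longrightarrow> v \<in> M \<Longrightarrow> module.E_act i v = X i v"
  by (simp add: module.E_act_def rep.act_class fE_closed)

lemma F_act: "i \<le> l \<Longrightarrow> v \<in> M \<Longrightarrow> module.F_act i v = Y i v"
  by (simp add: module.F_act_def rep.act_class fF_closed)

lemma K_act: "h \<in> coroot_lattice l \<Longrightarrow> v \<in> M \<Longrightarrow>
    module.K_act h v = Kq h v"
  by (simp add: module.K_act_def rep.act_class fK_closed)

lemma X_in_M: "i \<le> l \<Longrightarrow> X i v \<in> M"
  using step_mem by (blast intro: part_op_in_M bi_unique_step)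

lemma Y_in_M: "i \<le> l \<Longrightarrow> Y i v \<in> M"
  using step_mem by (blast intro: part_op_in_M bi_unique_step')

lemma F_div_act:
  assumes "i \<le> l" "v \<in> M"
  shows "module.F_div_act i n v = (if n = 0 then v else if n = 1 then Y i v else 0)"
proof -
  have "module.F_div_act i n v = smult_vec (inverse (qfact n)) ((Y i ^^ n) v)"
    using assms
    by (simp add: module.F_div_act_def rep.act_class divided_power_closed fF_closed
        ops.eval_divided_power ops.eval_gen[abs_def])
  moreover have "(Y i ^^ Suc (Suc m)) v = 0" for m
    by (simp add: Y_Y_0[OF assms(1)])
  then have "(Y i ^^ n) v = 0" if "n \<noteq> 0" "n \<noteq> 1" for n
    using that by (metis One_nat_def not0_implies_Suc)
  ultimately show ?thesis by simp
qed

text \<open>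
  Since \<open>q\<close> is not a root of unity, the eigenvalues \<open>q\<^bsup>\<langle>\<nu>, h\<rangle>\<^esup>\<close> determine the exponents, and each weight space
  is spanned by the states of its weight.
\<close>

lemma weight_space:
  assumes \<nu>: "\<nu> \<in> weight_lattice l"
  shows "module.weight_space \<nu> = {v \<in> M. \<forall>I\<in>Poly_Mapping.keys v. weight I = \<nu>}"
proof (intro Set.set_eqI iffI)
  fix v assume v: "v \<in> module.weight_space \<nu>"
  have "weight I = \<nu>" if I: "I \<in> Poly_Mapping.keys v" for I
  proof
    fix h
    show "weight I h = \<nu> h"
    proof (cases "h \<in> coroot_lattice l")
      case True
      then have "Kq h v = smult_vec (qq powi \<nu> h) v"
        using v K_act[of h v] by (simp add: module.weight_space_def)
      from arg_cong[OF this, of "\<lambda>u. Poly_Mapping.lookup u I"] I show ?thesis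
        using True by (simp add: weight_def in_keys_iff)
    next
      case False
      then show ?thesis
        using \<nu> by (simp add: weight_def weight_lattice_def extensional_def)
    qed
  qed
  then show "v \<in> {v \<in> M. \<forall>I\<in>Poly_Mapping.keys v. weight I = \<nu>}"
    using v by (simp add: module.weight_space_def)
next
  fix v assume v: "v \<in> {v \<in> M. \<forall>I\<in>Poly_Mapping.keys v. weight I = \<nu>}"
  have "module.K_act h v = smult_vec (qq powi \<nu> h) v" if h: "h \<in> coroot_lattice l" for h
  proof (rule poly_mapping_eqI)
    fix I
    show "Poly_Mapping.lookup (module.K_act h v) I = Poly_Mapping.lookup (smult_vec (qq powi \<nu> h) v) I"
    proof (cases "I \<in> Poly_Mapping.keys v")
      case True
      then have "\<nu> h = wt h I" using v h by (auto simp: weight_def)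
      then show ?thesis using v h K_act[OF h, of v] by simp
    qed (use v h K_act[OF h, of v] in \<open>simp add: in_keys_iff\<close>)
  qed
  then show "v \<in> module.weight_space \<nu>" using v by (simp add: module.weight_space_def)
qed

lemma component_in_M: "v \<in> M \<Longrightarrow> component g x v \<in> M"
  using keys_diag_op[of _ v] by (auto simp: M_def component_def)

lemma add_in_M: "u \<in> M \<Longrightarrow> v \<in> M \<Longrightarrow> u + v \<in> M"
  and zero_in_M: "0 \<in> M"
  using vec.subspace_add[OF subspace_M] vec.subspace_0[OF subspace_M] by auto

lemma diff_in_M: "u \<in> M \<Longrightarrow> v \<in> M \<Longrightarrow> u - v \<in> M"
  by (rule vec.subspace_diff[OF subspace_M])

lemma integrable: "module.integrable"
proof -
  have nil: "(\<exists>n. (module.E_act i ^^ n) u = 0) \<and> (\<exists>n. (module.F_act i ^^ n) u = 0)"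
    if "i \<le> l" "u \<in> M" for i u
  proof
    have "(module.E_act i ^^ 2) u = 0" "(module.F_act i ^^ 2) u = 0"
      using that by (simp_all add: numeral_2_eq_2 E_act F_act X_in_M Y_in_M X_X_0 Y_Y_0)
    then show "\<exists>n. (module.E_act i ^^ n) u = 0" "\<exists>n. (module.F_act i ^^ n) u = 0" by blast+
  qed
  moreover have "internal_direct_sum (weight_lattice l) module.weight_space M"
    by (rule internal_direct_sum_by_labels[where g = weight])
       (use weight_in_lattice zero_in_M add_in_M component_in_M weight_space in auto)
  ultimately show ?thesis by (simp add: module.integrable_def)
qed

text \<open>
  By \<open>lookup_hw_part\<close> this keeps the coefficients at the states without a raising step, so it is the part of
  \<open>v\<close> in the kernel of \<open>E\<^sub>i\<close>. The part that it removes lies in the image of \<open>F\<^sub>i\<close>.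
\<close>

abbreviation hw_part :: "nat \<Rightarrow> 'e heap_vec \<Rightarrow> 'e heap_vec" where
  "hw_part i v \<equiv> v - Y i (X i v)"

lemma X_eq_0I:
  assumes "i \<le> l" "\<And>I J. I \<in> Poly_Mapping.keys v \<Longrightarrow> \<not> step i I J"
  shows "X i v = 0"
  by (rule part_op_eqI[OF bi_unique_step]) (use assms in \<open>auto simp: in_keys_iff\<close>)

lemma lookup_hw_part:
  assumes "i \<le> l"
  shows "Poly_Mapping.lookup (hw_part i v) I =
    (if \<exists>J. step i I J then 0 else Poly_Mapping.lookup v I)"
  by (simp add: Y_X[OF assms] lookup_minus)

text \<open>
  The states of a weight vector share the eigenvalue of \<open>H\<^sub>i\<close>. If one of them has a lowering step, this
  eigenvalue is \<open>1\<close>, so all of them have one, and \<open>F\<^sub>i\<close> can be undone by \<open>E\<^sub>i\<close>.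
\<close>

lemma X_Y_weight_vector:
  assumes i: "i \<le> l" and u: "\<forall>I\<in>Poly_Mapping.keys u. weight I = \<nu>"
    and nz: "Y i u \<noteq> 0"
  shows "X i (Y i u) = u"
proof -
  obtain J where "Poly_Mapping.lookup (Y i u) J \<noteq> 0"
    using nz by (metis poly_mapping_eqI lookup_zero)
  then obtain I0 where I0: "step i J I0" "Poly_Mapping.lookup u I0 \<noteq> 0"
    using lookup_part_op_0[OF bi_unique_step'[OF i], of J u]
      lookup_part_op[OF bi_unique_step'[OF i], of _ J u] by (metis conversep_iff)
  have "step_weight (step i) I0 = 1"
    using I0(1) by (cases rule: step_weight_cases[OF i, of I0]) auto
  then have \<nu>: "\<nu> (Poly_Mapping.single i 1) = 1"
    using u I0(2) weight_step_weight[OF i, of I0] by (auto simp: in_keys_iff)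
  have "\<exists>J. step i J I" if "I \<in> Poly_Mapping.keys u" for I
    using u that \<nu> weight_step_weight[OF i, of I]
    by (cases rule: step_weight_cases[OF i, of I]) auto
  then show ?thesis
    by (intro poly_mapping_eqI) (auto simp: X_Y[OF i] in_keys_iff)
qed

text \<open>
  Uniqueness of the string decomposition \<open>x = \<Sum> F\<^sub>i\<^sup>(\<^sup>n\<^sup>) u\<^sub>n\<^sub>,\<^sub>\<nu>\<close>: only \<open>n = 0, 1\<close> occur as \<open>F\<^sub>i\<^sup>2 = 0\<close>. Applying \<open>E\<^sub>i\<close> kills
  the terms with \<open>n = 0\<close> and turns \<open>F\<^sub>i u\<^sub>1\<^sub>,\<^sub>\<nu>\<close> into \<open>u\<^sub>1\<^sub>,\<^sub>\<nu>\<close>, so that the \<open>u\<^sub>1\<^sub>,\<^sub>\<nu>\<close> are the weight components of \<open>X x\<close>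
  and the \<open>u\<^sub>0\<^sub>,\<^sub>\<nu>\<close> those of \<open>x - Y X x\<close>.
\<close>

lemma string_decomposition_lookup:
  assumes i: "i \<le> l" and x: "x \<in> M" and dec: "module.string_decomposition i x u"
  shows "Poly_Mapping.lookup u (n, \<nu>) =
    (if n = 0 then component weight \<nu> (hw_part i x)
     else if n = 1 then component weight \<nu> (X i x) else 0)"
proof -
  let ?u = "\<lambda>k. Poly_Mapping.lookup u k"
  let ?K = "Poly_Mapping.keys u"
  have K: "\<nu> \<in> weight_lattice l" "?u (n, \<nu>) \<in> M" "\<forall>I\<in>Poly_Mapping.keys (?u (n, \<nu>)). weight I = \<nu>"
    "X i (?u (n, \<nu>)) = 0" "n = 0 \<or> n = 1 \<and> Y i (?u (n, \<nu>)) \<noteq> 0"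
    if "(n, \<nu>) \<in> ?K" for n \<nu>
  proof -
    have *: "\<nu> \<in> weight_lattice l" "?u (n, \<nu>) \<in> module.weight_space \<nu>"
      "module.E_act i (?u (n, \<nu>)) = 0" "module.F_div_act i n (?u (n, \<nu>)) \<noteq> 0"
      using dec that unfolding module.string_decomposition_def by auto
    then show **: "\<nu> \<in> weight_lattice l" "?u (n, \<nu>) \<in> M"
      "\<forall>I\<in>Poly_Mapping.keys (?u (n, \<nu>)). weight I = \<nu>"
      using weight_space by auto
    show "X i (?u (n, \<nu>)) = 0" "n = 0 \<or> n = 1 \<and> Y i (?u (n, \<nu>)) \<noteq> 0"
      using *(3,4) by (auto simp: E_act[OF i **(2)] F_div_act[OF i **(2)] split: if_splits)
  qed
  have "x = (\<Sum>(n, \<nu>)\<in>?K. module.F_div_act i n (?u (n, \<nu>)))"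
    using dec unfolding module.string_decomposition_def by blast
  also have "\<dots> = (\<Sum>k\<in>?K. if fst k = 0 then ?u k else Y i (?u k))"
  proof (rule sum.cong)
    fix k assume k: "k \<in> ?K"
    obtain n \<nu> where "k = (n, \<nu>)" by (cases k)
    then show "(case k of (n, \<nu>) \<Rightarrow> module.F_div_act i n (?u (n, \<nu>))) = (if fst k = 0 then ?u k else Y i (?u k))"
      using K(2,5)[of n \<nu>] k by (auto simp: F_div_act[OF i])
  qed simp
  finally have x_eq: "x = (\<Sum>k\<in>?K. if fst k = 0 then ?u k else Y i (?u k))" .
  have "X i x = (\<Sum>k\<in>?K. X i (if fst k = 0 then ?u k else Y i (?u k)))"
    by (subst (1) x_eq) (rule lin_sum[OF linear_part_op])
  also have "\<dots> = (\<Sum>k\<in>?K. if fst k = 1 then ?u k else 0)"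
  proof (rule sum.cong)
    fix k assume k: "k \<in> ?K"
    obtain n \<nu> where "k = (n, \<nu>)" by (cases k)
    then show "X i (if fst k = 0 then ?u k else Y i (?u k)) = (if fst k = 1 then ?u k else 0)"
      using K[of n \<nu>] k X_Y_weight_vector[OF i, of "?u k" \<nu>] by auto
  qed simp
  finally have Xx: "X i x = (\<Sum>k\<in>?K. if fst k = 1 then ?u k else 0)" .
  have "Y i (X i x) = (\<Sum>k\<in>?K. if fst k = 1 then Y i (?u k) else 0)"
    unfolding Xx lin_sum[OF linear_part_op]
    by (rule sum.cong) (auto simp: lin_zero[OF linear_part_op])
  then have "hw_part i x = (\<Sum>k\<in>?K. (if fst k = 0 then ?u k else Y i (?u k)) -
      (if fst k = 1 then Y i (?u k) else 0))"
    by (subst (1) x_eq) (simp add: sum_subtractf)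
  also have "\<dots> = (\<Sum>k\<in>?K. if fst k = 0 then ?u k else 0)"
  proof (rule sum.cong)
    fix k assume k: "k \<in> ?K"
    have "fst k = 0 \<or> fst k = 1" using K(5)[of "fst k" "snd k"] k by auto
    then show "(if fst k = 0 then ?u k else Y i (?u k)) - (if fst k = 1 then Y i (?u k) else 0) =
        (if fst k = 0 then ?u k else 0)" by auto
  qed simp
  finally have hw: "hw_part i x = (\<Sum>k\<in>?K. if fst k = 0 then ?u k else 0)" .
  have comp: "component weight \<nu> (\<Sum>k\<in>?K. if fst k = m then ?u k else 0) = ?u (m, \<nu>)" for m
  proof -
    have "component weight \<nu> (\<Sum>k\<in>?K. if fst k = m then ?u k else 0) =
        (\<Sum>k\<in>?K. component weight \<nu> (if fst k = m then ?u k else 0))"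
      by (rule lin_sum[OF linear_component])
    also have "\<dots> = (\<Sum>k\<in>?K. if k = (m, \<nu>) then ?u k else 0)"
    proof (rule sum.cong)
      fix k assume k: "k \<in> ?K"
      obtain n \<nu>' where "k = (n, \<nu>')" by (cases k)
      then show "component weight \<nu> (if fst k = m then ?u k else 0) = (if k = (m, \<nu>) then ?u k else 0)"
        using K(3)[of n \<nu>'] k component_same[of "?u k" weight \<nu>] component_other[of "?u k" weight \<nu>' \<nu>]
        by (auto simp: lin_zero[OF linear_component])
    qed simp
    also have "\<dots> = ?u (m, \<nu>)" by (simp add: sum.delta in_keys_iff)
    finally show ?thesis .
  qed
  have "?u (n, \<nu>) = 0" if "n \<noteq> 0" "n \<noteq> 1"
    using K(5)[of n \<nu>] that by (auto simp: in_keys_iff)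
  then show ?thesis using comp[of 0] comp[of 1] hw Xx by simp
qed

text \<open>
  The second conclusion evaluates any linear expression in the constituents of the decomposition. It
  will be used with \<open>F\<^sub>i\<^sup>(\<^sup>n\<^sup>)\<close>, \<open>F\<^sub>i\<^sup>(\<^sup>n\<^sup>+\<^sup>1\<^sup>)\<close> and \<open>F\<^sub>i\<^sup>(\<^sup>n\<^sup>-\<^sup>1\<^sup>)\<close> as \<open>G n\<close>.
\<close>

lemma string_decomposition_exists:
  assumes i: "i \<le> l" and x: "x \<in> M"
  obtains u where "module.string_decomposition i x u"
    and "\<And>G :: nat \<Rightarrow> 'e heap_vec \<Rightarrow> 'e heap_vec. (\<And>n. Vector_Spaces.linear smult_vec smult_vec (G n)) \<Longrightarrow>
      (\<Sum>k\<in>Poly_Mapping.keys u. G (fst k) (Poly_Mapping.lookup u k)) = G 0 (hw_part i x) + G 1 (X i x)"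
proof -
  define c where "c k = (if fst k = 0 then component weight (snd k) (hw_part i x)
     else if fst k = 1 then component weight (snd k) (X i x) else 0)" for k :: "nat \<times> weight"
  define W where "W = weight ` Poly_Mapping.keys (hw_part i x) \<union> weight ` Poly_Mapping.keys (X i x)"
  have "finite W" by (simp add: W_def)
  have supp: "{k. c k \<noteq> 0} \<subseteq> {0, 1} \<times> W"
    by (auto simp: c_def component_eq_0_iff W_def split: if_splits)
  then have "finite {k. c k \<noteq> 0}"
    by (rule finite_subset) (use \<open>finite W\<close> in simp)
  define u where "u = Abs_poly_mapping c"
  have u: "Poly_Mapping.lookup u k = c k" for k
    using \<open>finite {k. c k \<noteq> 0}\<close> by (simp add: u_def)
  have keys: "Poly_Mapping.keys u \<subseteq> {0, 1} \<times> W"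
    using supp by (auto simp: in_keys_iff u)
  have hw_M: "hw_part i x \<in> M" by (rule diff_in_M[OF x Y_in_M[OF i]])
  have sums: "(\<Sum>k\<in>Poly_Mapping.keys u. G (fst k) (Poly_Mapping.lookup u k)) = G 0 (hw_part i x) + G 1 (X i x)"
    if G: "\<And>n. Vector_Spaces.linear smult_vec smult_vec (G n)" for G :: "nat \<Rightarrow> 'e heap_vec \<Rightarrow> 'e heap_vec"
  proof -
    have "(\<Sum>k\<in>Poly_Mapping.keys u. G (fst k) (Poly_Mapping.lookup u k)) =
        (\<Sum>k\<in>{0, 1} \<times> W. G (fst k) (c k))"
      unfolding u using keys \<open>finite W\<close>
      by (intro sum.mono_neutral_left) (auto simp: in_keys_iff u lin_zero[OF G])
    also have "\<dots> = (\<Sum>n\<in>{0, 1}. \<Sum>\<nu>\<in>W. G n (c (n, \<nu>)))"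
      by (simp add: sum.cartesian_product case_prod_beta)
    also have "\<dots> = G 0 (\<Sum>\<nu>\<in>W. component weight \<nu> (hw_part i x)) + G 1 (\<Sum>\<nu>\<in>W. component weight \<nu> (X i x))"
      by (simp add: c_def lin_sum[OF G])
    also have "\<dots> = G 0 (hw_part i x) + G 1 (X i x)"
      using \<open>finite W\<close> by (simp add: sum_component W_def)
    finally show ?thesis .
  qed
  have cond: "\<nu> \<in> weight_lattice l \<and> Poly_Mapping.lookup u (n, \<nu>) \<in> module.weight_space \<nu> \<and>
      module.E_act i (Poly_Mapping.lookup u (n, \<nu>)) = 0 \<and>
      module.F_div_act i n (Poly_Mapping.lookup u (n, \<nu>)) \<noteq> 0"
    if k: "(n, \<nu>) \<in> Poly_Mapping.keys u" for n \<nu>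
  proof -
    let ?v = "if n = 0 then hw_part i x else X i x"
    have n: "n = 0 \<or> n = 1" and \<nu>: "\<nu> \<in> weight_lattice l"
      using keys k weight_in_lattice by (auto simp: W_def)
    have uk: "Poly_Mapping.lookup u (n, \<nu>) = component weight \<nu> ?v"
      using n by (auto simp: u c_def)
    have vM: "component weight \<nu> ?v \<in> M"
      using hw_M X_in_M[OF i] by (intro component_in_M) auto
    have up: "\<not> step i I J" if "I \<in> Poly_Mapping.keys ?v" for I J
      using that lookup_hw_part[OF i, of x I] lookup_part_op_0[OF bi_unique_step[OF i], of I x]
        no_double_step[OF i, of _ I J] by (auto simp: in_keys_iff split: if_splits)
    have X0: "X i (component weight \<nu> ?v) = 0"
      by (rule X_eq_0I[OF i]) (use up in \<open>auto simp: in_keys_iff split: if_splits\<close>)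
    have nz: "component weight \<nu> ?v \<noteq> 0"
      using k uk by (simp add: in_keys_iff)
    have "Y i (component weight \<nu> ?v) \<noteq> 0" if "n = 1"
    proof
      assume "Y i (component weight \<nu> ?v) = 0"
      then have "X i (Y i (component weight \<nu> ?v)) = 0"
        by (simp add: lin_zero[OF linear_part_op])
      then have *: "diag_op (\<lambda>I. of_bool (\<exists>J. step i J I)) (component weight \<nu> (X i x)) = 0"
        using that by (simp add: X_Y[OF i])
      have "Poly_Mapping.lookup (component weight \<nu> (X i x)) I = 0" for I
        using arg_cong[OF *, of "\<lambda>u. Poly_Mapping.lookup u I"]
          lookup_part_op_0[OF bi_unique_step[OF i], of I x] by (auto split: if_splits)
      then show False using nz that by (auto intro: poly_mapping_eqI)
    qed
    then show ?thesis
      using n \<nu> vM nz X0 by (auto simp: uk weight_space E_act[OF i vM] F_div_act[OF i vM] in_keys_iff split: if_splits)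
  qed
  have "(\<Sum>(n, \<nu>)\<in>Poly_Mapping.keys u. module.F_div_act i n (Poly_Mapping.lookup u (n, \<nu>))) =
      (\<Sum>k\<in>Poly_Mapping.keys u. (if fst k = 0 then \<lambda>v. v else Y i) (Poly_Mapping.lookup u k))"
  proof (rule sum.cong)
    fix k assume k: "k \<in> Poly_Mapping.keys u"
    obtain n \<nu> where kn: "k = (n, \<nu>)" by (cases k)
    have "n = 0 \<or> n = 1" using k keys kn by auto
    moreover have "Poly_Mapping.lookup u k \<in> M"
      using cond[of n \<nu>] k kn by (auto simp: module.weight_space_def)
    ultimately show "(case k of (n, \<nu>) \<Rightarrow> module.F_div_act i n (Poly_Mapping.lookup u (n, \<nu>))) =
        (if fst k = 0 then \<lambda>v. v else Y i) (Poly_Mapping.lookup u k)"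
      by (auto simp: kn F_div_act[OF i])
  qed simp
  also have "\<dots> = x"
    using sums[of "\<lambda>n. if n = 0 then \<lambda>v. v else Y i"] by (simp add: linear_part_op vec.linear_ident)
  finally have "module.string_decomposition i x u"
    using cond by (auto simp: module.string_decomposition_def)
  then show thesis using that sums by blast
qed

lemma string_decomposition_THE:
  assumes i: "i \<le> l" and x: "x \<in> M" and dec: "module.string_decomposition i x u"
  shows "(THE u. module.string_decomposition i x u) = u"
proof (rule the_equality)
  show "module.string_decomposition i x u" by (rule dec)
  show "u' = u" if "module.string_decomposition i x u'" for u'
  proof (rule poly_mapping_eqI)
    fix k :: "nat \<times> weight"
    show "Poly_Mapping.lookup u' k = Poly_Mapping.lookup u k"
      by (cases k) (simp only: string_decomposition_lookup[OF i x that] string_decomposition_lookup[OF i x dec])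
  qed
qed

text \<open>On strings of length at most \<open>1\<close> the Kashiwara operators coincide with \<open>E\<^sub>i\<close> and \<open>F\<^sub>i\<close>.\<close>

lemma kashiwara:
  assumes i: "i \<le> l" and x: "x \<in> M"
  shows "module.kashiwara_f i x = Y i x"
    and "module.kashiwara_e i x = X i x"
proof -
  obtain u where dec: "module.string_decomposition i x u"
    and sums: "\<And>G :: nat \<Rightarrow> 'e heap_vec \<Rightarrow> 'e heap_vec. (\<And>n. Vector_Spaces.linear smult_vec smult_vec (G n)) \<Longrightarrow>
      (\<Sum>k\<in>Poly_Mapping.keys u. G (fst k) (Poly_Mapping.lookup u k)) = G 0 (hw_part i x) + G 1 (X i x)"
    using string_decomposition_exists[OF i x] by blast
  have M: "Poly_Mapping.lookup u k \<in> M" "fst k = 0 \<or> fst k = 1" if "k \<in> Poly_Mapping.keys u" for k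
  proof -
    have "k = (fst k, snd k)" by simp
    have 1: "Poly_Mapping.lookup u k \<in> module.weight_space (snd k)"
      and 2: "module.F_div_act i (fst k) (Poly_Mapping.lookup u k) \<noteq> 0"
      using dec that unfolding module.string_decomposition_def by (auto simp: case_prod_beta)
    then show "Poly_Mapping.lookup u k \<in> M" by (simp add: module.weight_space_def)
    then show "fst k = 0 \<or> fst k = 1" using 2 by (auto simp: F_div_act[OF i] split: if_splits)
  qed
  have lin0: "Vector_Spaces.linear smult_vec smult_vec (\<lambda>v::'e heap_vec. 0)"
    by (simp add: Vector_Spaces.linear_iff vec.vector_space_axioms)
  have "module.kashiwara_f i x =
      (\<Sum>k\<in>Poly_Mapping.keys u. (if fst k = 0 then Y i else (\<lambda>v. 0)) (Poly_Mapping.lookup u k))"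
    unfolding module.kashiwara_f_def string_decomposition_THE[OF i x dec] Let_def
    by (rule sum.cong) (auto simp: F_div_act[OF i M(1)])
  also have "\<dots> = Y i (hw_part i x)"
    using sums[of "\<lambda>n. if n = 0 then Y i else (\<lambda>v. 0)"] by (simp add: lin0 linear_part_op)
  also have "\<dots> = Y i x"
    by (simp add: lin_diff[OF linear_part_op] Y_Y_0[OF i])
  finally show "module.kashiwara_f i x = Y i x" .
  have "module.kashiwara_e i x =
      (\<Sum>k\<in>Poly_Mapping.keys u. (if fst k = 0 then (\<lambda>v. 0) else (\<lambda>v. v)) (Poly_Mapping.lookup u k))"
    unfolding module.kashiwara_e_def string_decomposition_THE[OF i x dec] Let_def
  proof (rule sum.cong)
    fix k assume k: "k \<in> Poly_Mapping.keys u"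
    then show "(case k of (n, \<nu>) \<Rightarrow> if n = 0 then 0 else module.F_div_act i (n - 1) (Poly_Mapping.lookup u (n, \<nu>))) =
      (if fst k = 0 then (\<lambda>v. 0) else (\<lambda>v. v)) (Poly_Mapping.lookup u k)"
      using M[OF k] by (auto simp: case_prod_beta F_div_act[OF i])
  qed simp
  also have "\<dots> = X i x"
    using sums[of "\<lambda>n. if n = 0 then (\<lambda>v. 0) else (\<lambda>v. v)"] by (simp add: lin0 vec.linear_ident)
  finally show "module.kashiwara_e i x = X i x" .
qed

end

section \<open>Lattices and extension of scalars\<close>

definition basis_lattice :: "'e set set \<Rightarrow> 'e heap_vec set" where
  "basis_lattice P = {v. Poly_Mapping.keys v \<subseteq> P \<and> (\<forall>I. Poly_Mapping.lookup v I \<in> A0)}"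

lemma basis_latticeI:
  "(\<And>I. Poly_Mapping.lookup v I \<in> A0) \<Longrightarrow> (\<And>I. I \<notin> P \<Longrightarrow> Poly_Mapping.lookup v I = 0) \<Longrightarrow> v \<in> basis_lattice P"
  by (auto simp: basis_lattice_def in_keys_iff)

lemma basis_latticeD:
  assumes "v \<in> basis_lattice P"
  shows "Poly_Mapping.lookup v I \<in> A0" "I \<notin> P \<Longrightarrow> Poly_Mapping.lookup v I = 0"
  using assms by (auto simp: basis_lattice_def in_keys_iff)

lemma basis_lattice_closed:
  "0 \<in> basis_lattice P"
  "u \<in> basis_lattice P \<Longrightarrow> v \<in> basis_lattice P \<Longrightarrow> u + v \<in> basis_lattice P"
  "u \<in> basis_lattice P \<Longrightarrow> v \<in> basis_lattice P \<Longrightarrow> u - v \<in> basis_lattice P"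
  "a \<in> A0 \<Longrightarrow> v \<in> basis_lattice P \<Longrightarrow> smult_vec a v \<in> basis_lattice P"
  "v \<in> basis_lattice P \<Longrightarrow> component g x v \<in> basis_lattice P"
  by (auto intro!: basis_latticeI simp: lookup_add lookup_minus A0_add A0_diff A0_mult basis_latticeD)

lemma basis_lattice_sum:
  "(\<And>i. i \<in> X \<Longrightarrow> f i \<in> basis_lattice P) \<Longrightarrow> sum f X \<in> basis_lattice P"
  by (induction X rule: infinite_finite_induct) (auto intro: basis_lattice_closed)

lemma basis_vec_in_lattice: "I \<in> P \<Longrightarrow> basis_vec I \<in> basis_lattice P"
  by (auto intro!: basis_latticeI simp: lookup_basis_vec)

lemma part_op_in_lattice:
  assumes "bi_unique R" "\<And>I J. R I J \<Longrightarrow> J \<in> P" "v \<in> basis_lattice P"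
  shows "part_op R v \<in> basis_lattice P"
proof (rule basis_latticeI)
  show "Poly_Mapping.lookup (part_op R v) J \<in> A0" for J
    using assms(3) lookup_part_op[OF assms(1), of _ J v] lookup_part_op_0[OF assms(1), of J v]
    by (cases "\<exists>I. R I J") (auto dest: basis_latticeD)
  show "Poly_Mapping.lookup (part_op R v) J = 0" if "J \<notin> P" for J
    using that assms(2) lookup_part_op_0[OF assms(1)] by blast
qed

context quantum_affine_module
begin

lemma tensor_eval_superset:
  assumes "finite S" "Poly_Mapping.keys t \<subseteq> S"
  shows "tensor_eval t = (\<Sum>k\<in>S. scale (of_int (Poly_Mapping.lookup t k) * fst k) (snd k))"
  unfolding tensor_eval_def case_prod_beta prod.collapse
  by (rule sum.mono_neutral_left) (use assms in \<open>auto simp: in_keys_iff\<close>)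

lemma tensor_eval_diff: "tensor_eval (s - t) = tensor_eval s - tensor_eval t"
proof -
  let ?S = "Poly_Mapping.keys s \<union> Poly_Mapping.keys t"
  have "Poly_Mapping.keys (s - t) \<subseteq> ?S" by (rule keys_diff)
  then show ?thesis
    by (simp add: tensor_eval_superset[of ?S] lookup_minus left_diff_distrib
        scale_left_diff_distrib sum_subtractf)
qed

lemma tensor_eval_0: "tensor_eval 0 = 0"
  by (simp add: tensor_eval_def)

lemma tensor_eval_single: "tensor_eval (Poly_Mapping.single (c, x) 1) = scale c x"
  by (simp add: tensor_eval_def)

lemma tensor_null_eval:
  assumes L: "A0_submodule L" and t: "t \<in> tensor_null scale L"
  shows "Poly_Mapping.keys t \<subseteq> UNIV \<times> L \<and> tensor_eval t = 0"
  using t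
proof induction
  case (diff s t)
  then show ?case using keys_diff[of s t] by (auto simp: tensor_eval_diff)
next
  case (left x c d)
  then show ?case
    using keys_diff[of "Poly_Mapping.single (c + d, x) 1 - Poly_Mapping.single (c, x) 1"
        "Poly_Mapping.single (d, x) 1 :: qrat \<times> 'v \<Rightarrow>\<^sub>0 int"]
      keys_diff[of "Poly_Mapping.single (c + d, x) 1" "Poly_Mapping.single (c, x) 1 :: qrat \<times> 'v \<Rightarrow>\<^sub>0 int"]
    by (auto simp: tensor_eval_diff tensor_eval_single scale_left_distrib)
next
  case (right x y c)
  then have "x + y \<in> L" using L by (auto simp: A0_submodule_def)
  then show ?case
    using right keys_diff[of "Poly_Mapping.single (c, x + y) 1 - Poly_Mapping.single (c, x) 1"
        "Poly_Mapping.single (c, y) 1 :: qrat \<times> 'v \<Rightarrow>\<^sub>0 int"]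
      keys_diff[of "Poly_Mapping.single (c, x + y) 1" "Poly_Mapping.single (c, x) 1 :: qrat \<times> 'v \<Rightarrow>\<^sub>0 int"]
    by (auto simp: tensor_eval_diff tensor_eval_single scale_right_distrib)
next
  case (balanced x a c)
  then have "scale a x \<in> L" using L by (auto simp: A0_submodule_def)
  then show ?case
    using balanced keys_diff[of "Poly_Mapping.single (c * a, x) 1"
        "Poly_Mapping.single (c, scale a x) 1 :: qrat \<times> 'v \<Rightarrow>\<^sub>0 int"]
    by (auto simp: tensor_eval_diff tensor_eval_single)
qed (simp add: tensor_eval_0)

lemma tensor_null_add:
  assumes "s \<in> tensor_null scale L" "t \<in> tensor_null scale L"
  shows "s + t \<in> tensor_null scale L"
  using tensor_null.diff[OF assms(1) tensor_null.diff[OF tensor_null.zero assms(2)]] by simp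

lemma tensor_null_zero_right:
  assumes "0 \<in> L"
  shows "Poly_Mapping.single (c, 0) 1 \<in> tensor_null scale L"
  using tensor_null.diff[OF tensor_null.zero tensor_null.right[OF assms assms]] by simp

lemma tensor_null_zero_left:
  assumes "x \<in> L"
  shows "Poly_Mapping.single (0, x) 1 \<in> tensor_null scale L"
  using tensor_null.diff[OF tensor_null.zero tensor_null.left[OF assms, of 0 0]] by simp

text \<open>
  Since \<^const>\<open>A0\<close> is a valuation ring, of any two scalars one is a regular multiple of the other, and so every
  element of \<open>\<rat>(q) \<otimes> L\<close> is a pure tensor.
\<close>

lemma pure_tensor:
  assumes L: "A0_submodule L" and t: "Poly_Mapping.keys t \<subseteq> UNIV \<times> L"
  shows "\<exists>c y. c \<noteq> 0 \<and> y \<in> L \<and> t - Poly_Mapping.single (c, y) 1 \<in> tensor_null scale L"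
  using t
proof (induction t rule: frag_induction)
  case zero
  have "0 \<in> L" using L by (simp add: A0_submodule_def)
  then show ?case
    using tensor_null.diff[OF tensor_null.zero tensor_null_zero_right[OF \<open>0 \<in> L\<close>, of 1]]
    by (intro exI[of _ 1] exI[of _ 0]) auto
next
  case (one k)
  then obtain c x where k: "k = (c, x)" "x \<in> L" by auto
  have "0 \<in> L" using L by (simp add: A0_submodule_def)
  show ?case
  proof (cases "c = 0")
    case True
    then show ?thesis
      using tensor_null.diff[OF tensor_null_zero_left[OF k(2)] tensor_null_zero_right[OF \<open>0 \<in> L\<close>, of 1]] k \<open>0 \<in> L\<close>
      by (intro exI[of _ 1] exI[of _ 0]) auto
  next
    case False
    then show ?thesis using k tensor_null.zero by (intro exI[of _ c] exI[of _ x]) auto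
  qed
next
  case (diff s t)
  then obtain c y d z where c: "c \<noteq> 0" "y \<in> L" "s - Poly_Mapping.single (c, y) 1 \<in> tensor_null scale L"
    and d: "d \<noteq> 0" "z \<in> L" "t - Poly_Mapping.single (d, z) 1 \<in> tensor_null scale L"
    by blast
  have st: "(s - Poly_Mapping.single (c, y) 1) - (t - Poly_Mapping.single (d, z) 1) \<in> tensor_null scale L"
    by (rule tensor_null.diff[OF c(3) d(3)])
  have L_diff: "x - y \<in> L" if "x \<in> L" "y \<in> L" for x y
  proof -
    have "scale (- 1) y \<in> L" using L that(2) A0_uminus[OF A0_1] unfolding A0_submodule_def by blast
    then have "x + scale (- 1) y \<in> L" using L that(1) by (auto simp: A0_submodule_def)
    then show ?thesis by simp
  qed
  have minus: "Poly_Mapping.single (e, x) 1 - Poly_Mapping.single (e, x' :: 'v) 1 -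
      Poly_Mapping.single (e, x - x') 1 \<in> tensor_null scale L" if "x \<in> L" "x' \<in> L" for e x x'
    using tensor_null.right[OF L_diff[OF that] that(2), of e] by (simp add: algebra_simps)
  have move: "Poly_Mapping.single (e * a, x) 1 - Poly_Mapping.single (e, scale a x) 1 \<in> tensor_null scale L"
    "scale a x \<in> L" if "x \<in> L" "a \<in> A0" for e a x
    using tensor_null.balanced[OF that] L that by (auto simp: A0_submodule_def)
  \<comment> \<open>The quotient of the two scalars moves across the tensor sign, in the direction in which it is regular.\<close>
  have "c / d \<in> A0 \<or> d / c \<in> A0"
    using A0_valuation_ring[of "c / d"] by simp
  then show ?case
  proof
    assume a: "c / d \<in> A0"
    let ?y = "scale (c / d) y"
    have 1: "Poly_Mapping.single (c, y) 1 - Poly_Mapping.single (d, ?y) 1 \<in> tensor_null scale L" "?y \<in> L"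
      using move(1)[OF c(2) a, of d] move(2)[OF c(2) a] d(1) by simp_all
    have "(s - t) - Poly_Mapping.single (d, ?y - z) 1 \<in> tensor_null scale L"
      using tensor_null_add[OF tensor_null_add[OF st 1(1)] minus[OF 1(2) d(2), of d]]
      by (simp add: algebra_simps)
    then show ?thesis using d(1) L_diff[OF 1(2) d(2)] by blast
  next
    assume a: "d / c \<in> A0"
    let ?z = "scale (d / c) z"
    have 1: "Poly_Mapping.single (d, z) 1 - Poly_Mapping.single (c, ?z) 1 \<in> tensor_null scale L" "?z \<in> L"
      using move(1)[OF d(2) a, of c] move(2)[OF d(2) a] c(1) by simp_all
    have "(s - t) - Poly_Mapping.single (c, y - ?z) 1 \<in> tensor_null scale L"
      using tensor_null_add[OF tensor_null.diff[OF st 1(1)] minus[OF c(2) 1(2), of c]]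
      by (simp add: algebra_simps)
    then show ?thesis using c(1) L_diff[OF c(2) 1(2)] by blast
  qed
qed

lemma extension_of_scalarsI:
  assumes L: "A0_submodule L" and M: "M = span L"
  shows "extension_of_scalars L"
  unfolding extension_of_scalars_def
proof
  show "{t. Poly_Mapping.keys t \<subseteq> UNIV \<times> L \<and> tensor_eval t = 0} = tensor_null scale L"
  proof
    show "tensor_null scale L \<subseteq> {t. Poly_Mapping.keys t \<subseteq> UNIV \<times> L \<and> tensor_eval t = 0}"
      using tensor_null_eval[OF L] by blast
    show "{t. Poly_Mapping.keys t \<subseteq> UNIV \<times> L \<and> tensor_eval t = 0} \<subseteq> tensor_null scale L"
    proof
      fix t :: "qrat \<times> 'v \<Rightarrow>\<^sub>0 int" assume t: "t \<in> {t. Poly_Mapping.keys t \<subseteq> UNIV \<times> L \<and> tensor_eval t = 0}"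
      then obtain c y where c: "c \<noteq> 0" "y \<in> L" "t - Poly_Mapping.single (c, y) 1 \<in> tensor_null scale L"
        using pure_tensor[OF L] by blast
      have "scale c y = 0"
        using tensor_null_eval[OF L c(3)] t by (simp add: tensor_eval_diff tensor_eval_single)
      then have "y = 0" using c(1) by simp
      then show "t \<in> tensor_null scale L"
        using tensor_null_add[OF c(3) tensor_null_zero_right[of L c]] c(2) by simp
    qed
  qed
  show "tensor_eval ` {t. Poly_Mapping.keys t \<subseteq> UNIV \<times> L} = M"
  proof
    show "tensor_eval ` {t. Poly_Mapping.keys t \<subseteq> UNIV \<times> L} \<subseteq> M"
    proof clarify
      fix t :: "qrat \<times> 'v \<Rightarrow>\<^sub>0 int" assume "Poly_Mapping.keys t \<subseteq> UNIV \<times> L"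
      then obtain c y where c: "y \<in> L" "t - Poly_Mapping.single (c, y) 1 \<in> tensor_null scale L"
        using pure_tensor[OF L] by blast
      have "tensor_eval t = scale c y"
        using tensor_null_eval[OF L c(2)] by (simp add: tensor_eval_diff tensor_eval_single)
      then show "tensor_eval t \<in> M" using c(1) M by (simp add: span_base span_scale)
    qed
    show "M \<subseteq> tensor_eval ` {t. Poly_Mapping.keys t \<subseteq> UNIV \<times> L}"
    proof
      fix x assume "x \<in> M"
      then have "x \<in> span L" using M by simp
      then show "x \<in> tensor_eval ` {t. Poly_Mapping.keys t \<subseteq> UNIV \<times> L}"
      proof (induction rule: span_induct_alt)
        case base
        show ?case using tensor_eval_0 by (intro image_eqI[of _ _ 0]) auto
      next
        case (step c y x)
        then obtain t where t: "x = tensor_eval t" "Poly_Mapping.keys t \<subseteq> UNIV \<times> L" by auto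
        have "scale c y + x = tensor_eval (t - Poly_Mapping.single (- c, y) 1)"
          by (simp add: t(1) tensor_eval_diff tensor_eval_single)
        moreover have "Poly_Mapping.keys (t - Poly_Mapping.single (- c, y) 1) \<subseteq> UNIV \<times> L"
          using keys_diff[of t "Poly_Mapping.single (- c, y) 1"] t(2) step.hyps by auto
        ultimately show ?case by blast
      qed
    qed
  qed
qed

end

section \<open>The crystal basis of a minuscule crystal\<close>

context minuscule_crystal
begin

abbreviation L where "L \<equiv> basis_lattice P"

lemma L_subset_M: "L \<subseteq> M"
  by (auto simp: basis_lattice_def M_def)

lemma A0_submodule_L: "module.A0_submodule L"
  using L_subset_M by (auto simp: module.A0_submodule_def basis_lattice_closed)

lemma span_L: "vec.span L = M"
proof
  show "vec.span L \<subseteq> M" by (rule vec.span_minimal[OF L_subset_M subspace_M])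
  show "M \<subseteq> vec.span L"
  proof
    fix v assume "v \<in> M"
    then have "(\<Sum>I\<in>Poly_Mapping.keys v. smult_vec (Poly_Mapping.lookup v I) (basis_vec I)) \<in> vec.span L"
      by (intro vec.span_sum vec.span_scale vec.span_base basis_vec_in_lattice) (auto simp: M_def)
    then show "v \<in> vec.span L" using vec_expand[of v] by simp
  qed
qed

lemma A0_basis_L: "module.A0_basis (basis_vec ` P) L"
  unfolding module.A0_basis_def
proof
  show "basis_vec ` P \<subseteq> L" by (auto intro: basis_vec_in_lattice)
  let ?s = "\<lambda>c. \<Sum>b\<in>Poly_Mapping.keys c. smult_vec (Poly_Mapping.lookup c b) b"
  let ?C = "{c. Poly_Mapping.keys c \<subseteq> basis_vec ` P \<and> (\<forall>b. Poly_Mapping.lookup c b \<in> A0)}"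
  have coord: "Poly_Mapping.lookup (?s c) I = Poly_Mapping.lookup c (basis_vec I)"
    if "Poly_Mapping.keys c \<subseteq> basis_vec ` P" for c I
  proof -
    have "Poly_Mapping.lookup (?s c) I =
        (\<Sum>b\<in>Poly_Mapping.keys c. if b = basis_vec I then Poly_Mapping.lookup c b else 0)"
      unfolding lookup_sum lookup_smult_vec
      by (rule sum.cong) (use that in \<open>auto simp: lookup_basis_vec\<close>)
    then show ?thesis by (simp add: sum.delta in_keys_iff)
  qed
  show "bij_betw ?s ?C L"
  proof (rule bij_betwI')
    fix c c' assume c: "c \<in> ?C" "c' \<in> ?C"
    show "?s c = ?s c' \<longleftrightarrow> c = c'"
    proof
      assume eq: "?s c = ?s c'"
      show "c = c'"
      proof (rule poly_mapping_eqI)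
        fix b
        show "Poly_Mapping.lookup c b = Poly_Mapping.lookup c' b"
        proof (cases "b \<in> basis_vec ` P")
          case True
          then show ?thesis using coord[of c] coord[of c'] c eq by auto
        next
          case False
          then have "b \<notin> Poly_Mapping.keys c" "b \<notin> Poly_Mapping.keys c'" using c by auto
          then show ?thesis by (simp add: in_keys_iff)
        qed
      qed
    qed simp
  next
    fix c assume c: "c \<in> ?C"
    show "?s c \<in> L"
      by (intro basis_lattice_sum basis_lattice_closed) (use c in \<open>auto intro: basis_vec_in_lattice\<close>)
  next
    fix v assume v: "v \<in> L"
    define f where "f b = (if b \<in> basis_vec ` P then Poly_Mapping.lookup v (the_inv basis_vec b) else 0)" for b
    have "{b. f b \<noteq> 0} \<subseteq> basis_vec ` Poly_Mapping.keys v"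
      by (auto simp: f_def inj_basis_vec the_inv_f_f in_keys_iff)
    then have "finite {b. f b \<noteq> 0}" by (rule finite_subset) simp
    then have lc: "Poly_Mapping.lookup (Abs_poly_mapping f) = f" by simp
    define c where "c = Abs_poly_mapping f"
    have c: "Poly_Mapping.lookup c b = f b" for b
      by (simp add: c_def lc)
    have cC: "c \<in> ?C"
      using v by (auto simp: c f_def in_keys_iff basis_latticeD split: if_splits)
    have "v = ?s c"
    proof (rule poly_mapping_eqI)
      fix I
      have "Poly_Mapping.lookup (?s c) I = Poly_Mapping.lookup c (basis_vec I)"
        using cC by (intro coord) simp
      then show "Poly_Mapping.lookup v I = Poly_Mapping.lookup (?s c) I"
        using basis_latticeD(2)[OF v, of I] by (auto simp: c f_def the_inv_f_f inj_basis_vec)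
    qed
    then show "\<exists>c\<in>?C. v = ?s c" using cC by blast
  qed
qed

lemma self_in_q_coset: "x \<in> module.q_coset L x"
proof -
  have "x = x + smult_vec qq 0" by simp
  then show ?thesis unfolding module.q_coset_def using basis_lattice_closed(1) by blast
qed

lemma q_coset_eq_iff:
  assumes "x \<in> L" "y \<in> L"
  shows "module.q_coset L x = module.q_coset L y \<longleftrightarrow> (\<exists>z\<in>L. x = y + smult_vec qq z)"
proof
  assume "module.q_coset L x = module.q_coset L y"
  then have "x \<in> module.q_coset L y" using self_in_q_coset by blast
  then show "\<exists>z\<in>L. x = y + smult_vec qq z" by (auto simp: module.q_coset_def)
next
  assume "\<exists>z\<in>L. x = y + smult_vec qq z"
  then obtain z where z: "z \<in> L" "x = y + smult_vec qq z" by blast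
  have "\<exists>w'\<in>L. x + smult_vec qq w = y + smult_vec qq w'" if "w \<in> L" for w
    using that z by (intro bexI[of _ "z + w"]) (auto simp: vec.scale_right_distrib basis_lattice_closed)
  moreover have "\<exists>w'\<in>L. y + smult_vec qq w = x + smult_vec qq w'" if "w \<in> L" for w
    using that z by (intro bexI[of _ "w - z"]) (auto simp: vec.scale_right_diff_distrib basis_lattice_closed)
  ultimately show "module.q_coset L x = module.q_coset L y" unfolding module.q_coset_def by blast
qed

lemma q_coset_eqD:
  assumes "x \<in> L" "y \<in> L" "module.q_coset L x = module.q_coset L y"
  shows "\<exists>d\<in>A0. Poly_Mapping.lookup x I - Poly_Mapping.lookup y I = qq * d"
proof -
  obtain z where "z \<in> L" "x = y + smult_vec qq z"
    using assms q_coset_eq_iff by blast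
  then show ?thesis by (intro bexI[of _ "Poly_Mapping.lookup z I"]) (simp_all add: lookup_add basis_latticeD)
qed

definition crystal_elt :: "'e set \<Rightarrow> 'e heap_vec set" where
  "crystal_elt I = module.q_coset L (basis_vec I)"

lemma crystal_elt_conv_comp: "module.q_coset L \<circ> basis_vec = crystal_elt"
  by (simp add: fun_eq_iff crystal_elt_def)

lemma one_notin_qA0: "d \<in> A0 \<Longrightarrow> qq * d \<noteq> 1"
  using const_in_qA0[of 1 d] by (auto simp: One_fract_def one_pCons)

lemma inj_crystal_elt: "inj_on crystal_elt P"
proof (rule inj_onI, rule ccontr)
  fix I J assume IJ: "I \<in> P" "J \<in> P" "crystal_elt I = crystal_elt J" "I \<noteq> J"
  obtain d where "d \<in> A0" "Poly_Mapping.lookup (basis_vec I) I - Poly_Mapping.lookup (basis_vec J) I = qq * d"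
    using q_coset_eqD[OF basis_vec_in_lattice[OF IJ(1)] basis_vec_in_lattice[OF IJ(2)], of I] IJ(3)
    by (auto simp: crystal_elt_def)
  then show False using IJ one_notin_qA0[of d] by (simp add: lookup_basis_vec)
qed

lemma crystal_elt_nonzero: "I \<in> P \<Longrightarrow> crystal_elt I \<noteq> module.q_coset L 0"
proof
  assume I: "I \<in> P" "crystal_elt I = module.q_coset L 0"
  obtain d where "d \<in> A0" "Poly_Mapping.lookup (basis_vec I) I - Poly_Mapping.lookup 0 I = qq * d"
    using q_coset_eqD[OF basis_vec_in_lattice[OF I(1)] basis_lattice_closed(1), of I] I(2)
    by (auto simp: crystal_elt_def)
  then show False using one_notin_qA0[of d] by (simp add: lookup_basis_vec)
qed

text \<open>
  Linear combinations in \<open>\<L>/q\<L>\<close> are formed from arbitrarily chosen representatives of the cosets. Each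
  differs from the basis vector \<open>v\<^sub>I\<close> of its coset by an element of \<open>q\<L>\<close>, so the \<open>v\<^sub>I\<close> may be used instead, and
  the claim is reduced coefficientwise to \<open>\<A>\<^sub>0/q\<A>\<^sub>0 = \<rat>\<close>.
\<close>

lemma rat_basis: "module.rat_basis_of_quotient L (crystal_elt ` P)"
  unfolding module.rat_basis_of_quotient_def
proof
  show "crystal_elt ` P \<subseteq> module.q_quotient L"
    by (auto simp: module.q_quotient_def crystal_elt_def basis_vec_in_lattice)
  let ?B = "crystal_elt ` P"
  let ?k = "\<lambda>r. Fract [:r:] 1 :: qrat"
  let ?s = "\<lambda>c. \<Sum>b\<in>Poly_Mapping.keys c. smult_vec (?k (Poly_Mapping.lookup c b)) (SOME x. x \<in> b)"
  define idx where "idx = the_inv_into P crystal_elt"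
  have idx: "idx (crystal_elt I) = I" if "I \<in> P" for I
    unfolding idx_def by (rule the_inv_into_f_f[OF inj_crystal_elt that])
  define rep where "rep c = (\<Sum>b\<in>Poly_Mapping.keys c. smult_vec (?k (Poly_Mapping.lookup c b)) (basis_vec (idx b)))"
    for c :: "'e heap_vec set \<Rightarrow>\<^sub>0 rat"
  have rep_L: "rep c \<in> L" if "Poly_Mapping.keys c \<subseteq> ?B" for c
    unfolding rep_def using that idx
    by (intro basis_lattice_sum basis_lattice_closed const_in_A0 basis_vec_in_lattice) auto
  have coset_rep: "module.q_coset L (?s c) = module.q_coset L (rep c)" if c: "Poly_Mapping.keys c \<subseteq> ?B" for c
  proof -
    have "\<forall>b\<in>Poly_Mapping.keys c. \<exists>y\<in>L. (SOME x. x \<in> b) = basis_vec (idx b) + smult_vec qq y"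
    proof
      fix b assume "b \<in> Poly_Mapping.keys c"
      then obtain I where I: "I \<in> P" "b = crystal_elt I" using c by auto
      have "basis_vec I \<in> b"
        using I self_in_q_coset by (simp add: crystal_elt_def)
      then have "(SOME x. x \<in> b) \<in> b" by (rule someI)
      then show "\<exists>y\<in>L. (SOME x. x \<in> b) = basis_vec (idx b) + smult_vec qq y"
        using I idx[OF I(1)] by (auto simp: module.q_coset_def crystal_elt_def)
    qed
    then obtain y where y: "\<And>b. b \<in> Poly_Mapping.keys c \<Longrightarrow> y b \<in> L"
      "\<And>b. b \<in> Poly_Mapping.keys c \<Longrightarrow> (SOME x. x \<in> b) = basis_vec (idx b) + smult_vec qq (y b)"
      by metis
    let ?z = "\<Sum>b\<in>Poly_Mapping.keys c. smult_vec (?k (Poly_Mapping.lookup c b)) (y b)"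
    have z: "?z \<in> L" using y(1) by (intro basis_lattice_sum basis_lattice_closed const_in_A0)
    have eq: "?s c = rep c + smult_vec qq ?z"
      by (simp add: rep_def y(2) vec.scale_right_distrib sum.distrib vec.scale_sum_right mult.commute)
    have "?s c \<in> L"
      unfolding eq by (intro basis_lattice_closed rep_L[OF c] z A0_qq)
    then show ?thesis using q_coset_eq_iff[OF _ rep_L[OF c]] eq z by blast
  qed
  have lookup_rep: "Poly_Mapping.lookup (rep c) I = ?k (Poly_Mapping.lookup c (crystal_elt I))"
    if c: "Poly_Mapping.keys c \<subseteq> ?B" and I: "I \<in> P" for c I
  proof -
    have "Poly_Mapping.lookup (rep c) I =
        (\<Sum>b\<in>Poly_Mapping.keys c. if b = crystal_elt I then ?k (Poly_Mapping.lookup c b) else 0)"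
      unfolding rep_def lookup_sum lookup_smult_vec lookup_basis_vec
    proof (rule sum.cong)
      fix b assume "b \<in> Poly_Mapping.keys c"
      then obtain J where J: "J \<in> P" "b = crystal_elt J" using c by auto
      then have "idx b = I \<longleftrightarrow> b = crystal_elt I"
        using idx I inj_onD[OF inj_crystal_elt, of J I] by auto
      then show "?k (Poly_Mapping.lookup c b) * of_bool (idx b = I) =
          (if b = crystal_elt I then ?k (Poly_Mapping.lookup c b) else 0)" by simp
    qed simp
    then show ?thesis by (simp add: sum.delta in_keys_iff Zero_fract_def)
  qed
  show "bij_betw (\<lambda>c. module.q_coset L (?s c))
    {c :: 'e heap_vec set \<Rightarrow>\<^sub>0 rat. Poly_Mapping.keys c \<subseteq> ?B} (module.q_quotient L)"
  proof (rule bij_betwI')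
    fix c c' :: "'e heap_vec set \<Rightarrow>\<^sub>0 rat"
    assume "c \<in> {c. Poly_Mapping.keys c \<subseteq> ?B}" "c' \<in> {c. Poly_Mapping.keys c \<subseteq> ?B}"
    then have c: "Poly_Mapping.keys c \<subseteq> ?B" "Poly_Mapping.keys c' \<subseteq> ?B" by auto
    show "module.q_coset L (?s c) = module.q_coset L (?s c') \<longleftrightarrow> c = c'"
    proof
      assume "module.q_coset L (?s c) = module.q_coset L (?s c')"
      then have eq: "module.q_coset L (rep c) = module.q_coset L (rep c')"
        using coset_rep c by simp
      show "c = c'"
      proof (rule poly_mapping_eqI)
        fix b
        show "Poly_Mapping.lookup c b = Poly_Mapping.lookup c' b"
        proof (cases "b \<in> ?B")
          case True
          then obtain I where I: "I \<in> P" "b = crystal_elt I" by blast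
          obtain d where d: "d \<in> A0" "Poly_Mapping.lookup (rep c) I - Poly_Mapping.lookup (rep c') I = qq * d"
            using q_coset_eqD[OF rep_L[OF c(1)] rep_L[OF c(2)] eq] by blast
          then have "?k (Poly_Mapping.lookup c b - Poly_Mapping.lookup c' b) = qq * d"
            using I lookup_rep[OF c(1) I(1)] lookup_rep[OF c(2) I(1)] by simp
          then show ?thesis using const_in_qA0 d(1) by fastforce
        next
          case False
          then have "b \<notin> Poly_Mapping.keys c" "b \<notin> Poly_Mapping.keys c'" using c by auto
          then show ?thesis by (simp add: in_keys_iff)
        qed
      qed
    qed simp
  next
    fix c :: "'e heap_vec set \<Rightarrow>\<^sub>0 rat"
    assume "c \<in> {c. Poly_Mapping.keys c \<subseteq> ?B}"
    then show "module.q_coset L (?s c) \<in> module.q_quotient L"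
      using coset_rep rep_L by (auto simp: module.q_quotient_def)
  next
    fix X assume "X \<in> module.q_quotient L"
    then obtain x where x: "x \<in> L" "X = module.q_coset L x" by (auto simp: module.q_quotient_def)
    have "\<forall>I. \<exists>r. \<exists>d\<in>A0. Poly_Mapping.lookup x I = ?k r + qq * d"
      using x(1) A0_residue by (simp add: basis_latticeD)
    then obtain r d where d: "\<And>I. d I \<in> A0" and r: "\<And>I. Poly_Mapping.lookup x I = ?k (r I) + qq * d I"
      by metis
    have r0: "r I = 0" if "I \<notin> Poly_Mapping.keys x" for I
    proof -
      have "?k (r I) = qq * (- d I)"
        using r[of I] that by (simp add: in_keys_iff add_eq_0_iff)
      then show ?thesis using const_in_qA0 A0_uminus[OF d] by blast
    qed
    define f where "f b = (if b \<in> ?B then r (idx b) else 0)" for b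
    have "{b. f b \<noteq> 0} \<subseteq> crystal_elt ` Poly_Mapping.keys x"
    proof
      fix b assume "b \<in> {b. f b \<noteq> 0}"
      then have b: "b \<in> ?B" "r (idx b) \<noteq> 0" by (auto simp: f_def split: if_splits)
      then obtain I where "I \<in> P" "b = crystal_elt I" by blast
      then show "b \<in> crystal_elt ` Poly_Mapping.keys x" using b(2) idx r0 by auto
    qed
    then have fin: "finite {b. f b \<noteq> 0}" by (rule finite_subset) simp
    define c where "c = Abs_poly_mapping f"
    have c: "Poly_Mapping.lookup c = f" using fin by (simp add: c_def)
    have cB: "Poly_Mapping.keys c \<subseteq> ?B" by (auto simp: in_keys_iff c f_def split: if_splits)
    have lk: "Poly_Mapping.lookup x I = Poly_Mapping.lookup (rep c) I + qq * (if I \<in> P then d I else 0)" for I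
    proof (cases "I \<in> P")
      case True
      then show ?thesis using r[of I] lookup_rep[OF cB True] idx[OF True] by (simp add: c f_def)
    next
      case False
      then show ?thesis using basis_latticeD(2)[OF x(1) False] basis_latticeD(2)[OF rep_L[OF cB] False] by simp
    qed
    have "smult_vec (inverse qq) (x - rep c) \<in> L"
    proof (rule basis_latticeI)
      fix I
      have "Poly_Mapping.lookup (smult_vec (inverse qq) (x - rep c)) I = (if I \<in> P then d I else 0)"
        by (simp add: lookup_minus lk)
      then show "Poly_Mapping.lookup (smult_vec (inverse qq) (x - rep c)) I \<in> A0"
        "I \<notin> P \<Longrightarrow> Poly_Mapping.lookup (smult_vec (inverse qq) (x - rep c)) I = 0"
        using d by auto
    qed
    moreover have "x = rep c + smult_vec qq (smult_vec (inverse qq) (x - rep c))"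
      by simp
    ultimately have "X = module.q_coset L (rep c)"
      unfolding x(2) using q_coset_eq_iff[OF x(1) rep_L[OF cB]] by blast
    then show "\<exists>c\<in>{c. Poly_Mapping.keys c \<subseteq> ?B}. X = module.q_coset L (?s c)"
      using coset_rep[OF cB] cB by blast
  qed
qed

lemma X_in_L: "i \<le> l \<Longrightarrow> x \<in> L \<Longrightarrow> X i x \<in> L"
  using step_mem by (blast intro: part_op_in_lattice bi_unique_step)

lemma Y_in_L: "i \<le> l \<Longrightarrow> x \<in> L \<Longrightarrow> Y i x \<in> L"
  using step_mem by (blast intro: part_op_in_lattice bi_unique_step')

text \<open>
  An operator agreeing on \<open>\<L>\<close> with a linear one that preserves \<open>\<L>\<close> takes congruent vectors to congruent
  vectors, so the union in the definition of the induced operator is a single coset.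
\<close>

lemma induced_crystal_elt:
  assumes T: "\<And>x. x \<in> L \<Longrightarrow> T x = T' x" and lin: "Vector_Spaces.linear smult_vec smult_vec T'"
    and stable: "\<And>x. x \<in> L \<Longrightarrow> T' x \<in> L" and I: "I \<in> P"
  shows "module.induced L T (crystal_elt I) = module.q_coset L (T' (basis_vec I))"
proof -
  have I_L: "basis_vec I \<in> L" by (rule basis_vec_in_lattice[OF I])
  have same: "module.q_coset L (T x) = module.q_coset L (T' (basis_vec I))" if xI: "x \<in> crystal_elt I" for x
  proof -
    obtain y where y: "y \<in> L" "x = basis_vec I + smult_vec qq y"
      using xI by (auto simp: module.q_coset_def crystal_elt_def)
    then have x: "x \<in> L" using I_L by (simp add: basis_lattice_closed)
    have "T x = T' (basis_vec I) + smult_vec qq (T' y)"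
      using T[OF x] y by (simp add: lin_add[OF lin] lin_scale[OF lin])
    moreover have "T x \<in> L" using T[OF x] stable[OF x] by simp
    ultimately show ?thesis
      using q_coset_eq_iff[OF _ stable[OF I_L]] stable[OF y(1)] by blast
  qed
  have "basis_vec I \<in> crystal_elt I"
    using self_in_q_coset by (simp add: crystal_elt_def)
  then show ?thesis unfolding module.induced_def using same by blast
qed

lemma induced_kashiwara:
  assumes i: "i \<le> l" and I: "I \<in> P"
  shows "module.induced L (module.kashiwara_e i) (crystal_elt I) = module.q_coset L (X i (basis_vec I))"
    and "module.induced L (module.kashiwara_f i) (crystal_elt I) = module.q_coset L (Y i (basis_vec I))"
proof -
  have "module.kashiwara_e i x = X i x" "module.kashiwara_f i x = Y i x"
    if "x \<in> L" for x
    using kashiwara[OF i] that L_subset_M by auto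
  note eq = this
  show "module.induced L (module.kashiwara_e i) (crystal_elt I) = module.q_coset L (X i (basis_vec I))"
    by (rule induced_crystal_elt[OF eq(1) linear_part_op X_in_L[OF i] I])
  show "module.induced L (module.kashiwara_f i) (crystal_elt I) = module.q_coset L (Y i (basis_vec I))"
    by (rule induced_crystal_elt[OF eq(2) linear_part_op Y_in_L[OF i] I])
qed

lemma induced_kashiwara_eq_iff:
  assumes i: "i \<le> l" and I: "I \<in> P" and J: "J \<in> P"
  shows "crystal_elt J = module.induced L (module.kashiwara_e i) (crystal_elt I) \<longleftrightarrow> step i I J"
    and "crystal_elt J = module.induced L (module.kashiwara_f i) (crystal_elt I) \<longleftrightarrow> step i J I"
proof -
  have *: "crystal_elt J = module.q_coset L (part_op R (basis_vec I)) \<longleftrightarrow> R I J"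
    if R: "bi_unique R" "\<And>I J. R I J \<Longrightarrow> J \<in> P" for R
  proof (cases "\<exists>K. R I K")
    case True
    then obtain K where K: "R I K" by blast
    have "crystal_elt J = crystal_elt K \<longleftrightarrow> J = K"
      using inj_crystal_elt J R(2)[OF K] by (auto dest: inj_onD)
    also have "\<dots> \<longleftrightarrow> R I J" using K R(1) by (auto dest: bi_uniqueDr)
    finally show ?thesis using part_op_basis_vec[OF R(1) K] by (simp add: crystal_elt_def)
  next
    case False
    then show ?thesis using crystal_elt_nonzero[OF J] by (simp add: part_op_basis_vec_0)
  qed
  show "crystal_elt J = module.induced L (module.kashiwara_e i) (crystal_elt I) \<longleftrightarrow> step i I J"
    unfolding induced_kashiwara[OF i I] by (rule *[OF bi_unique_step[OF i]]) (use step_mem i in blast)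
  show "crystal_elt J = module.induced L (module.kashiwara_f i) (crystal_elt I) \<longleftrightarrow> step i J I"
    unfolding induced_kashiwara[OF i I]
    by (subst *[OF bi_unique_step'[OF i]]) (use step_mem i in auto)
qed

lemma induced_kashiwara_range:
  assumes i: "i \<le> l" and I: "I \<in> P"
  shows "module.induced L (module.kashiwara_e i) (crystal_elt I) \<in> crystal_elt ` P \<union> {module.q_coset L 0}"
    and "module.induced L (module.kashiwara_f i) (crystal_elt I) \<in> crystal_elt ` P \<union> {module.q_coset L 0}"
proof -
  have *: "module.q_coset L (part_op R (basis_vec I)) \<in> crystal_elt ` P \<union> {module.q_coset L 0}"
    if R: "bi_unique R" "\<And>I J. R I J \<Longrightarrow> J \<in> P" for R
  proof (cases "\<exists>K. R I K")
    case True
    then obtain K where "R I K" by blast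
    then show ?thesis using part_op_basis_vec[OF R(1)] R(2) by (auto simp: crystal_elt_def)
  qed (simp add: part_op_basis_vec_0)
  show "module.induced L (module.kashiwara_e i) (crystal_elt I) \<in> crystal_elt ` P \<union> {module.q_coset L 0}"
    unfolding induced_kashiwara[OF i I] by (rule *[OF bi_unique_step[OF i]]) (use step_mem i in blast)
  show "module.induced L (module.kashiwara_f i) (crystal_elt I) \<in> crystal_elt ` P \<union> {module.q_coset L 0}"
    unfolding induced_kashiwara[OF i I] by (rule *[OF bi_unique_step'[OF i]]) (use step_mem i in auto)
qed

lemma crystal_basis: "module.crystal_basis L (crystal_elt ` P)"
  unfolding module.crystal_basis_def
proof (intro conjI allI impI)
  show "module.A0_submodule L" by (rule A0_submodule_L)
  show "\<exists>S. module.A0_basis S L" using A0_basis_L by blast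
  show "module.extension_of_scalars L"
    by (rule module.extension_of_scalarsI[OF A0_submodule_L]) (simp add: span_L)
  show "internal_direct_sum (weight_lattice l) (\<lambda>\<nu>. L \<inter> module.weight_space \<nu>) L"
    by (rule internal_direct_sum_by_labels[where g = weight])
       (use weight_in_lattice basis_lattice_closed weight_space L_subset_M in auto)
  show "module.rat_basis_of_quotient L (crystal_elt ` P)" by (rule rat_basis)
  fix i assume i: "i \<le> l"
  show "module.kashiwara_e i ` L \<subseteq> L" "module.kashiwara_f i ` L \<subseteq> L"
    using kashiwara[OF i] L_subset_M X_in_L[OF i] Y_in_L[OF i] by auto
  show "module.induced L (module.kashiwara_e i) ` crystal_elt ` P \<subseteq> crystal_elt ` P \<union> {module.q_coset L 0}"
    "module.induced L (module.kashiwara_f i) ` crystal_elt ` P \<subseteq> crystal_elt ` P \<union> {module.q_coset L 0}"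
    using induced_kashiwara_range[OF i] by blast+
  show "\<forall>b\<in>crystal_elt ` P. \<forall>b'\<in>crystal_elt ` P.
      (b' = module.induced L (module.kashiwara_f i) b) = (b = module.induced L (module.kashiwara_e i) b')"
    by (simp add: induced_kashiwara_eq_iff[OF i])
qed

end

section \<open>Proper ideals of a full heap\<close>

locale cartan_heap =
  fixes l :: nat and A :: "nat \<Rightarrow> nat \<Rightarrow> int" and \<epsilon> :: "'e::order \<Rightarrow> nat"
  assumes cartan: "gen_cartan_matrix l A" and full: "full_heap l A \<epsilon>"
begin

abbreviation P where "P \<equiv> proper_ideals l \<epsilon>"

definition linked :: "'e \<Rightarrow> 'e \<Rightarrow> bool" where
  "linked \<alpha> \<beta> \<longleftrightarrow> \<epsilon> \<alpha> = \<epsilon> \<beta> \<or> A (\<epsilon> \<alpha>) (\<epsilon> \<beta>) \<noteq> 0"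

lemma heap: "labelled_heap l A \<epsilon>"
  using full by (simp add: full_heap_def)

lemma label_le [simp]: "\<epsilon> \<alpha> \<le> l"
  using heap by (simp add: labelled_heap_def)

lemma finite_interval: "finite {\<alpha>..\<beta>}" "finite {\<alpha><..<\<beta>}" for \<alpha> \<beta> :: 'e
proof -
  show *: "finite {\<alpha>..\<beta>}" using heap by (simp add: labelled_heap_def)
  show "finite {\<alpha><..<\<beta>}" by (rule finite_subset[OF _ *]) auto
qed

lemma linked_sym: "linked \<alpha> \<beta> \<longleftrightarrow> linked \<beta> \<alpha>"
  using cartan by (auto simp: linked_def gen_cartan_matrix_def)

lemma linked_iff: "linked \<alpha> \<beta> \<longleftrightarrow> \<epsilon> \<alpha> = \<epsilon> \<beta> \<or> adjacent A (\<epsilon> \<alpha>) (\<epsilon> \<beta>)"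
  by (auto simp: linked_def adjacent_def)

lemma comparable: "linked \<alpha> \<beta> \<Longrightarrow> \<alpha> \<le> \<beta> \<or> \<beta> \<le> \<alpha>"
  using heap unfolding linked_iff labelled_heap_def by blast

lemma le_conv_linked: "\<alpha> \<le> \<beta> \<longleftrightarrow> (\<lambda>\<alpha> \<beta>. \<alpha> \<le> \<beta> \<and> linked \<alpha> \<beta>)\<^sup>+\<^sup>+ \<alpha> \<beta>"
  using heap unfolding linked_iff labelled_heap_def by metis

text \<open>
  As the order is generated by comparisons of elements with equal or adjacent labels, whatever lies
  strictly below \<open>\<alpha>\<close> lies below a linked element that is strictly below \<open>\<alpha>\<close>. Hence whether an element can be
  added to an ideal, or removed from it, depends only on the elements linked to it.
\<close>

lemma last_link:
  assumes "\<beta> < \<alpha>"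
  obtains \<gamma> where "\<beta> \<le> \<gamma>" "\<gamma> < \<alpha>" "linked \<gamma> \<alpha>"
proof -
  have "\<beta> \<noteq> \<alpha> \<longrightarrow> (\<exists>\<gamma>. \<beta> \<le> \<gamma> \<and> \<gamma> < \<alpha> \<and> linked \<gamma> \<alpha>)"
    if "(\<lambda>\<alpha> \<beta>. \<alpha> \<le> \<beta> \<and> linked \<alpha> \<beta>)\<^sup>+\<^sup>+ \<beta> \<alpha>"
    using that
  proof (induction rule: tranclp_induct)
    case (step y z)
    have "\<beta> \<le> y" using step.hyps(1) le_conv_linked by blast
    then show ?case using step.hyps(2) step.IH by (cases "y = z") (simp, meson order.strict_iff_order)
  next
    case (base y)
    then show ?case by (meson order.refl order.strict_iff_order)
  qed
  moreover have "\<beta> \<le> \<alpha>" "\<beta> \<noteq> \<alpha>" using assms by auto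
  ultimately show thesis using le_conv_linked[of \<beta> \<alpha>] that by blast
qed

lemma first_link:
  assumes "\<beta> < \<alpha>"
  obtains \<gamma> where "\<beta> < \<gamma>" "\<gamma> \<le> \<alpha>" "linked \<beta> \<gamma>"
proof -
  have "\<beta> \<noteq> \<alpha> \<longrightarrow> (\<exists>\<gamma>. \<beta> < \<gamma> \<and> \<gamma> \<le> \<alpha> \<and> linked \<beta> \<gamma>)"
    if "(\<lambda>\<alpha> \<beta>. \<alpha> \<le> \<beta> \<and> linked \<alpha> \<beta>)\<^sup>+\<^sup>+ \<beta> \<alpha>"
    using that
  proof (induction rule: converse_tranclp_induct)
    case (step y z)
    have "z \<le> \<alpha>" using step.hyps(2) le_conv_linked by blast
    then show ?case using step.hyps(1) step.IH by (cases "y = z") (simp, meson order.strict_iff_order)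
  next
    case (base y)
    then show ?case by (meson order.refl order.strict_iff_order)
  qed
  moreover have "\<beta> \<le> \<alpha>" "\<beta> \<noteq> \<alpha>" using assms by auto
  ultimately show thesis using le_conv_linked[of \<beta> \<alpha>] that by blast
qed

lemma unbounded:
  assumes "p \<le> l"
  obtains \<beta> \<gamma> where "\<epsilon> \<beta> = p" "\<not> \<beta> \<le> \<alpha>" "\<epsilon> \<gamma> = p" "\<not> \<alpha> \<le> \<gamma>"
  using full assms unfolding full_heap_def fibred_def bdd_above_def bdd_below_def by blast

lemma proper_idealD:
  assumes "I \<in> P"
  shows "\<beta> \<in> I \<Longrightarrow> \<alpha> \<le> \<beta> \<Longrightarrow> \<alpha> \<in> I" "order_ideal I"
    and "p \<le> l \<Longrightarrow> \<exists>\<alpha>\<in>I. \<epsilon> \<alpha> = p" "p \<le> l \<Longrightarrow> \<exists>\<alpha>. \<alpha> \<notin> I \<and> \<epsilon> \<alpha> = p"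
  using assms unfolding proper_ideals_def order_ideal_def by blast+

lemma proper_idealI:
  assumes "order_ideal I" "\<And>p. p \<le> l \<Longrightarrow> (\<exists>\<alpha>\<in>I. \<epsilon> \<alpha> = p) \<and> (\<exists>\<alpha>. \<alpha> \<notin> I \<and> \<epsilon> \<alpha> = p)"
  shows "I \<in> P"
  using assms unfolding proper_ideals_def by blast

lemma proper_ideal_insert:
  assumes I: "I \<in> P" and J: "order_ideal (insert \<alpha> I)" and \<alpha>: "\<alpha> \<notin> I"
  shows "insert \<alpha> I \<in> P"
proof (rule proper_idealI[OF J], rule conjI)
  fix p assume p: "p \<le> l"
  show "\<exists>\<beta>\<in>insert \<alpha> I. \<epsilon> \<beta> = p" using proper_idealD(3)[OF I p] by blast
  show "\<exists>\<beta>. \<beta> \<notin> insert \<alpha> I \<and> \<epsilon> \<beta> = p"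
  proof (cases "p = \<epsilon> \<alpha>")
    case True
    obtain \<beta> where \<beta>: "\<epsilon> \<beta> = p" "\<not> \<beta> \<le> \<alpha>" using unbounded[OF p] by blast
    then have "\<alpha> \<le> \<beta>" using comparable[of \<alpha> \<beta>] True by (auto simp: linked_def)
    then have "\<beta> \<notin> I" using proper_idealD(1)[OF I] \<alpha> by blast
    moreover have "\<beta> \<noteq> \<alpha>" using \<beta>(2) by auto
    ultimately show ?thesis using \<beta>(1) by blast
  next
    case False
    then show ?thesis using proper_idealD(4)[OF I p] by (metis insert_iff)
  qed
qed

lemma proper_ideal_remove:
  assumes I: "I \<in> P" and J: "order_ideal (I - {\<alpha>})" and \<alpha>: "\<alpha> \<in> I"
  shows "I - {\<alpha>} \<in> P"
proof (rule proper_idealI[OF J], rule conjI)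
  fix p assume p: "p \<le> l"
  show "\<exists>\<beta>. \<beta> \<notin> I - {\<alpha>} \<and> \<epsilon> \<beta> = p" using proper_idealD(4)[OF I p] by blast
  show "\<exists>\<beta>\<in>I - {\<alpha>}. \<epsilon> \<beta> = p"
  proof (cases "p = \<epsilon> \<alpha>")
    case True
    obtain \<beta> where \<beta>: "\<epsilon> \<beta> = p" "\<not> \<alpha> \<le> \<beta>" using unbounded[OF p] by blast
    then have "\<beta> \<le> \<alpha>" using comparable[of \<alpha> \<beta>] True by (auto simp: linked_def)
    then have "\<beta> \<in> I" using proper_idealD(1)[OF I] \<alpha> by blast
    moreover have "\<beta> \<noteq> \<alpha>" using \<beta>(2) by auto
    ultimately show ?thesis using \<beta>(1) by blast
  next
    case False
    then show ?thesis using proper_idealD(3)[OF I p] by (metis Diff_iff singletonD)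
  qed
qed

text \<open>
  The elements labelled \<open>p\<close> form a chain, which leaves \<open>I\<close> exactly once: between \<open>a\<close> and \<open>b\<close>.
\<close>

definition gap :: "nat \<Rightarrow> 'e set \<Rightarrow> 'e \<Rightarrow> 'e \<Rightarrow> bool" where
  "gap p I a b \<longleftrightarrow> \<epsilon> a = p \<and> \<epsilon> b = p \<and> a \<in> I \<and> b \<notin> I \<and> a < b \<and>
     (\<forall>\<gamma>. \<epsilon> \<gamma> = p \<longrightarrow> (\<gamma> \<in> I \<longleftrightarrow> \<gamma> \<le> a) \<and> (\<gamma> \<notin> I \<longleftrightarrow> b \<le> \<gamma>))"

lemma gap_exists:
  assumes I: "I \<in> P" and p: "p \<le> l"
  obtains a b where "gap p I a b"
proof -
  have chain: "\<alpha> \<le> \<beta> \<or> \<beta> \<le> \<alpha>" if "\<epsilon> \<alpha> = p" "\<epsilon> \<beta> = p" for \<alpha> \<beta>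
    using comparable[of \<alpha> \<beta>] that by (simp add: linked_def)
  obtain x y where x: "x \<in> I" "\<epsilon> x = p" and y: "y \<notin> I" "\<epsilon> y = p"
    using proper_idealD(3,4)[OF I p] by blast
  have down: "\<alpha> \<in> I" if "\<beta> \<in> I" "\<alpha> \<le> \<beta>" for \<alpha> \<beta> using proper_idealD(1)[OF I that] .
  have xy: "x \<le> y" using chain[OF x(2) y(2)] down x y by blast
  define S where "S = {\<gamma> \<in> {x..y}. \<epsilon> \<gamma> = p \<and> \<gamma> \<in> I}"
  define T where "T = {\<gamma> \<in> {x..y}. \<epsilon> \<gamma> = p \<and> \<gamma> \<notin> I}"
  have fin: "finite S" "finite T"
    by (rule finite_subset[OF _ finite_interval(1)[of x y]], auto simp: S_def T_def)+
  have ne: "x \<in> S" "y \<in> T" using x y xy by (auto simp: S_def T_def)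
  obtain a where a: "a \<in> S" "\<And>\<gamma>. \<gamma> \<in> S \<Longrightarrow> a \<le> \<gamma> \<Longrightarrow> a = \<gamma>"
    using finite_has_maximal[of S] fin ne by blast
  obtain b where b: "b \<in> T" "\<And>\<gamma>. \<gamma> \<in> T \<Longrightarrow> \<gamma> \<le> b \<Longrightarrow> b = \<gamma>"
    using finite_has_minimal[of T] fin ne by blast
  have a': "\<epsilon> a = p" "a \<in> I" "x \<le> a" and b': "\<epsilon> b = p" "b \<notin> I" "b \<le> y"
    using a b by (auto simp: S_def T_def)
  have max: "\<gamma> \<le> a" if "\<epsilon> \<gamma> = p" "\<gamma> \<in> I" for \<gamma>
  proof (rule ccontr)
    assume "\<not> \<gamma> \<le> a"
    then have "a \<le> \<gamma>" using chain[of \<gamma> a] that a' by blast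
    moreover have "\<gamma> \<le> y" using chain[of \<gamma> y] that y down by blast
    ultimately have "\<gamma> \<in> S" using that a' by (auto simp: S_def)
    then show False using a(2) \<open>a \<le> \<gamma>\<close> \<open>\<not> \<gamma> \<le> a\<close> by blast
  qed
  have min: "b \<le> \<gamma>" if "\<epsilon> \<gamma> = p" "\<gamma> \<notin> I" for \<gamma>
  proof (rule ccontr)
    assume "\<not> b \<le> \<gamma>"
    then have "\<gamma> \<le> b" using chain[of \<gamma> b] that b' by blast
    moreover have "x \<le> \<gamma>" using chain[of \<gamma> x] that x down by blast
    ultimately have "\<gamma> \<in> T" using that b' by (auto simp: T_def)
    then show False using b(2) \<open>\<gamma> \<le> b\<close> \<open>\<not> b \<le> \<gamma>\<close> by blast
  qed
  have "a < b" using chain[of a b] a' b' down by (auto simp: less_le)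
  then have "gap p I a b"
    unfolding gap_def using a' b' max min down by blast
  then show thesis by (rule that)
qed

lemma gapD:
  assumes "gap p I a b"
  shows "\<epsilon> a = p" "\<epsilon> b = p" "a \<in> I" "b \<notin> I" "a < b" "p \<le> l"
    and "\<epsilon> \<gamma> = p \<Longrightarrow> \<gamma> \<in> I \<Longrightarrow> \<gamma> \<le> a" "\<epsilon> \<gamma> = p \<Longrightarrow> \<gamma> \<notin> I \<Longrightarrow> b \<le> \<gamma>"
  using assms label_le[of a] unfolding gap_def by blast+

text \<open>The elements that count in the fullness condition; by \<open>gap_no_label\<close> none of them is labelled \<open>p\<close>.\<close>

definition neighbours :: "nat \<Rightarrow> 'e \<Rightarrow> 'e \<Rightarrow> 'e set" where
  "neighbours p a b = {\<gamma> \<in> {a<..<b}. A p (\<epsilon> \<gamma>) \<noteq> 0}"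

lemma gap_no_label:
  assumes "gap p I a b" "a < \<gamma>" "\<gamma> < b"
  shows "\<epsilon> \<gamma> \<noteq> p"
  using gapD(7,8)[OF assms(1), of \<gamma>] assms(2,3) by fastforce

lemma sum_neighbours:
  assumes "gap p I a b"
  shows "(\<Sum>\<gamma>\<in>neighbours p a b. A p (\<epsilon> \<gamma>)) = - 2"
proof -
  have "\<forall>\<gamma>\<in>{a<..<b}. \<epsilon> \<gamma> \<noteq> p" using gap_no_label[OF assms] by auto
  then have "(\<Sum>\<gamma>\<in>{a<..<b}. A p (\<epsilon> \<gamma>)) = - 2"
    using full gapD[OF assms] unfolding full_heap_def by blast
  moreover have "(\<Sum>\<gamma>\<in>neighbours p a b. A p (\<epsilon> \<gamma>)) = (\<Sum>\<gamma>\<in>{a<..<b}. A p (\<epsilon> \<gamma>))"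
    by (rule sum.mono_neutral_left) (auto simp: neighbours_def finite_interval)
  ultimately show ?thesis by simp
qed

lemma neighbour_entry:
  assumes "gap p I a b" "\<gamma> \<in> neighbours p a b"
  shows "A p (\<epsilon> \<gamma>) \<le> - 1"
proof -
  have "\<epsilon> \<gamma> \<noteq> p" "A p (\<epsilon> \<gamma>) \<noteq> 0"
    using assms gap_no_label[OF assms(1), of \<gamma>] by (auto simp: neighbours_def)
  moreover have "A p (\<epsilon> \<gamma>) \<le> 0"
    using cartan gapD(6)[OF assms(1)] \<open>\<epsilon> \<gamma> \<noteq> p\<close> label_le[of \<gamma>] unfolding gen_cartan_matrix_def by auto
  ultimately show ?thesis by simp
qed

lemma finite_neighbours: "finite (neighbours p a b)"
  by (rule finite_subset[OF _ finite_interval(2)[of a b]]) (auto simp: neighbours_def)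

lemma neighbours_nonempty: "gap p I a b \<Longrightarrow> neighbours p a b \<noteq> {}"
  using sum_neighbours[of p I a b] by auto

definition heap_step :: "nat \<Rightarrow> 'e set \<Rightarrow> 'e set \<Rightarrow> bool" where
  "heap_step p I J \<longleftrightarrow> I \<in> P \<and> J \<in> P \<and> (\<exists>\<alpha>. \<epsilon> \<alpha> = p \<and> \<alpha> \<notin> I \<and> J = insert \<alpha> I)"

lemma heap_step_mem: "heap_step p I J \<Longrightarrow> I \<in> P \<and> J \<in> P"
  by (simp add: heap_step_def)

lemma heap_stepI:
  "I \<in> P \<Longrightarrow> order_ideal (insert \<alpha> I) \<Longrightarrow> \<alpha> \<notin> I \<Longrightarrow> \<epsilon> \<alpha> = p \<Longrightarrow> heap_step p I (insert \<alpha> I)"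
  unfolding heap_step_def using proper_ideal_insert by blast

lemma heap_step_gap_source:
  assumes "heap_step p I J" "gap p I a b"
  shows "J = insert b I"
proof -
  obtain \<alpha> where \<alpha>: "\<epsilon> \<alpha> = p" "\<alpha> \<notin> I" "J = insert \<alpha> I" and J: "J \<in> P"
    using assms(1) by (auto simp: heap_step_def)
  have "b \<le> \<alpha>" using gapD(8)[OF assms(2) \<alpha>(1,2)] .
  then have "b \<in> J" using proper_idealD(1)[OF J] \<alpha>(3) by blast
  then show ?thesis using \<alpha>(3) gapD(4)[OF assms(2)] by blast
qed

lemma heap_step_gap_target:
  assumes "heap_step p K I" "gap p I a b"
  shows "K = I - {a}" "I = insert a K" "a \<notin> K"
proof -
  obtain \<alpha> where \<alpha>: "\<epsilon> \<alpha> = p" "\<alpha> \<notin> K" "I = insert \<alpha> K" and K: "K \<in> P"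
    using assms(1) by (auto simp: heap_step_def)
  have "\<alpha> \<le> a" using gapD(7)[OF assms(2) \<alpha>(1)] \<alpha>(3) by blast
  then have "a \<notin> K" using proper_idealD(1)[OF K] \<alpha>(2) by blast
  then have "\<alpha> = a" using gapD(3)[OF assms(2)] \<alpha>(3) by blast
  then show "K = I - {a}" "I = insert a K" "a \<notin> K" using \<alpha> by auto
qed

lemma bi_unique_heap_step:
  assumes "p \<le> l"
  shows "bi_unique (heap_step p)"
  unfolding bi_unique_def
proof (intro conjI allI impI)
  fix I J K
  show "J = K" if "heap_step p I J" "heap_step p I K"
    using that gap_exists[OF _ assms, of I] heap_step_gap_source heap_step_mem by metis
  show "I = J" if "heap_step p I K" "heap_step p J K"
    using that gap_exists[OF _ assms, of K] heap_step_gap_target(1) heap_step_mem by metis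
qed

text \<open>
  An element below \<open>b\<close> lies below some \<open>\<gamma> < b\<close> linked to \<open>b\<close>. Such a \<open>\<gamma>\<close> is comparable to \<open>a\<close>: it is either below
  \<open>a\<close>, and then in \<open>I\<close>, or a neighbour in the gap. So the neighbours alone decide whether \<open>b\<close> can be added.
\<close>

lemma heap_step_up_iff:
  assumes I: "I \<in> P" and g: "gap p I a b"
  shows "(\<exists>J. heap_step p I J) \<longleftrightarrow> neighbours p a b \<subseteq> I"
proof
  assume "\<exists>J. heap_step p I J"
  then obtain J where J: "heap_step p I J" by blast
  then have "J = insert b I" "J \<in> P" using heap_step_gap_source[OF J g] heap_step_mem by auto
  then have "\<gamma> \<in> I" if "\<gamma> < b" for \<gamma>
    using proper_idealD(1)[of J b \<gamma>] that by (auto simp: less_le)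
  then show "neighbours p a b \<subseteq> I" by (auto simp: neighbours_def)
next
  assume N: "neighbours p a b \<subseteq> I"
  have below: "\<beta> \<in> I" if "\<beta> < b" for \<beta>
  proof -
    obtain \<gamma> where \<gamma>: "\<beta> \<le> \<gamma>" "\<gamma> < b" "linked \<gamma> b" using last_link[OF \<open>\<beta> < b\<close>] by blast
    have "\<gamma> \<in> I"
    proof (rule ccontr)
      assume "\<gamma> \<notin> I"
      then have "\<epsilon> \<gamma> \<noteq> p" using gapD(8)[OF g, of \<gamma>] \<gamma>(2) by auto
      moreover have "linked a \<gamma>" using \<gamma>(3) linked_sym gapD(1,2)[OF g] by (auto simp: linked_def)
      then have "a < \<gamma>"
        using comparable[of a \<gamma>] proper_idealD(1)[OF I gapD(3)[OF g], of \<gamma>] \<open>\<gamma> \<notin> I\<close> gapD(3)[OF g]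
        by (auto simp: less_le)
      ultimately have "\<gamma> \<in> neighbours p a b"
        using \<open>linked a \<gamma>\<close> \<gamma>(2) gapD(1)[OF g] by (auto simp: neighbours_def linked_def)
      then show False using N \<open>\<gamma> \<notin> I\<close> by blast
    qed
    then show ?thesis using proper_idealD(1)[OF I] \<gamma>(1) by blast
  qed
  have "order_ideal (insert b I)"
    unfolding order_ideal_def using below proper_idealD(1)[OF I] by (auto simp: le_less)
  then show "\<exists>J. heap_step p I J" using heap_stepI[OF I] gapD[OF g] by blast
qed

text \<open>The dual statement, argued upwards from \<open>a\<close>.\<close>

lemma heap_step_down_iff:
  assumes I: "I \<in> P" and g: "gap p I a b"
  shows "(\<exists>K. heap_step p K I) \<longleftrightarrow> neighbours p a b \<inter> I = {}"
proof
  assume "\<exists>K. heap_step p K I"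
  then obtain K where K: "heap_step p K I" by blast
  have *: "I = insert a K" "a \<notin> K" "K \<in> P"
    using heap_step_gap_target(2,3)[OF K g] heap_step_mem[OF K] by blast+
  have "\<gamma> \<notin> I" if "a < \<gamma>" for \<gamma>
    using proper_idealD(1)[OF *(3), of \<gamma> a] that *(1,2) by (auto simp: less_le)
  then show "neighbours p a b \<inter> I = {}" by (auto simp: neighbours_def)
next
  assume N: "neighbours p a b \<inter> I = {}"
  have above: "\<beta> \<notin> I" if "a < \<beta>" for \<beta>
  proof
    assume "\<beta> \<in> I"
    obtain \<gamma> where \<gamma>: "a < \<gamma>" "\<gamma> \<le> \<beta>" "linked a \<gamma>" using first_link[OF \<open>a < \<beta>\<close>] by blast
    have "\<gamma> \<in> I" using proper_idealD(1)[OF I \<open>\<beta> \<in> I\<close> \<gamma>(2)] .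
    then have "\<epsilon> \<gamma> \<noteq> p" using gapD(7)[OF g, of \<gamma>] \<gamma>(1) by auto
    have "linked b \<gamma>" using \<gamma>(3) gapD(1,2)[OF g] by (auto simp: linked_def)
    then have "\<gamma> < b"
      using comparable[of b \<gamma>] proper_idealD(1)[OF I \<open>\<gamma> \<in> I\<close>, of b] gapD(4)[OF g] \<open>\<gamma> \<in> I\<close>
      by (auto simp: less_le)
    then have "\<gamma> \<in> neighbours p a b"
      using \<gamma> \<open>\<epsilon> \<gamma> \<noteq> p\<close> gapD(1)[OF g] by (auto simp: neighbours_def linked_def)
    then show False using N \<open>\<gamma> \<in> I\<close> by blast
  qed
  have "order_ideal (I - {a})"
    unfolding order_ideal_def
  proof (intro ballI allI impI)
    fix \<beta> \<alpha> assume "\<beta> \<in> I - {a}" "\<alpha> \<le> \<beta>"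
    then show "\<alpha> \<in> I - {a}"
      using above[of \<beta>] proper_idealD(1)[OF I, of \<beta> \<alpha>] by (auto simp: less_le)
  qed
  then have "I - {a} \<in> P" using proper_ideal_remove[OF I] gapD(3)[OF g] by blast
  then have "heap_step p (I - {a}) I"
    unfolding heap_step_def using I gapD(1,3)[OF g] by (auto intro!: exI[of _ a])
  then show "\<exists>K. heap_step p K I" by blast
qed

lemma heap_step_gap:
  assumes J: "heap_step p I J" and p: "p \<le> l"
  obtains a b b' where "gap p I a b" "J = insert b I" "gap p J b b'"
proof -
  have IJ: "I \<in> P" "J \<in> P" using heap_step_mem[OF J] by auto
  obtain a b where g: "gap p I a b" using gap_exists[OF IJ(1) p] .
  obtain a' b' where g': "gap p J a' b'" using gap_exists[OF IJ(2) p] .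
  have "J = insert b I" by (rule heap_step_gap_source[OF J g])
  moreover have "a' = b"
    using heap_step_gap_target(2,3)[OF J g'] calculation gapD(4)[OF g] by blast
  ultimately show thesis using that g g' by blast
qed

text \<open>
  After \<open>b\<close> has been added it is the lower end of the next gap, and its removability means that no neighbour
  in that gap is present. As there is at least one neighbour, the upper end cannot be added.
\<close>

lemma no_double_heap_step:
  assumes p: "p \<le> l" and J: "heap_step p I J"
  shows "\<not> heap_step p J K"
proof
  assume K: "heap_step p J K"
  obtain a b b' where g: "gap p I a b" "J = insert b I" "gap p J b b'"
    using heap_step_gap[OF J p] .
  have "J \<in> P" using heap_step_mem[OF J] by simp
  then have "neighbours p b b' \<subseteq> J" "neighbours p b b' \<inter> J = {}"
    using heap_step_up_iff[OF _ g(3)] heap_step_down_iff[OF _ g(3)] J K by blast+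
  then show False using neighbours_nonempty[OF g(3)] by blast
qed

text \<open>
  The neighbours contribute \<open>-2\<close> in total and each at most \<open>-1\<close>. So if some but not all of them are in \<open>I\<close>,
  those in \<open>I\<close> contribute exactly \<open>-1\<close>.
\<close>

lemma step_weight_heap_step:
  assumes I: "I \<in> P" and g: "gap p I a b"
  shows "step_weight (heap_step p) I = 1 + (\<Sum>\<gamma>\<in>neighbours p a b \<inter> I. A p (\<epsilon> \<gamma>))"
proof -
  let ?N = "neighbours p a b" and ?f = "\<lambda>\<gamma>. A p (\<epsilon> \<gamma>)"
  have N: "sum ?f ?N = - 2" "finite ?N" "?N \<noteq> {}"
    using sum_neighbours[OF g] finite_neighbours neighbours_nonempty[OF g] by auto
  have split: "sum ?f (?N \<inter> I) + sum ?f (?N - I) = - 2"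
    using sum.Int_Diff[OF N(2), of ?f I] N(1) by simp
  have neg: "sum ?f S \<le> - 1" if S: "S \<subseteq> ?N" "S \<noteq> {}" for S
  proof -
    obtain \<gamma> where \<gamma>: "\<gamma> \<in> S" using S(2) by blast
    have fin: "finite S" using S(1) N(2) finite_subset by blast
    have "sum ?f (S - {\<gamma>}) \<le> 0"
      using neighbour_entry[OF g] S(1) by (intro sum_nonpos) fastforce
    then show ?thesis
      using sum.remove[OF fin \<gamma>, of ?f] neighbour_entry[OF g, of \<gamma>] S(1) \<gamma> by auto
  qed
  consider "?N \<subseteq> I" | "?N \<inter> I = {}" | "?N \<inter> I \<noteq> {}" "?N - I \<noteq> {}" by blast
  then show ?thesis
  proof cases
    case 1
    then have "?N \<inter> I = ?N" "?N \<inter> I \<noteq> {}" using N(3) by auto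
    then show ?thesis
      using 1 N(1) heap_step_up_iff[OF I g] heap_step_down_iff[OF I g] by (simp add: step_weight_def)
  next
    case 2
    then have "\<not> ?N \<subseteq> I" using N(3) by auto
    then show ?thesis
      using 2 heap_step_up_iff[OF I g] heap_step_down_iff[OF I g] by (simp add: step_weight_def)
  next
    case 3
    then have "sum ?f (?N \<inter> I) = - 1"
      using split neg[of "?N \<inter> I"] neg[of "?N - I"] by auto
    moreover have "\<not> ?N \<subseteq> I" using 3(2) by auto
    ultimately show ?thesis
      using 3 heap_step_up_iff[OF I g] heap_step_down_iff[OF I g] by (simp add: step_weight_def)
  qed
qed

lemma gap_other_label:
  assumes "heap_step q I J" "p \<noteq> q"
  shows "gap p J a b \<longleftrightarrow> gap p I a b"
  using assms unfolding heap_step_def gap_def by auto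

text \<open>
  For \<open>p \<noteq> q\<close> the gap of label \<open>p\<close> stays the same. If \<open>A p q \<noteq> 0\<close>, the added element is comparable to both ends
  of the gap, and lies between them because \<open>I\<close> and \<open>J\<close> are ideals; so it is a new neighbour in \<open>J\<close>.
\<close>

lemma step_weight_change:
  assumes p: "p \<le> l" and q: "q \<le> l" and J: "heap_step q I J"
  shows "step_weight (heap_step p) J = step_weight (heap_step p) I + A p q"
proof (cases "p = q")
  case True
  have "step_weight (heap_step p) I = - 1" "step_weight (heap_step p) J = 1"
    using no_double_heap_step[OF q] J True unfolding step_weight_def by auto
  then show ?thesis using True cartan p by (simp add: gen_cartan_matrix_def)
next
  case False
  have IJ: "I \<in> P" "J \<in> P" using heap_step_mem[OF J] by auto
  obtain a b where g: "gap p I a b" using gap_exists[OF IJ(1) p] .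
  then have g': "gap p J a b" using gap_other_label[OF J False] by simp
  obtain \<alpha> where \<alpha>: "\<epsilon> \<alpha> = q" "\<alpha> \<notin> I" "J = insert \<alpha> I" using J by (auto simp: heap_step_def)
  have in_gap: "\<alpha> \<in> neighbours p a b \<longleftrightarrow> A p q \<noteq> 0"
  proof
    assume "A p q \<noteq> 0"
    then have "linked a \<alpha>" "linked b \<alpha>" using gapD(1,2)[OF g] \<alpha>(1) by (auto simp: linked_def)
    then have "a < \<alpha>" "\<alpha> < b"
      using comparable[of a \<alpha>] comparable[of b \<alpha>] \<alpha> gapD[OF g] gapD(4)[OF g']
        proper_idealD(1)[OF IJ(1), of a \<alpha>] proper_idealD(1)[OF IJ(2), of \<alpha> b]
      by (auto simp: less_le)
    then show "\<alpha> \<in> neighbours p a b" using \<open>A p q \<noteq> 0\<close> \<alpha>(1) by (simp add: neighbours_def)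
  qed (simp add: neighbours_def \<alpha>(1))
  have "(\<Sum>\<gamma>\<in>neighbours p a b \<inter> J. A p (\<epsilon> \<gamma>)) = (\<Sum>\<gamma>\<in>neighbours p a b \<inter> I. A p (\<epsilon> \<gamma>)) + A p q"
  proof (cases "\<alpha> \<in> neighbours p a b")
    case True
    then have "neighbours p a b \<inter> J = insert \<alpha> (neighbours p a b \<inter> I)" using \<alpha>(3) by auto
    then show ?thesis using \<alpha>(1,2) finite_neighbours by simp
  next
    case False
    then have "neighbours p a b \<inter> J = neighbours p a b \<inter> I" using \<alpha>(3) by auto
    then show ?thesis using False in_gap by simp
  qed
  then show ?thesis
    by (simp add: step_weight_heap_step[OF IJ(1) g] step_weight_heap_step[OF IJ(2) g'])
qed

text \<open>
  The fourth corner of the diamond is the union or the intersection of the two given ideals.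
\<close>

lemma heap_step_diamond:
  assumes "p \<noteq> q"
  shows "(heap_step q)\<inverse>\<inverse> OO heap_step p = heap_step p OO (heap_step q)\<inverse>\<inverse>"
proof (intro ext iffI)
  fix I K assume "((heap_step q)\<inverse>\<inverse> OO heap_step p) I K"
  then obtain J where J: "heap_step q J I" "heap_step p J K" by auto
  then obtain \<alpha> \<beta> where *: "\<epsilon> \<beta> = q" "\<beta> \<notin> J" "I = insert \<beta> J" "\<epsilon> \<alpha> = p" "\<alpha> \<notin> J" "K = insert \<alpha> J"
    and P: "I \<in> P" "K \<in> P" by (auto simp: heap_step_def)
  have "order_ideal (insert \<alpha> I)"
    using proper_idealD(1)[OF P(1)] proper_idealD(1)[OF P(2)] * unfolding order_ideal_def by blast
  then have 1: "heap_step p I (insert \<alpha> I)" using heap_stepI P * assms by auto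
  have "insert \<alpha> I = insert \<beta> K" using * by auto
  then have 2: "heap_step q K (insert \<alpha> I)"
    using heap_step_mem[OF 1] P(2) * assms unfolding heap_step_def by auto
  show "(heap_step p OO (heap_step q)\<inverse>\<inverse>) I K" using 1 2 by auto
next
  fix I K assume "(heap_step p OO (heap_step q)\<inverse>\<inverse>) I K"
  then obtain L where L: "heap_step p I L" "heap_step q K L" by auto
  then obtain \<alpha> \<beta> where *: "\<epsilon> \<alpha> = p" "\<alpha> \<notin> I" "L = insert \<alpha> I" "\<epsilon> \<beta> = q" "\<beta> \<notin> K" "L = insert \<beta> K"
    and P: "I \<in> P" "K \<in> P" by (auto simp: heap_step_def)
  have ab: "\<alpha> \<in> K" "\<beta> \<in> I" using * assms by auto
  have eq: "I - {\<beta>} = I \<inter> K" "K - {\<alpha>} = I \<inter> K" using * by auto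
  have "order_ideal (I - {\<beta>})"
    unfolding eq order_ideal_def using proper_idealD(1)[OF P(1)] proper_idealD(1)[OF P(2)] by blast
  then have J: "I - {\<beta>} \<in> P" by (rule proper_ideal_remove[OF P(1) _ ab(2)])
  have "heap_step q (I - {\<beta>}) I" using J P ab * unfolding heap_step_def by auto
  moreover have "heap_step p (I - {\<beta>}) K"
    using J P ab * eq unfolding heap_step_def by (auto intro!: exI[of _ \<alpha>])
  ultimately show "((heap_step q)\<inverse>\<inverse> OO heap_step p) I K" by auto
qed

text \<open>
  If \<open>\<alpha>\<close> and then \<open>\<beta>\<close> are added and their labels are not adjacent, \<open>\<beta>\<close> is not above \<open>\<alpha>\<close>. Otherwise some
  \<open>\<gamma>\<close> linked to \<open>\<beta>\<close> would satisfy \<open>\<alpha> < \<gamma> < \<beta>\<close>; it would have to lie in \<open>I\<close>, and then so would \<open>\<alpha>\<close>.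
\<close>

lemma heap_step_commute:
  assumes p: "p \<le> l" and q: "q \<le> l" and 0: "A p q = 0"
  shows "heap_step p OO heap_step q = heap_step q OO heap_step p"
proof -
  have *: "(heap_step q OO heap_step p) I K"
    if "A p q = 0" "p \<le> l" "q \<le> l" "(heap_step p OO heap_step q) I K" for p q I K
  proof -
    have pq: "p \<noteq> q" "A q p = 0"
      using that cartan unfolding gen_cartan_matrix_def by auto
    obtain J where "heap_step p I J" "heap_step q J K" using \<open>(heap_step p OO heap_step q) I K\<close> by auto
    then obtain \<alpha> \<beta> where *: "\<epsilon> \<alpha> = p" "\<alpha> \<notin> I" "J = insert \<alpha> I" "\<epsilon> \<beta> = q" "\<beta> \<notin> J" "K = insert \<beta> J"
      and P: "I \<in> P" "J \<in> P" "K \<in> P" by (auto simp: heap_step_def)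
    have "\<not> \<alpha> < \<beta>"
    proof
      assume "\<alpha> < \<beta>"
      then obtain \<gamma> where \<gamma>: "\<alpha> \<le> \<gamma>" "\<gamma> < \<beta>" "linked \<gamma> \<beta>" using last_link by blast
      have "\<gamma> \<in> K" using proper_idealD(1)[OF P(3), of \<beta> \<gamma>] \<gamma>(2) * by auto
      moreover have "\<gamma> \<noteq> \<beta>" "\<gamma> \<noteq> \<alpha>"
        using \<gamma> * pq \<open>A p q = 0\<close> by (auto simp: linked_def)
      ultimately have "\<gamma> \<in> I" using * by auto
      then show False using proper_idealD(1)[OF P(1) _ \<gamma>(1)] * by blast
    qed
    then have "order_ideal (insert \<beta> I)"
      using proper_idealD(1)[OF P(1)] proper_idealD(1)[OF P(3)] *
      unfolding order_ideal_def by (auto simp: less_le)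
    then have 1: "heap_step q I (insert \<beta> I)" using heap_stepI[OF P(1)] * by auto
    have "K = insert \<alpha> (insert \<beta> I)" using * by auto
    then have "heap_step p (insert \<beta> I) K"
      using heap_step_mem[OF 1] P(3) * pq unfolding heap_step_def by auto
    then show ?thesis using 1 by auto
  qed
  have "A q p = 0" using 0 p q cartan unfolding gen_cartan_matrix_def by auto
  then show ?thesis using *[OF 0 p q] *[OF _ q p] by (intro ext iffI) auto
qed

text \<open>
  All neighbours in the gap between the two elements labelled \<open>p\<close> are added after the first of them and
  before the second, so the single element labelled \<open>q\<close> would be the only neighbour. But its entry is \<open>-1\<close>
  and not \<open>-2\<close>.
\<close>

lemma no_triple_heap_step:
  assumes p: "p \<le> l" and q: "q \<le> l" and A: "A p q = - 1"
    and J: "heap_step p I J" and K: "heap_step q J K"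
  shows "\<not> heap_step p K L"
proof
  assume L: "heap_step p K L"
  have pq: "p \<noteq> q" using A p cartan unfolding gen_cartan_matrix_def by auto
  have P: "I \<in> P" "K \<in> P" using heap_step_mem[OF J] heap_step_mem[OF K] by auto
  obtain a b b' where g: "gap p I a b" "J = insert b I" "gap p J b b'"
    using heap_step_gap[OF J p] .
  obtain \<beta> where \<beta>: "\<epsilon> \<beta> = q" "K = insert \<beta> J" using K by (auto simp: heap_step_def)
  have gK: "gap p K b b'" using gap_other_label[OF K pq] g(3) by simp
  have "neighbours p b b' \<subseteq> K" using heap_step_up_iff[OF P(2) gK] L by blast
  moreover have "\<gamma> \<notin> J" if "\<gamma> \<in> neighbours p b b'" for \<gamma>
    using that proper_idealD(1)[OF P(1), of \<gamma> b] gapD(4)[OF g(1)] g(2)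
    by (auto simp: neighbours_def less_le)
  ultimately have "neighbours p b b' \<subseteq> {\<beta>}" using \<beta> by blast
  then have "neighbours p b b' = {\<beta>}" using neighbours_nonempty[OF gK] by blast
  then show False using sum_neighbours[OF gK] A \<beta>(1) by simp
qed

lemma X_op_eq:
  assumes p: "p \<le> l" and v: "v \<in> heap_space l \<epsilon>"
  shows "X_op \<epsilon> p v = part_op (heap_step p) v"
  unfolding X_op_def part_op_def
proof (rule lin_ext_cong)
  fix I assume "I \<in> Poly_Mapping.keys v"
  then have I: "I \<in> P" using v by (auto simp: heap_space_def)
  have ad: "addable \<epsilon> p I \<alpha> \<longleftrightarrow> \<alpha> \<notin> I \<and> heap_step p I (insert \<alpha> I)" for \<alpha>
  proof
    assume "addable \<epsilon> p I \<alpha>"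
    then show "\<alpha> \<notin> I \<and> heap_step p I (insert \<alpha> I)"
      using heap_stepI[OF I] by (auto simp: addable_def)
  next
    assume \<alpha>: "\<alpha> \<notin> I \<and> heap_step p I (insert \<alpha> I)"
    then have "\<epsilon> \<alpha> = p" unfolding heap_step_def by (metis insert_iff)
    then show "addable \<epsilon> p I \<alpha>"
      using \<alpha> heap_step_mem[of p I "insert \<alpha> I"] proper_idealD(2) by (auto simp: addable_def)
  qed
  show "(if \<exists>\<alpha>. addable \<epsilon> p I \<alpha> then basis_vec (I \<union> {THE \<alpha>. addable \<epsilon> p I \<alpha>}) else 0) =
    (if \<exists>J. heap_step p I J then basis_vec (THE J. heap_step p I J) else 0)"
  proof (cases "\<exists>J. heap_step p I J")
    case True
    then obtain J where J: "heap_step p I J" by blast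
    then obtain \<alpha> where \<alpha>: "\<alpha> \<notin> I" "J = insert \<alpha> I" by (auto simp: heap_step_def)
    have uniq: "\<alpha>' = \<alpha>" if "addable \<epsilon> p I \<alpha>'" for \<alpha>'
      using that ad bi_uniqueDr[OF bi_unique_heap_step[OF p], of I "insert \<alpha>' I" J] J \<alpha> by blast
    have \<alpha>_addable: "addable \<epsilon> p I \<alpha>" using ad J \<alpha> by blast
    have "(THE \<alpha>. addable \<epsilon> p I \<alpha>) = \<alpha>" by (rule the_equality) (fact \<alpha>_addable, fact uniq)
    moreover have "(THE J. heap_step p I J) = J" by (rule bi_unique_the[OF bi_unique_heap_step[OF p] J])
    moreover have "\<exists>\<alpha>. addable \<epsilon> p I \<alpha>" using \<alpha>_addable by blast
    ultimately show ?thesis using True \<alpha>(2) by simp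
  next
    case False
    then have "\<nexists>\<alpha>. addable \<epsilon> p I \<alpha>" using ad by blast
    then show ?thesis using False by simp
  qed
qed

lemma Y_op_eq:
  assumes p: "p \<le> l" and v: "v \<in> heap_space l \<epsilon>"
  shows "Y_op \<epsilon> p v = part_op (heap_step p)\<inverse>\<inverse> v"
  unfolding Y_op_def part_op_def
proof (rule lin_ext_cong)
  fix I assume "I \<in> Poly_Mapping.keys v"
  then have I: "I \<in> P" using v by (auto simp: heap_space_def)
  have re: "removable \<epsilon> p I \<alpha> \<longleftrightarrow> \<alpha> \<in> I \<and> heap_step p (I - {\<alpha>}) I" for \<alpha>
  proof
    assume "removable \<epsilon> p I \<alpha>"
    then show "\<alpha> \<in> I \<and> heap_step p (I - {\<alpha>}) I"
      using proper_ideal_remove[OF I] I by (auto simp: removable_def heap_step_def)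
  next
    assume \<alpha>: "\<alpha> \<in> I \<and> heap_step p (I - {\<alpha>}) I"
    then have "\<epsilon> \<alpha> = p" unfolding heap_step_def by blast
    then show "removable \<epsilon> p I \<alpha>"
      using \<alpha> heap_step_mem[of p "I - {\<alpha>}" I] proper_idealD(2) by (auto simp: removable_def)
  qed
  have bi: "bi_unique (heap_step p)\<inverse>\<inverse>" using bi_unique_heap_step[OF p] by (simp add: bi_unique_def)
  show "(if \<exists>\<alpha>. removable \<epsilon> p I \<alpha> then basis_vec (I - {THE \<alpha>. removable \<epsilon> p I \<alpha>}) else 0) =
    (if \<exists>J. (heap_step p)\<inverse>\<inverse> I J then basis_vec (THE J. (heap_step p)\<inverse>\<inverse> I J) else 0)"
  proof (cases "\<exists>J. heap_step p J I")
    case True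
    then obtain J where J: "heap_step p J I" by blast
    then obtain \<alpha> where \<alpha>: "\<alpha> \<in> I" "J = I - {\<alpha>}" by (auto simp: heap_step_def)
    have uniq: "\<alpha>' = \<alpha>" if "removable \<epsilon> p I \<alpha>'" for \<alpha>'
      using that re bi_uniqueDl[OF bi_unique_heap_step[OF p], of "I - {\<alpha>'}" I J] J \<alpha> by blast
    have \<alpha>_removable: "removable \<epsilon> p I \<alpha>" using re J \<alpha> by blast
    have "(THE \<alpha>. removable \<epsilon> p I \<alpha>) = \<alpha>" by (rule the_equality) (fact \<alpha>_removable, fact uniq)
    moreover have "The ((heap_step p)\<inverse>\<inverse> I) = J"
      by (rule bi_unique_the[OF bi]) (simp add: J)
    moreover have "\<exists>\<alpha>. removable \<epsilon> p I \<alpha>" using \<alpha>_removable by blast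
    ultimately show ?thesis using True \<alpha>(2) by simp
  next
    case False
    then have "\<nexists>\<alpha>. removable \<epsilon> p I \<alpha>" using re by blast
    then show ?thesis using False by simp
  qed
qed

lemma basis_vec_in_heap_space: "I \<in> P \<Longrightarrow> basis_vec I \<in> heap_space l \<epsilon>"
  by (simp add: heap_space_def)

lemma H_op_basis_vec:
  assumes p: "p \<le> l" and I: "I \<in> P"
  shows "H_op \<epsilon> p (basis_vec I) = smult_vec (of_int (step_weight (heap_step p) I)) (basis_vec I)"
proof -
  have bi: "bi_unique (heap_step p)" "bi_unique (heap_step p)\<inverse>\<inverse>"
    using bi_unique_heap_step[OF p] by (simp_all add: bi_unique_def)
  have X: "X_op \<epsilon> p (basis_vec I) \<noteq> 0 \<longleftrightarrow> (\<exists>J. heap_step p I J)"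
    unfolding X_op_eq[OF p basis_vec_in_heap_space[OF I]]
    using part_op_basis_vec[OF bi(1)] part_op_basis_vec_0[of "heap_step p" I] by fastforce
  have Y: "Y_op \<epsilon> p (basis_vec I) \<noteq> 0 \<longleftrightarrow> (\<exists>J. heap_step p J I)"
    unfolding Y_op_eq[OF p basis_vec_in_heap_space[OF I]]
    using part_op_basis_vec[OF bi(2)] part_op_basis_vec_0[of "(heap_step p)\<inverse>\<inverse>" I] by fastforce
  have "\<not> ((\<exists>J. heap_step p I J) \<and> (\<exists>J. heap_step p J I))"
    using no_double_heap_step[OF p] by blast
  then show ?thesis by (auto simp: H_op_def X Y step_weight_def)
qed

end

section \<open>The module on the proper ideals\<close>

locale numbered_full_heap = cartan_heap l A \<epsilon>
  for l A and \<epsilon> :: "'e::order \<Rightarrow> nat" +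
  fixes E0 :: "int \<Rightarrow> 'e"
  assumes mono_E0: "strict_mono E0" and range_E0: "range E0 = {\<alpha>. \<epsilon> \<alpha> = 0}"
begin

lemma heap_height_gap:
  assumes "gap 0 I (E0 s) b"
  shows "heap_height E0 I = s"
proof -
  have label: "\<epsilon> (E0 t) = 0" for t using range_E0 by auto
  have "E0 t \<in> I \<longleftrightarrow> t \<le> s" for t
    using assms label strict_mono_less_eq[OF mono_E0] unfolding gap_def by blast
  then show ?thesis unfolding heap_height_def by (intro Greatest_equality) auto
qed

text \<open>
  The two ends of the gap of label \<open>0\<close> carry consecutive numbers, as no element labelled \<open>0\<close> lies between
  them.
\<close>

lemma heap_height_step:
  assumes q: "q \<le> l" and J: "heap_step q I J"
  shows "heap_height E0 J = heap_height E0 I + of_bool (q = 0)"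
proof (cases "q = 0")
  case True
  obtain a b b' where g: "gap q I a b" "J = insert b I" "gap q J b b'"
    using heap_step_gap[OF J q] .
  have "a \<in> range E0" "b \<in> range E0" using gapD(1,2)[OF g(1)] True by (auto simp: range_E0)
  then obtain s t where s: "a = E0 s" and t: "b = E0 t" by blast
  have "s < t" using gapD(5)[OF g(1)] s t strict_mono_less[OF mono_E0] by simp
  moreover have "\<not> s + 1 < t"
  proof
    assume "s + 1 < t"
    then have "a < E0 (s + 1)" "E0 (s + 1) < b" using s t strict_mono_less[OF mono_E0] by auto
    moreover have "\<epsilon> (E0 (s + 1)) = q" using range_E0 True by auto
    ultimately show False using gap_no_label[OF g(1)] by blast
  qed
  ultimately have "t = s + 1" by simp
  moreover have "heap_height E0 I = s" "heap_height E0 J = t"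
    using g(1,3) s t True by (auto intro: heap_height_gap)
  ultimately show ?thesis using True by simp
next
  case False
  obtain a b where g: "gap 0 I a b"
    using gap_exists[of I 0] heap_step_mem[OF J] by blast
  have "a \<in> range E0" using gapD(1)[OF g] by (simp add: range_E0)
  then obtain s where "a = E0 s" by blast
  then have "heap_height E0 I = s" "heap_height E0 J = s"
    using g gap_other_label[OF J, of 0 a b] False heap_height_gap by auto
  then show ?thesis using False by simp
qed

sublocale crystal: minuscule_crystal l A P heap_step "heap_height E0"
  by (unfold_locales, fact cartan,
      (rule heap_step_mem; assumption),
      (rule bi_unique_heap_step; assumption),
      (rule no_double_heap_step; assumption),
      (rule step_weight_change; assumption),
      (rule heap_height_step; assumption),
      (rule heap_step_diamond; assumption),
      (rule heap_step_commute; assumption),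
      (rule no_triple_heap_step; assumption))

lemma coweight_op_basis_vec:
  assumes I: "I \<in> P"
  shows "coweight_op l \<epsilon> E0 h (basis_vec I) = smult_vec (of_int (crystal.wt h I)) (basis_vec I)"
proof -
  have "coweight_op l \<epsilon> E0 h (basis_vec I) =
      (\<Sum>i\<le>l. smult_vec (of_int (Poly_Mapping.lookup h i)) (smult_vec (of_int (step_weight (heap_step i) I)) (basis_vec I))) +
      smult_vec (of_int (Poly_Mapping.lookup h (l + 1))) (smult_vec (of_int (heap_height E0 I)) (basis_vec I))"
    unfolding coweight_op_def by (simp add: H_op_basis_vec[OF _ I] D_op_def)
  also have "\<dots> = smult_vec (of_int (crystal.wt h I)) (basis_vec I)"
    by (simp add: crystal.wt_def vec.scale_left_distrib vec.scale_sum_left)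
  finally show ?thesis .
qed

lemma M_eq: "crystal.M = heap_space l \<epsilon>"
  by (simp add: crystal.M_def heap_space_def)

end

lemma crystal_lattice_eq: "crystal_lattice l \<epsilon> = basis_lattice (proper_ideals l \<epsilon>)"
proof
  show "crystal_lattice l \<epsilon> \<subseteq> basis_lattice (proper_ideals l \<epsilon>)"
    unfolding crystal_lattice_def
    by (auto intro!: basis_lattice_sum basis_lattice_closed basis_vec_in_lattice)
  show "basis_lattice (proper_ideals l \<epsilon>) \<subseteq> crystal_lattice l \<epsilon>"
  proof
    fix v assume "v \<in> basis_lattice (proper_ideals l \<epsilon>)"
    then have "Poly_Mapping.keys v \<subseteq> proper_ideals l \<epsilon>" "\<forall>I. Poly_Mapping.lookup v I \<in> A0"
      by (auto simp: basis_lattice_def)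
    then show "v \<in> crystal_lattice l \<epsilon>"
      unfolding crystal_lattice_def using vec_expand[of v] finite_keys[of v] by blast
  qed
qed

theorem theorem8p3:
  fixes l :: nat
    and A :: "nat \<Rightarrow> nat \<Rightarrow> int"
    and \<epsilon> :: "'e::order \<Rightarrow> nat"
    and E0 :: "int \<Rightarrow> 'e"
  assumes "gen_cartan_matrix l A"
    and "untwisted_affine l A"
    and "full_heap l A \<epsilon>"
    and "simply_folded l A \<epsilon>"
    and "strict_mono E0"
    and "range E0 = {\<alpha>. \<epsilon> \<alpha> = 0}"
  shows "\<exists>act.
    quantum_affine_module smult_vec l A (heap_space l \<epsilon>) act \<and>
    (\<forall>i\<le>l. \<forall>v\<in>heap_space l \<epsilon>.
       act (quantum_class l A (fE i)) v = X_op \<epsilon> i v \<and>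
       act (quantum_class l A (fF i)) v = Y_op \<epsilon> i v) \<and>
    (\<forall>h\<in>coroot_lattice l. \<forall>I\<in>proper_ideals l \<epsilon>. \<exists>\<nu>::int.
       coweight_op l \<epsilon> E0 h (basis_vec I) = smult_vec (of_int \<nu>) (basis_vec I) \<and>
       act (quantum_class l A (fK h)) (basis_vec I) = smult_vec (qq powi \<nu>) (basis_vec I)) \<and>
    quantum_affine_module.integrable smult_vec l A (heap_space l \<epsilon>) act \<and>
    quantum_affine_module.A0_basis smult_vec (basis_vec ` proper_ideals l \<epsilon>) (crystal_lattice l \<epsilon>) \<and>
    inj_on (quantum_affine_module.q_coset smult_vec (crystal_lattice l \<epsilon>) \<circ> basis_vec)
      (proper_ideals l \<epsilon>) \<and>
    quantum_affine_module.crystal_basis smult_vec l A (heap_space l \<epsilon>) act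
      (crystal_lattice l \<epsilon>)
      ((quantum_affine_module.q_coset smult_vec (crystal_lattice l \<epsilon>) \<circ> basis_vec) `
        proper_ideals l \<epsilon>)"
proof -
  interpret numbered_full_heap l A \<epsilon> E0
    by unfold_locales (fact assms)+
  note identify = crystal_lattice_eq M_eq[symmetric] crystal.crystal_elt_conv_comp
  have E: "crystal.rep.act (quantum_class l A (fE i)) v = X_op \<epsilon> i v"
    and F: "crystal.rep.act (quantum_class l A (fF i)) v = Y_op \<epsilon> i v"
    if "i \<le> l" "v \<in> heap_space l \<epsilon>" for i v
    using crystal.E_act[of i v] crystal.F_act[of i v] that
    by (simp_all add: M_eq X_op_eq Y_op_eq crystal.module.E_act_def crystal.module.F_act_def)
  have K: "\<exists>\<nu>::int. coweight_op l \<epsilon> E0 h (basis_vec I) = smult_vec (of_int \<nu>) (basis_vec I) \<and>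
      crystal.rep.act (quantum_class l A (fK h)) (basis_vec I) = smult_vec (qq powi \<nu>) (basis_vec I)"
    if "h \<in> coroot_lattice l" "I \<in> proper_ideals l \<epsilon>" for h I
  proof (intro exI conjI)
    show "coweight_op l \<epsilon> E0 h (basis_vec I) = smult_vec (of_int (crystal.wt h I)) (basis_vec I)"
      by (rule coweight_op_basis_vec[OF that(2)])
    show "crystal.rep.act (quantum_class l A (fK h)) (basis_vec I) =
        smult_vec (qq powi crystal.wt h I) (basis_vec I)"
      using crystal.K_act[OF that(1), of "basis_vec I"] basis_vec_in_heap_space[OF that(2)]
      by (simp add: M_eq diag_op_basis_vec crystal.module.K_act_def)
  qed
  show ?thesis
    unfolding identify
    using crystal.module.quantum_affine_module_axioms E F K crystal.integrable crystal.A0_basis_L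
      crystal.inj_crystal_elt crystal.crystal_basis
    by (intro exI[of _ crystal.rep.act] conjI ballI allI impI) (simp_all add: M_eq[symmetric])
qed

end
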